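(* Let $M$ be a connected $C^\infty$-smooth Riemannian manifold of dimension $n\ge 2$. For any $N\ge 1$ and sufficiently large $\ell$, there is a set of $s$-tuples of vector fields $(f_1,\dots,f_s)$ which is residual in $(\mathrm{Vect}\,M)^s$ in the Whitney $C^\ell$-topology, such that for any $(f_1,\dots,f_s)$ from this set the $N$-folds $(f_1^N,\dots,f_s^N)$ are bracket generating at each point of $M^{(N)}=M^N\setminus\Delta^N$.
   Context: $\mathrm{Vect}\,M$ is the space of smooth vector fields on $M$, and $s$ is the number of vector fields $f_1,\dots,f_s$ defining the control-linear system $\dot x=\sum_{j=1}^s f_j(x)u_j(t)$ on $M$. $\Delta^N\subset M^N$ is the set of $N$-tuples $(x_1,\dots,x_N)$ with $x_i=x_j$ for some $i\ne j$; thus $M^{(N)}=M^N\setminus\Delta^N$ is the set of $N$-tuples of pairwise distinct points, an open submanifold of $M^N$ with $T_\gamma M^{(N)}=T_{\gamma_1}M\times\cdots\times T_{\gamma_N}M$ for $\gamma=(\gamma_1,\dots,\gamma_N)$. The $N$-fold of $X\in\mathrm{Vect}\,M$ is the vector field $X^N$ on $M^{(N)}$ given by $X^N(x_1,\dots,x_N)=(X(x_1),\dots,X(x_N))$. One has $[X^N,Y^N]=[X,Y]^N$, and likewise for iterated brackets. Vector fields $f_1^N,\dots,f_s^N$ are bracket generating at $\gamma\in M^{(N)}$ if the evaluations at $\gamma$ of their iterated Lie brackets (of all orders, including the fields themselves) span $T_\gamma M^{(N)}$. A set is residual if it contains a countable intersection of open dense sets.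
   Formalization: The number s of vector fields is assumed to be at least 2; with s ≤ 1 the iterated brackets span at most a line in a tangent space of dimension nN ≥ 2, so no tuple has the bracket generating property. *)

theory Defs
  imports "HOL-Analysis.Analysis"
begin

section \<open>Smooth functions between Euclidean spaces\<close>

primrec iter_deriv ::
  "'a::real_normed_vector list \<Rightarrow> ('a \<Rightarrow> 'b::real_normed_vector) \<Rightarrow> 'a \<Rightarrow> 'b" where
  "iter_deriv [] f = f"
| "iter_deriv (v # vs) f = (\<lambda>x. frechet_derivative (iter_deriv vs f) (at x) v)"

text \<open>
  Only used for open \<open>S\<close>. Every iterated directional derivative is required to be
  differentiable, hence continuous, on \<open>S\<close>; this is smoothness of class \<open>C\<^sup>\<infinity>\<close>.
\<close>

definition smooth_on ::
  "'a::real_normed_vector set \<Rightarrow> ('a \<Rightarrow> 'b::real_normed_vector) \<Rightarrow> bool" where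
  "smooth_on S f \<longleftrightarrow> (\<forall>vs. \<forall>x\<in>S. iter_deriv vs f differentiable (at x))"


section \<open>Smooth manifolds\<close>

text \<open>
  A chart is a pair of a domain and a map which is only relevant on the domain. The underlying
  set of a manifold is an open subset of the type \<open>'m\<close>, namely the union of the domains of the
  charts in the atlas. The model space is an arbitrary Euclidean space \<open>'e\<close>, so that the
  dimension of the manifold is \<open>DIM('e)\<close>.
\<close>

type_synonym ('m, 'e) chart = "'m set \<times> ('m \<Rightarrow> 'e)"

definition is_chart :: "('m::topological_space, 'e::euclidean_space) chart \<Rightarrow> bool" where
  "is_chart c \<longleftrightarrow> open (fst c) \<and> open (snd c ` fst c) \<and>
     homeomorphism (fst c) (snd c ` fst c) (snd c) (inv_into (fst c) (snd c))"

definition smooth_transition ::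
  "('m::topological_space, 'e::euclidean_space) chart \<Rightarrow> ('m, 'e) chart \<Rightarrow> bool" where
  "smooth_transition c d \<longleftrightarrow>
     smooth_on (snd c ` (fst c \<inter> fst d)) (snd d \<circ> inv_into (fst c) (snd c))"

definition smooth_atlas :: "('m::topological_space, 'e::euclidean_space) chart set \<Rightarrow> bool" where
  "smooth_atlas A \<longleftrightarrow> (\<forall>c\<in>A. is_chart c) \<and> (\<forall>c\<in>A. \<forall>d\<in>A. smooth_transition c d)"

definition carrier_of :: "('m, 'e) chart set \<Rightarrow> 'm set" where
  "carrier_of A = \<Union> (fst ` A)"

definition maximal_atlas ::
  "('m::topological_space, 'e::euclidean_space) chart set \<Rightarrow> ('m, 'e) chart set" where
  "maximal_atlas A = {c. is_chart c \<and> fst c \<subseteq> carrier_of A \<and>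
     (\<forall>d\<in>A. smooth_transition c d \<and> smooth_transition d c)}"

text \<open>Smooth real functions on an open subset \<open>U\<close> of the manifold, and near a point.\<close>

definition smooth_fun ::
  "('m::topological_space, 'e::euclidean_space) chart set \<Rightarrow> 'm set \<Rightarrow> ('m \<Rightarrow> real) \<Rightarrow> bool" where
  "smooth_fun A U f \<longleftrightarrow>
     (\<forall>c\<in>A. smooth_on (snd c ` (fst c \<inter> U)) (f \<circ> inv_into (fst c) (snd c)))"

definition smooth_near ::
  "('m::topological_space, 'e::euclidean_space) chart set \<Rightarrow> 'm \<Rightarrow> ('m \<Rightarrow> real) \<Rightarrow> bool" where
  "smooth_near A p f \<longleftrightarrow> (\<exists>U. open U \<and> p \<in> U \<and> U \<subseteq> carrier_of A \<and> smooth_fun A U f)"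


section \<open>Tangent vectors, vector fields, Lie brackets\<close>

text \<open>
  Tangent vectors at \<open>p\<close> are the derivations on germs of smooth functions at \<open>p\<close>. Since they are
  total functions in HOL, they are normalised to be \<open>0\<close> on functions not smooth near \<open>p\<close>.
\<close>

type_synonym 'm tangent = "('m \<Rightarrow> real) \<Rightarrow> real"

definition tangent_space ::
  "('m::topological_space, 'e::euclidean_space) chart set \<Rightarrow> 'm \<Rightarrow> 'm tangent set" where
  "tangent_space A p = {v.
     (\<forall>f. \<not> smooth_near A p f \<longrightarrow> v f = 0) \<and>
     (\<forall>f g. smooth_near A p f \<and> smooth_near A p g \<and> (\<forall>\<^sub>F x in nhds p. f x = g x)
        \<longrightarrow> v f = v g) \<and>
     (\<forall>f g a b. smooth_near A p f \<and> smooth_near A p g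
        \<longrightarrow> v (\<lambda>x. a * f x + b * g x) = a * v f + b * v g) \<and>
     (\<forall>f g. smooth_near A p f \<and> smooth_near A p g
        \<longrightarrow> v (\<lambda>x. f x * g x) = f p * v g + g p * v f)}"

text \<open>Smooth vector fields, normalised to vanish outside the manifold.\<close>

definition vector_fields ::
  "('m::topological_space, 'e::euclidean_space) chart set \<Rightarrow> ('m \<Rightarrow> 'm tangent) set" where
  "vector_fields A = {X.
     (\<forall>p\<in>carrier_of A. X p \<in> tangent_space A p) \<and>
     (\<forall>p. p \<notin> carrier_of A \<longrightarrow> X p = (\<lambda>f. 0)) \<and>
     (\<forall>U f. open U \<and> U \<subseteq> carrier_of A \<and> smooth_fun A U f
        \<longrightarrow> smooth_fun A U (\<lambda>p. X p f))}"

definition lie_bracket ::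
  "('m::topological_space, 'e::euclidean_space) chart set
     \<Rightarrow> ('m \<Rightarrow> 'm tangent) \<Rightarrow> ('m \<Rightarrow> 'm tangent) \<Rightarrow> 'm \<Rightarrow> 'm tangent" where
  "lie_bracket A X Y p f =
     (if smooth_near A p f then X p (\<lambda>q. Y q f) - Y p (\<lambda>q. X q f) else 0)"

inductive_set iterated_brackets ::
  "('m::topological_space, 'e::euclidean_space) chart set
     \<Rightarrow> ('m \<Rightarrow> 'm tangent) set \<Rightarrow> ('m \<Rightarrow> 'm tangent) set"
  for A F where
  base: "X \<in> F \<Longrightarrow> X \<in> iterated_brackets A F"
| bracket: "X \<in> iterated_brackets A F \<Longrightarrow> Y \<in> iterated_brackets A F
    \<Longrightarrow> lie_bracket A X Y \<in> iterated_brackets A F"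

definition bracket_generating_at ::
  "('m::topological_space, 'e::euclidean_space) chart set
     \<Rightarrow> ('m \<Rightarrow> 'm tangent) set \<Rightarrow> 'm \<Rightarrow> bool" where
  "bracket_generating_at A F p \<longleftrightarrow>
     (\<forall>v\<in>tangent_space A p. \<exists>S a. finite S \<and> S \<subseteq> iterated_brackets A F \<and>
        v = (\<lambda>f. \<Sum>X\<in>S. a X * X p f))"

definition riemannian_metric ::
  "('m::topological_space, 'e::euclidean_space) chart set
     \<Rightarrow> ('m \<Rightarrow> 'm tangent \<Rightarrow> 'm tangent \<Rightarrow> real) \<Rightarrow> bool" where
  "riemannian_metric A g \<longleftrightarrow>
     (\<forall>p\<in>carrier_of A.
        (\<forall>u\<in>tangent_space A p. \<forall>v\<in>tangent_space A p. \<forall>w\<in>tangent_space A p. \<forall>a b.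
           g p (\<lambda>f. a * u f + b * v f) w = a * g p u w + b * g p v w) \<and>
        (\<forall>u\<in>tangent_space A p. \<forall>v\<in>tangent_space A p. g p u v = g p v u) \<and>
        (\<forall>u\<in>tangent_space A p. u \<noteq> (\<lambda>f. 0) \<longrightarrow> g p u u > 0)) \<and>
     (\<forall>X\<in>vector_fields A. \<forall>Y\<in>vector_fields A.
        smooth_fun A (carrier_of A) (\<lambda>p. g p (X p) (Y p)))"


section \<open>The Whitney topology on vector fields\<close>

text \<open>
  The coordinate expression of a vector field in a chart: the components of a derivation are its
  values on the coordinate functions.
\<close>

definition chart_rep ::
  "('m, 'e::euclidean_space) chart \<Rightarrow> ('m \<Rightarrow> 'm tangent) \<Rightarrow> 'e \<Rightarrow> 'e" where
  "chart_rep c X y =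
     (\<Sum>b\<in>Basis. X (inv_into (fst c) (snd c) y) (\<lambda>x. snd c x \<bullet> b) *\<^sub>R b)"

text \<open>
  Basic neighbourhoods of the Whitney (strong) \<open>C\<^sup>l\<close> topology are given by a locally finite family
  of charts \<open>c\<close>, each with a compact subset \<open>K\<close> of its domain and a bound \<open>\<epsilon>\<close> on the difference
  of all partial derivatives of order at most \<open>l\<close> over \<open>K\<close>.
\<close>

definition whitney_family ::
  "('m::topological_space, 'e::euclidean_space) chart set
     \<Rightarrow> (('m, 'e) chart \<times> 'm set \<times> real) set \<Rightarrow> bool" where
  "whitney_family A \<F> \<longleftrightarrow>
     (\<forall>(c, K, \<epsilon>)\<in>\<F>. c \<in> maximal_atlas A \<and> compact K \<and> K \<subseteq> fst c \<and> \<epsilon> > 0) \<and>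
     (\<forall>p\<in>carrier_of A. \<exists>W. open W \<and> p \<in> W \<and> finite {t\<in>\<F>. fst (fst t) \<inter> W \<noteq> {}})"

definition whitney_nbhd ::
  "('m::topological_space, 'e::euclidean_space) chart set \<Rightarrow> nat
     \<Rightarrow> (('m, 'e) chart \<times> 'm set \<times> real) set \<Rightarrow> ('m \<Rightarrow> 'm tangent) \<Rightarrow> ('m \<Rightarrow> 'm tangent) set" where
  "whitney_nbhd A l \<F> X = {Y\<in>vector_fields A.
     \<forall>(c, K, \<epsilon>)\<in>\<F>. \<forall>vs. set vs \<subseteq> Basis \<and> length vs \<le> l \<longrightarrow>
       (\<forall>y\<in>snd c ` K.
          norm (iter_deriv vs (chart_rep c Y) y - iter_deriv vs (chart_rep c X) y) < \<epsilon>)}"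

definition whitney_topology ::
  "('m::topological_space, 'e::euclidean_space) chart set \<Rightarrow> nat \<Rightarrow> ('m \<Rightarrow> 'm tangent) topology" where
  "whitney_topology A l = topology_generated_by
     {whitney_nbhd A l \<F> X | \<F> X. whitney_family A \<F> \<and> X \<in> vector_fields A}"

lemma topspace_whitney_topology [simp]: "topspace (whitney_topology A l) = vector_fields A"
proof
  show "topspace (whitney_topology A l) \<subseteq> vector_fields A"
    by (auto simp: whitney_topology_def topology_generated_by_topspace whitney_nbhd_def)
  show "vector_fields A \<subseteq> topspace (whitney_topology A l)"
  proof
    fix X assume X: "X \<in> vector_fields A"
    have "whitney_family A {}"
      unfolding whitney_family_def by (auto intro!: exI[of _ UNIV])
    moreover have "X \<in> whitney_nbhd A l {} X"
      using X by (simp add: whitney_nbhd_def)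
    ultimately show "X \<in> topspace (whitney_topology A l)"
      using X unfolding whitney_topology_def topology_generated_by_topspace by blast
  qed
qed

definition residual_in :: "'a topology \<Rightarrow> 'a set \<Rightarrow> bool" where
  "residual_in T R \<longleftrightarrow> R \<subseteq> topspace T \<and>
     (\<exists>\<G>. countable \<G> \<and> (\<forall>G\<in>\<G>. openin T G \<and> T closure_of G = topspace T) \<and>
        topspace T \<inter> \<Inter>\<G> \<subseteq> R)"


section \<open>Configuration spaces and N-folds of vector fields\<close>

text \<open>The finite index type \<open>'k\<close> enumerates the points of a configuration: \<open>N = CARD('k)\<close>.\<close>

definition fat_diagonal :: "('m, 'e) chart set \<Rightarrow> ('m ^ 'k) set" where
  "fat_diagonal A = {x. (\<forall>i. x $ i \<in> carrier_of A) \<and> (\<exists>i j. i \<noteq> j \<and> x $ i = x $ j)}"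

definition config_space :: "('m, 'e) chart set \<Rightarrow> ('m ^ 'k) set" where
  "config_space A = {x. \<forall>i. x $ i \<in> carrier_of A} - fat_diagonal A"

text \<open>The product charts restricted to the configuration space.\<close>

definition config_atlas :: "('m, 'e) chart set \<Rightarrow> ('m ^ 'k, 'e ^ 'k) chart set" where
  "config_atlas A = {({x. \<forall>i. x $ i \<in> fst (c i)} - fat_diagonal A, \<lambda>x. \<chi> i. snd (c i) (x $ i)) | c.
     \<forall>i. c i \<in> A}"

lemma carrier_of_config_atlas:
  fixes A :: "('m, 'e) chart set"
  shows "carrier_of (config_atlas A) = (config_space A :: ('m ^ 'k) set)"
proof (intro set_eqI iffI)
  fix x :: "'m ^ 'k"
  assume "x \<in> carrier_of (config_atlas A)"
  then obtain c where c: "\<And>i. c i \<in> A" "\<And>i. x $ i \<in> fst (c i)" "x \<notin> fat_diagonal A"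
    by (auto simp: carrier_of_def config_atlas_def)
  then have "x $ i \<in> carrier_of A" for i
    unfolding carrier_of_def by blast
  with c(3) show "x \<in> config_space A"
    by (simp add: config_space_def)
next
  fix x :: "'m ^ 'k"
  assume x: "x \<in> config_space A"
  then have "\<exists>d. d \<in> A \<and> x $ i \<in> fst d" for i
    by (simp add: config_space_def carrier_of_def Bex_def)
  then obtain c where c: "\<And>i. c i \<in> A" "\<And>i. x $ i \<in> fst (c i)"
    by metis
  let ?U = "{x. \<forall>i. x $ i \<in> fst (c i)} - fat_diagonal A"
  let ?d = "(?U, \<lambda>x. \<chi> i. snd (c i) (x $ i))"
  have "?d \<in> config_atlas A"
    using c(1) unfolding config_atlas_def by blast
  moreover have "x \<in> fst ?d"
    using c(2) x by (simp add: config_space_def)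
  ultimately show "x \<in> carrier_of (config_atlas A)"
    unfolding carrier_of_def by (rule UN_I)
qed

text \<open>
  The tangent vector \<open>(X (\<gamma> $ i))\<^sub>i\<close> of the configuration space at \<open>\<gamma>\<close>, acting as a derivation:
  the component with index \<open>i\<close> differentiates in the \<open>i\<close>-th point, the others being frozen.
\<close>

definition nfold ::
  "('m::topological_space, 'e::euclidean_space) chart set
     \<Rightarrow> ('m \<Rightarrow> 'm tangent) \<Rightarrow> 'm ^ 'k \<Rightarrow> ('m ^ 'k) tangent" where
  "nfold A X \<gamma> f =
     (if smooth_near (config_atlas A) \<gamma> f
      then \<Sum>i\<in>UNIV. X (\<gamma> $ i) (\<lambda>y. f (\<chi> j. if j = i then y else \<gamma> $ j))
      else 0)"

end

theory Submission
  imports Defs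
begin

text \<open>
  Only the first two fields \<open>f\<^sub>0\<close>, \<open>f\<^sub>1\<close> are needed. Generically they have no common zero, since this
  is \<open>2n\<close> conditions on \<open>n\<close> coordinates; then, for every configuration of \<open>N\<close> points, some
  \<open>Y = f\<^sub>0 + a f\<^sub>1\<close> with \<open>a \<in> {0, \<dots>, N}\<close> vanishes at none of them. Consider the brackets
  \<open>ad\<^sub>Y\<^sup>k f\<^sub>1\<close> for \<open>k < 2nN\<close>. Perturbing \<open>f\<^sub>1\<close> by \<open>h\<close> and \<open>f\<^sub>0\<close> by \<open>- a h\<close>, with \<open>h\<close> a bump function times
  a polynomial of degree less than \<open>2nN\<close> near each of the points, does not change \<open>Y\<close>, and makes
  the \<open>nN \<times> 2nN\<close> matrix of these brackets on the configuration range bijectively and affinely over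
  all matrices. Matrices of rank less than \<open>nN\<close> have codimension \<open>nN + 1\<close>, more than the
  dimension \<open>nN\<close> of the configuration space, so that for almost every perturbation the brackets
  span at every configuration of a given compact set. This makes the spanning condition dense over
  compact sets, over which it is also open in the \<open>C\<^sup>l\<close> topology for \<open>l \<ge> 2nN - 1\<close>, and countably
  many compact sets cover the configuration space.
\<close>

subsection \<open>Functions of class \<open>C\<^sup>n\<close>\<close>

text \<open>A single Y cannot serve everywhere, because the topology of M may force it to vanish
  somewhere. So \<open>a\<close> depends on the configuration, and one choice is valid only on a
  small compact piece of a box. The pieces are treated one after another, and openness protects
  those already done. Nonvanishing of Y is what makes the matrix of brackets surjective: near a
  point Y is transversal to the level sets of a linear coordinate, so bracketing with Y lowers by
  exactly one the order to which a polynomial in this coordinate vanishes there. A polynomial of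
  degree less than m whose first m brackets vanish at the point is therefore zero, and m
  coefficients match m brackets. The number 2nN comes from the count: for m brackets, matrices of
  rank below d = nN have codimension m - d + 1, which exceeds the dimension d of the configuration
  space exactly from m = 2d on. The count is made without transversality theory: a degenerate
  parameter is recovered by a locally Lipschitz map from a code in a hyperplane, which is a null
  set.\<close>

lemma frechet_derivative_eqI: "(f has_derivative D) (at x) \<Longrightarrow> frechet_derivative f (at x) = D"
  using frechet_derivative_at by metis

lemma frechet_derivative_transform_open:
  assumes "open S" "x \<in> S" "\<And>y. y \<in> S \<Longrightarrow> f y = g y"
  shows "frechet_derivative f (at x) = frechet_derivative g (at x)"
proof -
  have "(f has_derivative D) (at x) \<longleftrightarrow> (g has_derivative D) (at x)" for D
    using assms has_derivative_transform_within_open[of f D x UNIV S g]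
      has_derivative_transform_within_open[of g D x UNIV S f] by auto
  then show ?thesis by (simp add: frechet_derivative_def)
qed

lemma differentiable_transform_open:
  assumes "open S" "x \<in> S" "\<And>y. y \<in> S \<Longrightarrow> f y = g y" "f differentiable (at x)"
  shows "g differentiable (at x)"
  using assms has_derivative_transform_within_open[of f _ x UNIV S g]
  unfolding differentiable_def by blast

lemma iter_deriv_cong_open:
  assumes "open S" "\<And>y. y \<in> S \<Longrightarrow> f y = g y" "x \<in> S"
  shows "iter_deriv vs f x = iter_deriv vs g x"
  using assms(3)
proof (induction vs arbitrary: x)
  case (Cons v vs)
  show ?case
    using frechet_derivative_transform_open[OF assms(1) Cons.prems, of "iter_deriv vs f" "iter_deriv vs g"] Cons.IH
    by simp
qed (simp add: assms)

lemma iter_deriv_append: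
  "iter_deriv (vs @ ws) f = iter_deriv vs (iter_deriv ws f)"
  by (induction vs) auto

lemma iter_deriv_snoc:
  "iter_deriv (vs @ [v]) f = iter_deriv vs (\<lambda>x. frechet_derivative f (at x) v)"
  by (simp add: iter_deriv_append)

text \<open>An order-bounded form of \<open>smooth_on\<close>, introduced for induction: by the
  product and chain rules, the first derivative of a product or composite is an expression in the
  factors and their first derivatives, to which the case of order n applies. The count is shifted by
  one: order 0 already means differentiable.\<close>

definition times_diff_on ::
  "nat \<Rightarrow> 'a::real_normed_vector set \<Rightarrow> ('a \<Rightarrow> 'b::real_normed_vector) \<Rightarrow> bool" where
  "times_diff_on n S f \<longleftrightarrow> (\<forall>vs. length vs \<le> n \<longrightarrow> (\<forall>x\<in>S. iter_deriv vs f differentiable (at x)))"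

lemma smooth_on_iff_times_diff: "smooth_on S f \<longleftrightarrow> (\<forall>n. times_diff_on n S f)"
  unfolding smooth_on_def times_diff_on_def by blast

lemma times_diff_on_0: "times_diff_on 0 S f \<longleftrightarrow> (\<forall>x\<in>S. f differentiable (at x))"
  by (simp add: times_diff_on_def)

text \<open>\<open>iter_deriv\<close> applies the head of the list last. Peeling off the last entry
  instead turns the innermost derivative into a new function of order n, so that the derivative of f
  is computed once and the induction hypothesis is applied to the result.\<close>

lemma times_diff_on_Suc:
  "times_diff_on (Suc n) S f \<longleftrightarrow> (\<forall>x\<in>S. f differentiable (at x)) \<and>
     (\<forall>v. times_diff_on n S (\<lambda>x. frechet_derivative f (at x) v))"
proof
  assume L: "times_diff_on (Suc n) S f"
  have "times_diff_on n S (\<lambda>x. frechet_derivative f (at x) v)" for v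
    unfolding times_diff_on_def
  proof safe
    fix vs :: "'a list" and x assume "length vs \<le> n" "x \<in> S"
    then show "iter_deriv vs (\<lambda>x. frechet_derivative f (at x) v) differentiable at x"
      using L[unfolded times_diff_on_def, rule_format, of "vs @ [v]" x] by (simp add: iter_deriv_snoc)
  qed
  moreover have "\<forall>x\<in>S. f differentiable (at x)"
    using L[unfolded times_diff_on_def, rule_format, of "[]"] by simp
  ultimately show "(\<forall>x\<in>S. f differentiable (at x)) \<and>
     (\<forall>v. times_diff_on n S (\<lambda>x. frechet_derivative f (at x) v))" by blast
next
  assume R: "(\<forall>x\<in>S. f differentiable (at x)) \<and>
     (\<forall>v. times_diff_on n S (\<lambda>x. frechet_derivative f (at x) v))"
  show "times_diff_on (Suc n) S f" unfolding times_diff_on_def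
  proof safe
    fix vs :: "'a list" and x assume *: "length vs \<le> Suc n" "x \<in> S"
    show "iter_deriv vs f differentiable at x"
    proof (cases vs rule: rev_cases)
      case (snoc ws v)
      then show ?thesis using * R by (auto simp: iter_deriv_snoc times_diff_on_def)
    qed (use * R in auto)
  qed
qed

lemma times_diff_on_mono: "times_diff_on n S f \<Longrightarrow> m \<le> n \<Longrightarrow> T \<subseteq> S \<Longrightarrow> times_diff_on m T f"
  unfolding times_diff_on_def by (meson le_trans subsetD)

lemma times_diff_on_SucD: "times_diff_on (Suc n) S f \<Longrightarrow> times_diff_on n S f"
  by (rule times_diff_on_mono) auto

lemma times_diff_on_cong:
  assumes "open S" "\<And>y. y \<in> S \<Longrightarrow> f y = g y" "times_diff_on n S f"
  shows "times_diff_on n S g"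
  unfolding times_diff_on_def
proof safe
  fix vs :: "'a list" and x assume *: "length vs \<le> n" "x \<in> S"
  then have "iter_deriv vs f differentiable at x" using assms(3) by (auto simp: times_diff_on_def)
  then show "iter_deriv vs g differentiable at x"
    by (rule differentiable_transform_open[OF assms(1) *(2), rotated])
      (rule iter_deriv_cong_open[OF assms(1,2)])
qed

lemma frechet_derivative_add:
  "f differentiable (at x) \<Longrightarrow> g differentiable (at x) \<Longrightarrow>
    frechet_derivative (\<lambda>x. f x + g x) (at x) = (\<lambda>v. frechet_derivative f (at x) v + frechet_derivative g (at x) v)"
  by (intro frechet_derivative_eqI has_derivative_add) (simp_all add: frechet_derivative_works[symmetric])

lemma times_diff_on_add:
  "open S \<Longrightarrow> times_diff_on n S f \<Longrightarrow> times_diff_on n S g \<Longrightarrow> times_diff_on n S (\<lambda>x. f x + g x)"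
proof (induction n arbitrary: f g)
  case (Suc n)
  note d = Suc.prems(2,3)[unfolded times_diff_on_Suc]
  show ?case unfolding times_diff_on_Suc
  proof safe
    fix v
    have "times_diff_on n S (\<lambda>x. frechet_derivative f (at x) v + frechet_derivative g (at x) v)"
      using Suc.IH[OF Suc.prems(1)] d by blast
    then show "times_diff_on n S (\<lambda>x. frechet_derivative (\<lambda>x. f x + g x) (at x) v)"
      by (rule times_diff_on_cong[OF Suc.prems(1), rotated]) (use d in \<open>simp add: frechet_derivative_add\<close>)
  qed (use d in auto)
qed (auto simp: times_diff_on_0)

lemma times_diff_on_const: "times_diff_on n S (\<lambda>x. c)"
proof (induction n arbitrary: c)
  case (Suc n) then show ?case by (auto simp: times_diff_on_Suc)
qed (auto simp: times_diff_on_0)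

lemma times_diff_on_sum:
  "open S \<Longrightarrow> (\<And>i. i \<in> I \<Longrightarrow> times_diff_on n S (f i)) \<Longrightarrow> times_diff_on n S (\<lambda>x. \<Sum>i\<in>I. f i x)"
  by (induction I rule: infinite_finite_induct) (auto simp: times_diff_on_const intro!: times_diff_on_add)

lemma times_diff_on_bilinear:
  assumes P: "bounded_bilinear P"
  shows "open S \<Longrightarrow> times_diff_on n S f \<Longrightarrow> times_diff_on n S g \<Longrightarrow> times_diff_on n S (\<lambda>x. P (f x) (g x))"
proof (induction n arbitrary: f g)
  case 0
  show ?case unfolding times_diff_on_0
  proof
    fix x assume "x \<in> S"
    with 0 obtain D E where "(f has_derivative D) (at x)" "(g has_derivative E) (at x)"
      unfolding times_diff_on_0 differentiable_def by blast
    from bounded_bilinear.FDERIV[OF P this] show "(\<lambda>x. P (f x) (g x)) differentiable at x"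
      unfolding differentiable_def by blast
  qed
next
  case (Suc n)
  note d = Suc.prems(2,3)[unfolded times_diff_on_Suc]
  have D: "((\<lambda>x. P (f x) (g x)) has_derivative
      (\<lambda>h. P (f x) (frechet_derivative g (at x) h) + P (frechet_derivative f (at x) h) (g x))) (at x)"
    if "x \<in> S" for x
    by (rule bounded_bilinear.FDERIV[OF P]) (use d that in \<open>auto simp: frechet_derivative_works[symmetric]\<close>)
  show ?case unfolding times_diff_on_Suc
  proof safe
    fix v
    have "times_diff_on n S (\<lambda>x. P (f x) (frechet_derivative g (at x) v) + P (frechet_derivative f (at x) v) (g x))"
      using d Suc.prems
      by (intro times_diff_on_add Suc.IH) (auto intro: times_diff_on_SucD)
    then show "times_diff_on n S (\<lambda>x. frechet_derivative (\<lambda>x. P (f x) (g x)) (at x) v)"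
      by (rule times_diff_on_cong[OF Suc.prems(1), rotated]) (simp add: frechet_derivative_eqI[OF D])
  qed (use D in \<open>auto simp: differentiable_def\<close>)
qed

lemma frechet_derivative_Basis_sum:
  fixes f :: "'a::euclidean_space \<Rightarrow> 'b::real_normed_vector"
  assumes "f differentiable (at x)"
  shows "frechet_derivative f (at x) v = (\<Sum>b\<in>Basis. (v \<bullet> b) *\<^sub>R frechet_derivative f (at x) b)"
proof -
  interpret linear "frechet_derivative f (at x)" using assms by (rule linear_frechet_derivative)
  have "frechet_derivative f (at x) (\<Sum>b\<in>Basis. (v \<bullet> b) *\<^sub>R b) = (\<Sum>b\<in>Basis. (v \<bullet> b) *\<^sub>R frechet_derivative f (at x) b)"
    by (simp add: sum scaleR)
  then show ?thesis by (simp add: euclidean_representation)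
qed

text \<open>The chain rule yields the derivative of f in a direction that varies with x, which is
  not itself a composite. Expanding this direction in the basis of the intermediate space gives a
  sum of products of coordinates of the derivative of g with composites of partial derivatives of f,
  to which the induction hypothesis applies.\<close>

lemma times_diff_on_compose:
  fixes g :: "'a::real_normed_vector \<Rightarrow> 'b::euclidean_space"
  shows "open S \<Longrightarrow> open T \<Longrightarrow> g ` S \<subseteq> T \<Longrightarrow> times_diff_on n T f \<Longrightarrow> times_diff_on n S g
    \<Longrightarrow> times_diff_on n S (\<lambda>x. f (g x))"
proof (induction n arbitrary: f)
  case 0
  then show ?case unfolding times_diff_on_0
    using differentiable_chain_at[unfolded o_def] by blast
next
  case (Suc n)
  note f = Suc.prems(4)[unfolded times_diff_on_Suc] and g = Suc.prems(5)[unfolded times_diff_on_Suc]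
  have D: "((\<lambda>x. f (g x)) has_derivative
      (\<lambda>h. frechet_derivative f (at (g x)) (frechet_derivative g (at x) h))) (at x)"
    if "x \<in> S" for x
  proof -
    have "f differentiable at (g x)" "g differentiable at x" using f g that Suc.prems(3) by auto
    then show ?thesis
      using diff_chain_at[of g "frechet_derivative g (at x)" x f "frechet_derivative f (at (g x))"]
      by (simp add: frechet_derivative_works[symmetric] o_def)
  qed
  show ?case unfolding times_diff_on_Suc
  proof safe
    fix v
    have 1: "times_diff_on n S (\<lambda>x. frechet_derivative f (at (g x)) b)" for b
      using Suc.IH[OF Suc.prems(1-3), of "\<lambda>y. frechet_derivative f (at y) b"] f Suc.prems(5) times_diff_on_SucD by blast
    have 2: "times_diff_on n S (\<lambda>x. frechet_derivative g (at x) v \<bullet> b)" for b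
      using g by (intro times_diff_on_bilinear[OF bounded_bilinear_inner] Suc.prems(1) times_diff_on_const) auto
    have "times_diff_on n S (\<lambda>x. \<Sum>b\<in>Basis. (frechet_derivative g (at x) v \<bullet> b) *\<^sub>R frechet_derivative f (at (g x)) b)"
      by (intro times_diff_on_sum times_diff_on_bilinear[OF bounded_bilinear_scaleR] Suc.prems(1) 1 2)
    then show "times_diff_on n S (\<lambda>x. frechet_derivative (\<lambda>x. f (g x)) (at x) v)"
    proof (rule times_diff_on_cong[OF Suc.prems(1), rotated])
      fix x assume x: "x \<in> S"
      then have "f differentiable at (g x)" using f Suc.prems(3) by auto
      then show "(\<Sum>b\<in>Basis. (frechet_derivative g (at x) v \<bullet> b) *\<^sub>R frechet_derivative f (at (g x)) b)
        = frechet_derivative (\<lambda>x. f (g x)) (at x) v"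
        using frechet_derivative_eqI[OF D[OF x]] frechet_derivative_Basis_sum by metis
    qed
  qed (use D in \<open>auto simp: differentiable_def\<close>)
qed

lemma smooth_on_cong:
  assumes "open S" "\<And>y. y \<in> S \<Longrightarrow> f y = g y" "smooth_on S f"
  shows "smooth_on S g"
  using assms times_diff_on_cong unfolding smooth_on_iff_times_diff by blast

lemma smooth_on_subset: "smooth_on S f \<Longrightarrow> T \<subseteq> S \<Longrightarrow> smooth_on T f"
  unfolding smooth_on_def by blast

lemma smooth_on_local:
  assumes "\<And>x. x \<in> S \<Longrightarrow> \<exists>T. open T \<and> x \<in> T \<and> smooth_on T f"
  shows "smooth_on S f"
  using assms unfolding smooth_on_def by blast

lemma smooth_on_const [simp]: "smooth_on S (\<lambda>x. c)"
  by (simp add: smooth_on_iff_times_diff times_diff_on_const)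

lemma smooth_on_add:
  "open S \<Longrightarrow> smooth_on S f \<Longrightarrow> smooth_on S g \<Longrightarrow> smooth_on S (\<lambda>x. f x + g x)"
  by (simp add: smooth_on_iff_times_diff times_diff_on_add)

lemma smooth_on_sum:
  "open S \<Longrightarrow> (\<And>i. i \<in> I \<Longrightarrow> smooth_on S (f i)) \<Longrightarrow> smooth_on S (\<lambda>x. \<Sum>i\<in>I. f i x)"
  by (simp add: smooth_on_iff_times_diff times_diff_on_sum)

lemma smooth_on_bilinear:
  "bounded_bilinear P \<Longrightarrow> open S \<Longrightarrow> smooth_on S f \<Longrightarrow> smooth_on S g \<Longrightarrow> smooth_on S (\<lambda>x. P (f x) (g x))"
  by (simp add: smooth_on_iff_times_diff times_diff_on_bilinear)

lemmas smooth_on_scaleR = smooth_on_bilinear[OF bounded_bilinear_scaleR]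
lemmas smooth_on_inner = smooth_on_bilinear[OF bounded_bilinear_inner]
lemmas smooth_on_mult = smooth_on_bilinear[OF bounded_bilinear_mult]

lemma smooth_on_minus:
  fixes f :: "'a::real_normed_vector \<Rightarrow> 'b::real_normed_vector"
  assumes "open S" "smooth_on S f" shows "smooth_on S (\<lambda>x. - f x)"
  using smooth_on_scaleR[OF assms(1) smooth_on_const assms(2), of "-1"] by simp

lemma smooth_on_diff:
  fixes f :: "'a::real_normed_vector \<Rightarrow> 'b::real_normed_vector"
  assumes "open S" "smooth_on S f" "smooth_on S g" shows "smooth_on S (\<lambda>x. f x - g x)"
  using smooth_on_add[OF assms(1,2) smooth_on_minus[OF assms(1,3)]] by simp

lemma smooth_on_compose:
  fixes g :: "'a::real_normed_vector \<Rightarrow> 'b::euclidean_space"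
  assumes "open S" "open T" "g ` S \<subseteq> T" "smooth_on T f" "smooth_on S g"
  shows "smooth_on S (\<lambda>x. f (g x))"
  using assms(4,5) times_diff_on_compose[OF assms(1-3)] unfolding smooth_on_iff_times_diff by blast

lemma smooth_on_bounded_linear:
  assumes "bounded_linear f" shows "smooth_on S f"
proof -
  have D: "frechet_derivative f (at x) = f" for x
    using bounded_linear_imp_has_derivative[OF assms] by (rule frechet_derivative_eqI)
  have "times_diff_on n S f" for n
    by (cases n) (use assms bounded_linear_imp_differentiable in
      \<open>auto simp: times_diff_on_0 times_diff_on_Suc D times_diff_on_const\<close>)
  then show ?thesis by (simp add: smooth_on_iff_times_diff)
qed

lemma smooth_on_ident: "smooth_on S (\<lambda>x. x)"
  by (rule smooth_on_bounded_linear) (rule bounded_linear_ident)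

lemma smooth_on_power:
  fixes f :: "'a::real_normed_vector \<Rightarrow> real"
  shows "open S \<Longrightarrow> smooth_on S f \<Longrightarrow> smooth_on S (\<lambda>x. f x ^ n)"
  by (induction n) (auto intro!: smooth_on_mult)

lemma smooth_on_differentiable: "smooth_on S f \<Longrightarrow> x \<in> S \<Longrightarrow> f differentiable (at x)"
  unfolding smooth_on_iff_times_diff using times_diff_on_0 by blast

lemma smooth_on_deriv: "smooth_on S f \<Longrightarrow> smooth_on S (\<lambda>x. frechet_derivative f (at x) v)"
  unfolding smooth_on_iff_times_diff using times_diff_on_Suc by blast

lemma smooth_on_iter_deriv: "smooth_on S f \<Longrightarrow> smooth_on S (iter_deriv vs f)"
  by (induction vs) (auto intro: smooth_on_deriv)

lemma smooth_on_continuous_on: "smooth_on S f \<Longrightarrow> continuous_on S f"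
  by (meson continuous_at_imp_continuous_on differentiable_imp_continuous_within smooth_on_differentiable)

lemma smooth_on_has_derivative:
  "smooth_on S f \<Longrightarrow> x \<in> S \<Longrightarrow> (f has_derivative frechet_derivative f (at x)) (at x)"
  using smooth_on_differentiable frechet_derivative_works by blast

lemma smooth_on_deriv_field:
  fixes f :: "'a::euclidean_space \<Rightarrow> 'b::real_normed_vector"
  assumes "open S" "smooth_on S f" "smooth_on S g"
  shows "smooth_on S (\<lambda>x. frechet_derivative f (at x) (g x))"
proof -
  have "smooth_on S (\<lambda>x. \<Sum>b\<in>Basis. (g x \<bullet> b) *\<^sub>R frechet_derivative f (at x) b)"
    by (intro smooth_on_sum smooth_on_scaleR smooth_on_inner assms smooth_on_const smooth_on_deriv)
  then show ?thesis
    by (rule smooth_on_cong[OF assms(1), rotated])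
      (use frechet_derivative_Basis_sum smooth_on_differentiable[OF assms(2)] in metis)
qed

lemma smooth_on_componentwise:
  fixes f :: "'a::real_normed_vector \<Rightarrow> 'b::euclidean_space"
  assumes "open S" "\<And>b. b \<in> Basis \<Longrightarrow> smooth_on S (\<lambda>x. f x \<bullet> b)"
  shows "smooth_on S f"
proof -
  have "smooth_on S (\<lambda>x. \<Sum>b\<in>Basis. (f x \<bullet> b) *\<^sub>R b)"
    by (intro smooth_on_sum smooth_on_scaleR assms smooth_on_const)
  then show ?thesis by (simp add: euclidean_representation)
qed

lemma smooth_on_vec_lambda:
  fixes f :: "'k::finite \<Rightarrow> 'a::real_normed_vector \<Rightarrow> 'e::euclidean_space"
  assumes "open S" "\<And>i. smooth_on S (f i)"
  shows "smooth_on S (\<lambda>x. \<chi> i. f i x)"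
proof (rule smooth_on_componentwise[OF assms(1)])
  fix b :: "'e^'k" assume "b \<in> Basis"
  then obtain i e where "b = axis i e" by (auto simp: Basis_vec_def)
  then have "(\<lambda>x. (\<chi> i. f i x) \<bullet> b) = (\<lambda>x. f i x \<bullet> e)" by (simp add: inner_axis)
  then show "smooth_on S (\<lambda>x. (\<chi> i. f i x) \<bullet> b)" using assms by (auto intro!: smooth_on_inner)
qed

lemma smooth_on_nth: "smooth_on S (\<lambda>x. x $ i)"
  by (intro smooth_on_bounded_linear bounded_linear_vec_nth)

subsection \<open>Symmetry of second derivatives\<close>

lemma has_real_derivative_along_line:
  fixes f :: "'a::real_normed_vector \<Rightarrow> real"
  assumes "f differentiable (at (p + s *\<^sub>R u))"
  shows "((\<lambda>s. f (p + s *\<^sub>R u)) has_real_derivative frechet_derivative f (at (p + s *\<^sub>R u)) u) (at s)"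
proof -
  let ?D = "frechet_derivative f (at (p + s *\<^sub>R u))"
  have l: "linear ?D" using assms by (rule linear_frechet_derivative)
  have "((\<lambda>s. p + s *\<^sub>R u) has_derivative (\<lambda>h. h *\<^sub>R u)) (at s)"
    by (auto intro!: derivative_eq_intros)
  moreover have "(f has_derivative ?D) (at (p + s *\<^sub>R u))"
    using assms frechet_derivative_works by blast
  ultimately have "((\<lambda>s. f (p + s *\<^sub>R u)) has_derivative (\<lambda>h. ?D (h *\<^sub>R u))) (at s)"
    using diff_chain_at[of "\<lambda>s. p + s *\<^sub>R u" "\<lambda>h. h *\<^sub>R u" s f ?D] by (simp add: o_def)
  then show ?thesis
    by (simp add: has_field_derivative_def linear_cmul[OF l] mult.commute[of _ "?D u"])
qed

text \<open>The mean value theorem is applied twice: along u, to the difference of f over the step h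
  v, and then along v, to the derivative so obtained. The left side is symmetric in u and v while
  the right side is not, which \<open>second_derivative_symmetric\<close> exploits.\<close>

lemma second_difference_mvt:
  fixes f :: "'a::euclidean_space \<Rightarrow> real"
  assumes sm: "smooth_on S f" and S: "ball x r \<subseteq> S" and h: "h > 0" "h * (norm u + norm v) < r"
  obtains \<xi> \<eta> where "0 < \<xi>" "\<xi> < h" "0 < \<eta>" "\<eta> < h"
    "f (x + h *\<^sub>R u + h *\<^sub>R v) - f (x + h *\<^sub>R u) - f (x + h *\<^sub>R v) + f x
      = h * h * frechet_derivative (\<lambda>y. frechet_derivative f (at y) u) (at (x + \<xi> *\<^sub>R u + \<eta> *\<^sub>R v)) v"
proof -
  have inS: "x + s *\<^sub>R u + t *\<^sub>R v \<in> S" if "0 \<le> s" "s \<le> h" "0 \<le> t" "t \<le> h" for s t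
  proof -
    have "norm (s *\<^sub>R u + t *\<^sub>R v) \<le> s * norm u + t * norm v"
      using that norm_triangle_ineq[of "s *\<^sub>R u" "t *\<^sub>R v"] by simp
    also have "\<dots> \<le> h * (norm u + norm v)"
      using that by (simp add: distrib_left add_mono mult_right_mono)
    finally have "dist (x + (s *\<^sub>R u + t *\<^sub>R v)) x < r" using h(2) by (simp add: dist_norm)
    then have "x + (s *\<^sub>R u + t *\<^sub>R v) \<in> ball x r" by (simp add: dist_commute)
    then show ?thesis using S by (simp add: add.assoc subset_iff)
  qed
  let ?g = "\<lambda>s. f ((x + h *\<^sub>R v) + s *\<^sub>R u) - f (x + s *\<^sub>R u)"
  have "(?g has_real_derivative frechet_derivative f (at ((x + h *\<^sub>R v) + s *\<^sub>R u)) u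
       - frechet_derivative f (at (x + s *\<^sub>R u)) u) (at s)" if "0 \<le> s" "s \<le> h" for s
    using inS[OF that, of h] inS[OF that, of 0] h(1)
    by (intro DERIV_diff has_real_derivative_along_line smooth_on_differentiable[OF sm])
      (auto simp: algebra_simps)
  from MVT2[OF h(1) this] obtain \<xi> where \<xi>: "0 < \<xi>" "\<xi> < h"
    "?g h - ?g 0 = h * (frechet_derivative f (at ((x + h *\<^sub>R v) + \<xi> *\<^sub>R u)) u
       - frechet_derivative f (at (x + \<xi> *\<^sub>R u)) u)"
    by auto
  let ?k = "\<lambda>t. frechet_derivative f (at ((x + \<xi> *\<^sub>R u) + t *\<^sub>R v)) u"
  have "(?k has_real_derivative frechet_derivative (\<lambda>y. frechet_derivative f (at y) u) (at ((x + \<xi> *\<^sub>R u) + t *\<^sub>R v)) v) (at t)"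
    if "0 \<le> t" "t \<le> h" for t
    using has_real_derivative_along_line[OF smooth_on_differentiable[OF smooth_on_deriv[OF sm] inS[of \<xi> t]], of u]
      \<xi>(1,2) that by auto
  from MVT2[OF h(1) this] obtain \<eta> where \<eta>: "0 < \<eta>" "\<eta> < h"
    "?k h - ?k 0 = h * frechet_derivative (\<lambda>y. frechet_derivative f (at y) u) (at ((x + \<xi> *\<^sub>R u) + \<eta> *\<^sub>R v)) v"
    by auto
  show ?thesis
    by (rule that[of \<xi> \<eta>]) (use \<xi> \<eta> in \<open>simp_all add: algebra_simps\<close>)
qed

text \<open>Both mixed derivatives, taken at suitable points near x, equal the same second
  difference divided by the square of h. Their continuity at x does the rest.\<close>

lemma second_derivative_symmetric:
  fixes f :: "'a::euclidean_space \<Rightarrow> real"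
  assumes "open S" and sm: "smooth_on S f" and x: "x \<in> S"
  shows "frechet_derivative (\<lambda>y. frechet_derivative f (at y) u) (at x) v
       = frechet_derivative (\<lambda>y. frechet_derivative f (at y) v) (at x) u"
proof -
  define A where "A u v = (\<lambda>x. frechet_derivative (\<lambda>y. frechet_derivative f (at y) u) (at x) v)" for u v
  obtain r where r: "r > 0" "ball x r \<subseteq> S" using assms openE by blast
  have cont: "isCont (A u v) x" for u v
    unfolding A_def
    by (intro differentiable_imp_continuous_within smooth_on_differentiable[OF _ x] smooth_on_deriv sm)
  have "\<bar>A u v x - A v u x\<bar> \<le> e" if "e > 0" for e
  proof -
    obtain d1 where d1: "d1 > 0" "\<And>y. dist y x < d1 \<Longrightarrow> dist (A u v y) (A u v x) < e / 2"
      using cont[of u v] \<open>e > 0\<close> unfolding continuous_at_eps_delta by (meson half_gt_zero)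
    obtain d2 where d2: "d2 > 0" "\<And>y. dist y x < d2 \<Longrightarrow> dist (A v u y) (A v u x) < e / 2"
      using cont[of v u] \<open>e > 0\<close> unfolding continuous_at_eps_delta by (meson half_gt_zero)
    \<comment> \<open>The parallelogram with sides h u and h v has to stay inside the ball of
      smoothness and both balls of continuity. The 1 in the denominator of \<open>h\<close> covers u
      = v = 0.\<close>
    define M where "M = Min {r, d1, d2}"
    define h where "h = M / (norm u + norm v + 1)"
    have M: "M > 0" "M \<le> r" "M \<le> d1" "M \<le> d2" using r d1 d2 by (auto simp: M_def)
    have h: "h > 0" "h * (norm u + norm v) < M"
    proof -
      let ?w = "norm u + norm v"
      have w: "?w + 1 > 0" by (simp add: add_nonneg_pos)
      show "h > 0" using w M by (simp add: h_def)
      have "h * (?w + 1) = M" using w by (simp add: h_def)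
      moreover have "h * ?w < h * (?w + 1)" using \<open>h > 0\<close> by simp
      ultimately show "h * ?w < M" by simp
    qed
    have near: "norm (s *\<^sub>R u + t *\<^sub>R v) < M" if "0 < s" "s < h" "0 < t" "t < h" for s t
    proof -
      have "norm (s *\<^sub>R u + t *\<^sub>R v) \<le> s * norm u + t * norm v"
        using that norm_triangle_ineq[of "s *\<^sub>R u" "t *\<^sub>R v"] by simp
      also have "\<dots> \<le> h * (norm u + norm v)"
        using that by (simp add: distrib_left add_mono mult_right_mono)
      finally show ?thesis using h(2) by simp
    qed
    obtain s t where st: "0 < s" "s < h" "0 < t" "t < h"
      "f (x + h *\<^sub>R u + h *\<^sub>R v) - f (x + h *\<^sub>R u) - f (x + h *\<^sub>R v) + f x = h * h * A u v (x + s *\<^sub>R u + t *\<^sub>R v)"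
      using second_difference_mvt[OF sm r(2) h(1), of u v] h(2) M(2) unfolding A_def by auto
    obtain s' t' where st': "0 < s'" "s' < h" "0 < t'" "t' < h"
      "f (x + h *\<^sub>R v + h *\<^sub>R u) - f (x + h *\<^sub>R v) - f (x + h *\<^sub>R u) + f x = h * h * A v u (x + s' *\<^sub>R v + t' *\<^sub>R u)"
      using second_difference_mvt[OF sm r(2) h(1), of v u] h(2) M(2) unfolding A_def by (auto simp: add.commute)
    have "h * h * A u v (x + s *\<^sub>R u + t *\<^sub>R v) = h * h * A v u (x + s' *\<^sub>R v + t' *\<^sub>R u)"
      using st(5) st'(5) by (simp add: algebra_simps)
    then have "A u v (x + s *\<^sub>R u + t *\<^sub>R v) = A v u (x + s' *\<^sub>R v + t' *\<^sub>R u)" using h(1) by simp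
    moreover have "dist (A u v (x + s *\<^sub>R u + t *\<^sub>R v)) (A u v x) < e / 2"
      using near[OF st(1-4)] M by (intro d1(2)) (simp add: dist_norm add.assoc)
    moreover have "dist (A v u (x + s' *\<^sub>R v + t' *\<^sub>R u)) (A v u x) < e / 2"
      using near[OF st'(3,4,1,2)] M by (intro d2(2)) (simp add: dist_norm add.assoc add.commute)
    ultimately show ?thesis by (simp add: dist_real_def abs_if split: if_splits)
  qed
  then have "\<bar>A u v x - A v u x\<bar> \<le> 0" by (rule field_le_epsilon[of _ 0, simplified])
  then show ?thesis by (simp add: A_def)
qed

subsection \<open>Hadamard's lemma\<close>

text \<open>Differentiation under the integral sign. The weight \<open>s ^ k\<close> is carried
  along because each differentiation brings out a factor s from the inner map; with it the family of
  these integrals is closed under derivatives, and their smoothness follows by induction.\<close>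

lemma has_derivative_radial_integral:
  fixes \<phi> :: "'a::euclidean_space \<Rightarrow> real"
  assumes sm: "smooth_on (ball y0 r) \<phi>" and y: "y \<in> ball y0 r"
  shows "((\<lambda>y. integral {0..1} (\<lambda>s. s ^ k * \<phi> (y0 + s *\<^sub>R (y - y0)))) has_derivative
    (\<lambda>v. integral {0..1} (\<lambda>s. s ^ Suc k * frechet_derivative \<phi> (at (y0 + s *\<^sub>R (y - y0))) v))) (at y)"
proof -
  let ?U = "ball y0 r"
  have inU: "y0 + s *\<^sub>R (z - y0) \<in> ?U" if "z \<in> ?U" "s \<in> {0..1}" for z s
  proof -
    have "s * norm (z - y0) \<le> 1 * norm (z - y0)" using that by (intro mult_right_mono) auto
    then show ?thesis using that by (simp add: dist_norm norm_minus_commute)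
  qed
  \<comment> \<open>The derivative in z as a bounded linear map, assembled from partial derivatives,
    so that the joint continuity in (z, s) required by \<open>leibniz_rule\<close> reduces to that
    of scalar functions.\<close>
  define fx where "fx z s = (\<Sum>b\<in>Basis. (s ^ Suc k * frechet_derivative \<phi> (at (y0 + s *\<^sub>R (z - y0))) b) *\<^sub>R blinfun_inner_left b)"
    for z :: 'a and s :: real
  have fx_apply: "blinfun_apply (fx z s) v = s ^ Suc k * frechet_derivative \<phi> (at (y0 + s *\<^sub>R (z - y0))) v"
    if "z \<in> ?U" "s \<in> {0..1}" for z s v
    using frechet_derivative_Basis_sum[OF smooth_on_differentiable[OF sm inU[OF that]], of v]
    by (simp add: fx_def blinfun.sum_left blinfun.scaleR_left sum_distrib_left inner_commute mult_ac)
  have cont: "continuous_on (?U \<times> {0..1}) (\<lambda>p. \<psi> (y0 + snd p *\<^sub>R (fst p - y0)))"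
    if "continuous_on ?U \<psi>" for \<psi> :: "'a \<Rightarrow> real"
    by (rule continuous_on_compose2[OF that]) (auto intro!: continuous_intros inU simp del: mem_ball)
  have cont1: "continuous_on {0..1} (\<lambda>s. \<psi> (y0 + s *\<^sub>R (z - y0)))"
    if "continuous_on ?U \<psi>" "z \<in> ?U" for \<psi> :: "'a \<Rightarrow> real" and z
    by (rule continuous_on_compose2[OF that(1)]) (auto intro!: continuous_intros inU[OF that(2)] simp del: mem_ball)
  have "((\<lambda>y. integral (cbox 0 1) (\<lambda>s. s ^ k * \<phi> (y0 + s *\<^sub>R (y - y0)))) has_derivative
     blinfun_apply (integral (cbox 0 1) (fx y))) (at y within ?U)"
  proof (rule leibniz_rule)
    fix z :: 'a and s :: real assume z: "z \<in> ?U" and s: "s \<in> cbox 0 1"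
    then have s': "s \<in> {0..1}" by simp
    have "((\<lambda>z. y0 + s *\<^sub>R (z - y0)) has_derivative (\<lambda>v. s *\<^sub>R v)) (at z)"
      by (auto intro!: derivative_eq_intros)
    from diff_chain_at[OF this smooth_on_has_derivative[OF sm inU[OF z s']]]
    have "((\<lambda>z. \<phi> (y0 + s *\<^sub>R (z - y0))) has_derivative
       (\<lambda>v. frechet_derivative \<phi> (at (y0 + s *\<^sub>R (z - y0))) (s *\<^sub>R v))) (at z)" by (simp add: o_def)
    then have "((\<lambda>z. s ^ k * \<phi> (y0 + s *\<^sub>R (z - y0))) has_derivative
       (\<lambda>v. s ^ k * frechet_derivative \<phi> (at (y0 + s *\<^sub>R (z - y0))) (s *\<^sub>R v))) (at z)"
      by (rule has_derivative_mult_right)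
    also have "(\<lambda>v. s ^ k * frechet_derivative \<phi> (at (y0 + s *\<^sub>R (z - y0))) (s *\<^sub>R v)) = blinfun_apply (fx z s)"
      using fx_apply[OF z s'] linear_cmul[OF linear_frechet_derivative[OF smooth_on_differentiable[OF sm inU[OF z s']]]]
      by (auto simp: mult_ac)
    finally show "((\<lambda>z. s ^ k * \<phi> (y0 + s *\<^sub>R (z - y0))) has_derivative blinfun_apply (fx z s)) (at z within ?U)"
      by (rule has_derivative_at_withinI)
  next
    fix z assume "z \<in> ?U"
    then show "(\<lambda>s. s ^ k * \<phi> (y0 + s *\<^sub>R (z - y0))) integrable_on cbox 0 1"
      using cont1[OF smooth_on_continuous_on[OF sm]]
      by (intro integrable_continuous) (auto intro!: continuous_intros simp del: mem_ball)
  next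
    show "continuous_on (?U \<times> cbox 0 1) (\<lambda>(z, s). fx z s)"
      unfolding fx_def split_beta
      using cont[OF smooth_on_continuous_on[OF smooth_on_deriv[OF sm]]]
      by (intro continuous_intros) auto
  qed (use y in auto)
  moreover have "blinfun_apply (integral (cbox 0 1) (fx y)) v
      = integral {0..1} (\<lambda>s. s ^ Suc k * frechet_derivative \<phi> (at (y0 + s *\<^sub>R (y - y0))) v)" for v
  proof -
    have "fx y integrable_on cbox 0 1"
      unfolding fx_def
      using cont1[OF smooth_on_continuous_on[OF smooth_on_deriv[OF sm]] y]
      by (intro integrable_continuous continuous_intros) auto
    from integral_linear[OF this blinfun.bounded_linear_left, of v]
    have "blinfun_apply (integral (cbox 0 1) (fx y)) v = integral (cbox 0 1) (\<lambda>s. blinfun_apply (fx y s) v)"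
      by (simp add: o_def)
    also have "\<dots> = integral {0..1} (\<lambda>s. s ^ Suc k * frechet_derivative \<phi> (at (y0 + s *\<^sub>R (y - y0))) v)"
      unfolding cbox_interval by (rule integral_cong) (rule fx_apply[OF y])
    finally show ?thesis .
  qed
  then have "blinfun_apply (integral (cbox 0 1) (fx y))
      = (\<lambda>v. integral {0..1} (\<lambda>s. s ^ Suc k * frechet_derivative \<phi> (at (y0 + s *\<^sub>R (y - y0))) v))" ..
  ultimately show ?thesis
    by (simp only: at_within_open[OF y open_ball] cbox_interval)
qed

lemma smooth_on_radial_integral:
  fixes \<phi> :: "'a::euclidean_space \<Rightarrow> real"
  assumes "smooth_on (ball y0 r) \<phi>"
  shows "smooth_on (ball y0 r) (\<lambda>y. integral {0..1} (\<lambda>s. s ^ k * \<phi> (y0 + s *\<^sub>R (y - y0))))"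
proof -
  have "times_diff_on n (ball y0 r) (\<lambda>y. integral {0..1} (\<lambda>s. s ^ k * \<phi> (y0 + s *\<^sub>R (y - y0))))" for n
    using assms
  proof (induction n arbitrary: k \<phi>)
    case 0
    then show ?case unfolding times_diff_on_0 using has_derivative_radial_integral differentiableI by blast
  next
    case (Suc n)
    note D = has_derivative_radial_integral[OF Suc.prems]
    show ?case unfolding times_diff_on_Suc
    proof safe
      fix v
      have "times_diff_on n (ball y0 r) (\<lambda>y. integral {0..1} (\<lambda>s. s ^ Suc k * frechet_derivative \<phi> (at (y0 + s *\<^sub>R (y - y0))) v))"
        using Suc.IH[OF smooth_on_deriv[OF Suc.prems]] .
      then show "times_diff_on n (ball y0 r) (\<lambda>y. frechet_derivative (\<lambda>y. integral {0..1} (\<lambda>s. s ^ k * \<phi> (y0 + s *\<^sub>R (y - y0)))) (at y) v)"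
        by (rule times_diff_on_cong[OF open_ball, rotated]) (simp only: frechet_derivative_eqI[OF D])
    qed (use D differentiableI in blast)
  qed
  then show ?thesis by (simp add: smooth_on_iff_times_diff)
qed

lemma hadamard:
  fixes F :: "'a::euclidean_space \<Rightarrow> real"
  assumes sm: "smooth_on (ball y0 r) F" and r: "r > 0"
  obtains G where "\<And>b. smooth_on (ball y0 r) (G b)"
    "\<And>b. G b y0 = frechet_derivative F (at y0) b"
    "\<And>y. y \<in> ball y0 r \<Longrightarrow> F y = F y0 + (\<Sum>b\<in>Basis. ((y - y0) \<bullet> b) * G b y)"
proof -
  \<comment> \<open>The factor \<open>s ^ 0\<close> puts the integral into the form treated by
    \<open>smooth_on_radial_integral\<close>. The expansion of F is then the fundamental theorem of
    calculus on the segment from y0 to y.\<close>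
  define G where "G b y = integral {0..1} (\<lambda>s. s ^ 0 * frechet_derivative F (at (y0 + s *\<^sub>R (y - y0))) b)" for b y
  show ?thesis
  proof (rule that)
    show "smooth_on (ball y0 r) (G b)" for b
      unfolding G_def by (rule smooth_on_radial_integral[OF smooth_on_deriv[OF sm]])
    show "G b y0 = frechet_derivative F (at y0) b" for b by (simp add: G_def)
    fix y assume y: "y \<in> ball y0 r"
    have inU: "y0 + s *\<^sub>R (y - y0) \<in> ball y0 r" if "s \<in> {0..1}" for s
    proof -
      have "s * norm (y - y0) \<le> 1 * norm (y - y0)" using that by (intro mult_right_mono) auto
      then show ?thesis using y that by (simp add: dist_norm norm_minus_commute)
    qed
    let ?g = "\<lambda>s. frechet_derivative F (at (y0 + s *\<^sub>R (y - y0)))"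
    have "(?g s (y - y0)) = (\<Sum>b\<in>Basis. ((y - y0) \<bullet> b) * ?g s b)" if "s \<in> {0..1}" for s
      using frechet_derivative_Basis_sum[OF smooth_on_differentiable[OF sm inU[OF that]], of "y - y0"] by simp
    have int: "(\<lambda>s. ?g s b) integrable_on {0..1}" for b
    proof -
      have "continuous_on {0..1} (\<lambda>s. ?g s b)"
        by (rule continuous_on_compose2[OF smooth_on_continuous_on[OF smooth_on_deriv[OF sm]]])
          (auto intro!: continuous_intros inU simp del: mem_ball)
      then show ?thesis by (simp add: integrable_continuous_real)
    qed
    have "((\<lambda>s. ?g s (y - y0)) has_integral F (y0 + 1 *\<^sub>R (y - y0)) - F (y0 + 0 *\<^sub>R (y - y0))) {0..1}"
    proof (rule fundamental_theorem_of_calculus)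
      fix s :: real assume "s \<in> {0..1}"
      from has_real_derivative_along_line[OF smooth_on_differentiable[OF sm inU[OF this]]]
      show "((\<lambda>s. F (y0 + s *\<^sub>R (y - y0))) has_vector_derivative ?g s (y - y0)) (at s within {0..1})"
        by (simp add: has_real_derivative_iff_has_vector_derivative has_vector_derivative_at_within)
    qed simp
    then have "F y - F y0 = integral {0..1} (\<lambda>s. ?g s (y - y0))" by (simp add: integral_unique)
    also have "\<dots> = integral {0..1} (\<lambda>s. \<Sum>b\<in>Basis. ((y - y0) \<bullet> b) * ?g s b)"
      by (rule integral_cong) fact
    also have "\<dots> = (\<Sum>b\<in>Basis. ((y - y0) \<bullet> b) * G b y)"
      using int by (subst integral_sum) (auto simp: G_def intro!: integrable_on_mult_right)
    finally show "F y = F y0 + (\<Sum>b\<in>Basis. ((y - y0) \<bullet> b) * G b y)" by simp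
  qed
qed

subsection \<open>A smooth bump function\<close>

text \<open>For k = 0 this is the classical flat function exp (-1/s). The powers of 1/s are included
  because the derivative of \<open>flat_exp k\<close> is a combination of
  \<open>flat_exp (k + 2)\<close> and \<open>flat_exp (k + 1)\<close>, so that one induction treats
  all orders.\<close>

definition flat_exp :: "nat \<Rightarrow> real \<Rightarrow> real" where
  "flat_exp k s = (if s > 0 then inverse s ^ k * exp (- inverse s) else 0)"

lemma flat_exp_tendsto_0: "(flat_exp k \<longlongrightarrow> 0) (at_right 0)"
proof -
  have "((\<lambda>t::real. t ^ k / exp t) \<longlongrightarrow> 0) at_top" by (rule tendsto_power_div_exp_0)
  from filterlim_compose[OF this filterlim_inverse_at_top_right]
  have "((\<lambda>s::real. inverse s ^ k / exp (inverse s)) \<longlongrightarrow> 0) (at_right 0)" .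
  then show ?thesis
    by (rule Lim_transform_eventually)
      (auto simp: flat_exp_def exp_minus field_simps intro: eventually_at_right_less[THEN eventually_mono])
qed

lemma has_real_derivative_flat_exp:
  "(flat_exp k has_real_derivative flat_exp (k + 2) s - real k * flat_exp (k + 1) s) (at s)"
proof (cases s "0 :: real" rule: linorder_cases)
  case greater
  let ?u = "inverse s"
  have "((\<lambda>s. inverse s ^ k * exp (- inverse s)) has_real_derivative
      real k * ?u ^ (k - 1) * (- (?u * ?u)) * exp (- ?u) + ?u ^ k * (exp (- ?u) * (?u * ?u))) (at s)"
    using greater by (auto intro!: derivative_eq_intros)
  also have "real k * ?u ^ (k - 1) * (- (?u * ?u)) * exp (- ?u) + ?u ^ k * (exp (- ?u) * (?u * ?u))
      = flat_exp (k + 2) s - real k * flat_exp (k + 1) s"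
    using greater by (cases k) (simp_all add: flat_exp_def algebra_simps)
  finally have "((\<lambda>s. inverse s ^ k * exp (- inverse s)) has_real_derivative
      flat_exp (k + 2) s - real k * flat_exp (k + 1) s) (at s)" .
  then show ?thesis
    by (rule has_field_derivative_transform_within_open[where S="{0<..}"]) (use greater in \<open>auto simp: flat_exp_def\<close>)
next
  case less
  have "((\<lambda>s. 0) has_real_derivative flat_exp (k + 2) s - real k * flat_exp (k + 1) s) (at s)"
    using less by (simp add: flat_exp_def)
  then show ?thesis
    by (rule has_field_derivative_transform_within_open[where S="{..<0}"]) (use less in \<open>auto simp: flat_exp_def\<close>)
next
  case equal
  \<comment> \<open>At the origin the difference quotient is 0 on the left and
    \<open>flat_exp (Suc k)\<close> on the right, and the latter tends to 0 because the exponential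
    beats every power.\<close>
  have "((\<lambda>h. flat_exp k h / h) \<longlongrightarrow> 0) (at 0)"
    unfolding filterlim_at_split
  proof
    have "((\<lambda>h::real. 0) \<longlongrightarrow> (0::real)) (at_left 0)" by simp
    then show "((\<lambda>h. flat_exp k h / h) \<longlongrightarrow> 0) (at_left 0)"
      by (rule Lim_transform_eventually) (auto simp: flat_exp_def eventually_at_filter)
    show "((\<lambda>h. flat_exp k h / h) \<longlongrightarrow> 0) (at_right 0)"
      by (rule Lim_transform_eventually[OF flat_exp_tendsto_0[of "Suc k"]])
        (auto simp: flat_exp_def eventually_at_filter field_simps)
  qed
  then show ?thesis using equal by (simp add: DERIV_def flat_exp_def)
qed

lemma smooth_on_flat_exp: "smooth_on S (flat_exp k)"
proof -
  have D: "(flat_exp k has_derivative (\<lambda>v. (flat_exp (k + 2) s + (- real k) * flat_exp (k + 1) s) * v)) (at s)" for k s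
    using has_real_derivative_flat_exp[of k s] by (simp add: has_field_derivative_def)
  have "times_diff_on n UNIV (flat_exp k)" for n
  proof (induction n arbitrary: k)
    case 0 show ?case unfolding times_diff_on_0 using D differentiableI by blast
  next
    case (Suc n)
    show ?case unfolding times_diff_on_Suc frechet_derivative_eqI[OF D]
      by (intro conjI ballI allI differentiableI[OF D] times_diff_on_bilinear[OF bounded_bilinear_mult]
          times_diff_on_add times_diff_on_const Suc open_UNIV)
  qed
  then have "smooth_on UNIV (flat_exp k)" by (simp add: smooth_on_iff_times_diff)
  then show ?thesis by (rule smooth_on_subset) simp
qed

text \<open>The squared distance keeps the argument smooth at the centre, where the norm is
  not.\<close>

definition bump :: "'a::euclidean_space \<Rightarrow> real \<Rightarrow> 'a \<Rightarrow> real" where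
  "bump a \<rho> x = flat_exp 0 (\<rho>\<^sup>2 - (x - a) \<bullet> (x - a))"

lemma smooth_on_bump: "smooth_on S (bump a \<rho>)"
proof -
  have "smooth_on UNIV (bump a \<rho>)" unfolding bump_def
    by (rule smooth_on_compose[where T=UNIV and f="flat_exp 0"])
      (auto intro!: smooth_on_flat_exp smooth_on_diff smooth_on_inner smooth_on_ident)
  then show ?thesis by (rule smooth_on_subset) simp
qed

lemma bump_pos: "x \<in> ball a \<rho> \<Longrightarrow> bump a \<rho> x > 0"
proof -
  assume "x \<in> ball a \<rho>"
  then have "norm (x - a) < \<rho>" by (simp add: dist_norm norm_minus_commute)
  then have "(norm (x - a))\<^sup>2 < \<rho>\<^sup>2" by (simp add: power_strict_mono)
  then show ?thesis by (simp add: bump_def flat_exp_def power2_norm_eq_inner)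
qed

lemma bump_zero: "\<rho> > 0 \<Longrightarrow> x \<notin> ball a \<rho> \<Longrightarrow> bump a \<rho> x = 0"
proof -
  assume \<rho>: "\<rho> > 0" and "x \<notin> ball a \<rho>"
  then have "\<rho> \<le> norm (x - a)" by (simp add: dist_norm norm_minus_commute)
  then have "\<rho>\<^sup>2 \<le> (norm (x - a))\<^sup>2" using \<rho> by (simp add: power_mono)
  then show ?thesis by (simp add: bump_def flat_exp_def power2_norm_eq_inner)
qed

subsection \<open>Charts\<close>

abbreviation chart_inv :: "('m, 'e) chart \<Rightarrow> 'e \<Rightarrow> 'm" where
  "chart_inv c \<equiv> inv_into (fst c) (snd c)"

lemma is_chartD:
  assumes "is_chart c"
  shows "open (fst c)" "open (snd c ` fst c)"
    "continuous_on (fst c) (snd c)" "continuous_on (snd c ` fst c) (chart_inv c)"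
    "inj_on (snd c) (fst c)"
proof -
  have h: "homeomorphism (fst c) (snd c ` fst c) (snd c) (chart_inv c)"
    using assms by (simp add: is_chart_def)
  show "open (fst c)" "open (snd c ` fst c)" using assms by (simp_all add: is_chart_def)
  show "continuous_on (fst c) (snd c)" "continuous_on (snd c ` fst c) (chart_inv c)"
    using homeomorphism_cont1[OF h] homeomorphism_cont2[OF h] by simp_all
  show "inj_on (snd c) (fst c)"
    using homeomorphism_apply1[OF h] by (rule inj_on_inverseI)
qed

lemma chart_inv_left: "is_chart c \<Longrightarrow> p \<in> fst c \<Longrightarrow> chart_inv c (snd c p) = p"
  by (rule inv_into_f_f[OF is_chartD(5)])

lemma chart_inv_in: "y \<in> snd c ` fst c \<Longrightarrow> chart_inv c y \<in> fst c"
  by (rule inv_into_into)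

lemma chart_inv_right: "y \<in> snd c ` fst c \<Longrightarrow> snd c (chart_inv c y) = y"
  by (rule f_inv_into_f)

lemma chart_vimage_open:
  assumes "is_chart c" "open V" shows "open {p \<in> fst c. snd c p \<in> V}"
proof -
  have "open (fst c \<inter> snd c -` V)"
    using is_chartD[OF assms(1)] assms(2) continuous_on_open_vimage by (metis Int_commute)
  then show ?thesis by (simp add: Int_def)
qed

lemma chart_image_open:
  assumes c: "is_chart c" and W: "open W" shows "open (snd c ` (fst c \<inter> W))"
proof -
  have "snd c ` (fst c \<inter> W) = snd c ` fst c \<inter> chart_inv c -` W"
    using chart_inv_left[OF c] by (auto simp: image_iff intro!: bexI[rotated])
  moreover have "open (snd c ` fst c \<inter> chart_inv c -` W)"
    using is_chartD[OF c] W continuous_on_open_vimage by (metis Int_commute)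
  ultimately show ?thesis by simp
qed

lemma maximal_atlasI: "smooth_atlas A \<Longrightarrow> c \<in> A \<Longrightarrow> c \<in> maximal_atlas A"
  by (auto simp: smooth_atlas_def maximal_atlas_def carrier_of_def)

lemma maximal_atlasD:
  assumes "c \<in> maximal_atlas A"
  shows "is_chart c" "fst c \<subseteq> carrier_of A" "d \<in> A \<Longrightarrow> smooth_transition c d" "d \<in> A \<Longrightarrow> smooth_transition d c"
  using assms by (auto simp: maximal_atlas_def)

lemma smooth_on_change_chart:
  assumes c: "is_chart c" and d: "is_chart d" and t: "smooth_transition c d"
    and W: "open W" "W \<subseteq> fst c" "W \<subseteq> fst d"
    and f: "smooth_on (snd d ` W) (\<lambda>y. f (chart_inv d y))"
  shows "smooth_on (snd c ` W) (\<lambda>y. f (chart_inv c y))"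
proof -
  have oc: "open (snd c ` W)" and od: "open (snd d ` W)"
    using chart_image_open[OF c W(1)] chart_image_open[OF d W(1)] W by (simp_all add: Int_absorb1)
  have "smooth_on (snd c ` W) (snd d \<circ> chart_inv c)"
    using t W unfolding smooth_transition_def by (rule_tac smooth_on_subset) auto
  moreover have "(snd d \<circ> chart_inv c) ` snd c ` W \<subseteq> snd d ` W"
    using W chart_inv_left[OF c] by force
  ultimately have "smooth_on (snd c ` W) (\<lambda>y. f (chart_inv d ((snd d \<circ> chart_inv c) y)))"
    using f by (rule_tac smooth_on_compose[OF oc od])
  then show ?thesis
  proof (rule smooth_on_cong[OF oc, rotated])
    fix y assume "y \<in> snd c ` W"
    then obtain q where q: "q \<in> W" "y = snd c q" by blast
    then have "q \<in> fst c" "q \<in> fst d" using W by auto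
    then show "f (chart_inv d ((snd d \<circ> chart_inv c) y)) = f (chart_inv c y)"
      using q by (simp add: chart_inv_left[OF c] chart_inv_left[OF d])
  qed
qed

text \<open>Smoothness is defined through all charts of A at once. Compatibility of charts reduces
  it to one chart of the maximal atlas, chosen at will, so that later arguments can be carried out
  in coordinates.\<close>

lemma smooth_near_iff:
  assumes A: "smooth_atlas A" and c: "c \<in> maximal_atlas A" and p: "p \<in> fst c"
  shows "smooth_near A p f \<longleftrightarrow>
    (\<exists>V. open V \<and> snd c p \<in> V \<and> V \<subseteq> snd c ` fst c \<and> smooth_on V (\<lambda>y. f (chart_inv c y)))"
proof
  assume "smooth_near A p f"
  then obtain U where U: "open U" "p \<in> U" "U \<subseteq> carrier_of A" "smooth_fun A U f"
    unfolding smooth_near_def by blast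
  then obtain d where d: "d \<in> A" "p \<in> fst d" by (auto simp: carrier_of_def)
  have cd: "is_chart d" using A d by (auto simp: smooth_atlas_def)
  note cc = maximal_atlasD[OF c]
  let ?W = "fst c \<inter> fst d \<inter> U"
  have W: "open ?W" using U is_chartD(1)[OF cd] is_chartD(1)[OF cc(1)] by (intro open_Int)
  have "smooth_on (snd d ` ?W) (\<lambda>y. f (chart_inv d y))"
    using U(4) d unfolding smooth_fun_def o_def by (auto intro: smooth_on_subset)
  from smooth_on_change_chart[OF cc(1) cd cc(3)[OF d(1)] W _ _ this]
  have "smooth_on (snd c ` ?W) (\<lambda>y. f (chart_inv c y))" by auto
  moreover have "open (snd c ` ?W)"
    using chart_image_open[OF cc(1) W] by (simp add: Int_assoc[symmetric])
  ultimately show "\<exists>V. open V \<and> snd c p \<in> V \<and> V \<subseteq> snd c ` fst c \<and> smooth_on V (\<lambda>y. f (chart_inv c y))"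
    using d p U by (intro exI[of _ "snd c ` ?W"]) auto
next
  assume "\<exists>V. open V \<and> snd c p \<in> V \<and> V \<subseteq> snd c ` fst c \<and> smooth_on V (\<lambda>y. f (chart_inv c y))"
  then obtain V where V: "open V" "snd c p \<in> V" "V \<subseteq> snd c ` fst c" "smooth_on V (\<lambda>y. f (chart_inv c y))"
    by blast
  note cc = maximal_atlasD[OF c]
  let ?U = "{q \<in> fst c. snd c q \<in> V}"
  have U: "open ?U" by (rule chart_vimage_open[OF cc(1) V(1)])
  have "smooth_fun A ?U f" unfolding smooth_fun_def o_def
  proof
    fix d assume d: "d \<in> A"
    then have cd: "is_chart d" using A by (auto simp: smooth_atlas_def)
    have W: "open (fst d \<inter> ?U)" using U is_chartD(1)[OF cd] by (intro open_Int)
    have "smooth_on (snd c ` (fst d \<inter> ?U)) (\<lambda>y. f (chart_inv c y))"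
      by (rule smooth_on_subset[OF V(4)]) auto
    from smooth_on_change_chart[OF cd cc(1) cc(4)[OF d] W _ _ this]
    show "smooth_on (snd d ` (fst d \<inter> ?U)) (\<lambda>y. f (chart_inv d y))" by auto
  qed
  then show "smooth_near A p f"
    unfolding smooth_near_def using U p V(2) cc(2) by (intro exI[of _ ?U]) auto
qed

lemma smooth_near_ballE:
  assumes "smooth_atlas A" "c \<in> maximal_atlas A" "p \<in> fst c" "smooth_near A p f"
  obtains r where "r > 0" "ball (snd c p) r \<subseteq> snd c ` fst c" "smooth_on (ball (snd c p) r) (\<lambda>y. f (chart_inv c y))"
proof -
  obtain V where V: "open V" "snd c p \<in> V" "V \<subseteq> snd c ` fst c" "smooth_on V (\<lambda>y. f (chart_inv c y))"
    using assms(4) unfolding smooth_near_iff[OF assms(1-3)] by blast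
  from openE[OF V(1,2)] obtain r where r: "r > 0" "ball (snd c p) r \<subseteq> V" .
  show ?thesis by (rule that[OF r(1) _ smooth_on_subset[OF V(4) r(2)]]) (use r V in blast)
qed

lemma smooth_nearI:
  assumes A: "smooth_atlas A" and c: "c \<in> maximal_atlas A" and p: "p \<in> fst c"
    and V: "open V" "snd c p \<in> V" and F: "smooth_on V F"
    and eq: "\<And>y. y \<in> V \<Longrightarrow> y \<in> snd c ` fst c \<Longrightarrow> f (chart_inv c y) = F y"
  shows "smooth_near A p f"
proof -
  let ?V = "V \<inter> snd c ` fst c"
  have o: "open ?V" using V is_chartD[OF maximal_atlasD(1)[OF c]] by auto
  have "smooth_on ?V (\<lambda>y. f (chart_inv c y))"
    by (rule smooth_on_cong[OF o _ smooth_on_subset[OF F]]) (use eq in auto)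
  then show ?thesis unfolding smooth_near_iff[OF A c p] using o p V by (intro exI[of _ ?V]) auto
qed

lemma smooth_fun_iff_near:
  assumes A: "smooth_atlas A" and U: "open U" "U \<subseteq> carrier_of A"
  shows "smooth_fun A U f \<longleftrightarrow> (\<forall>p\<in>U. smooth_near A p f)"
proof
  assume "smooth_fun A U f" then show "\<forall>p\<in>U. smooth_near A p f"
    using U unfolding smooth_near_def by blast
next
  assume L: "\<forall>p\<in>U. smooth_near A p f"
  show "smooth_fun A U f" unfolding smooth_fun_def o_def
  proof (intro ballI smooth_on_local)
    fix d y assume d: "d \<in> A" and "y \<in> snd d ` (fst d \<inter> U)"
    then obtain p where p: "p \<in> fst d" "p \<in> U" "y = snd d p" by auto
    from L p(2) have "smooth_near A p f" by blast
    from smooth_near_ballE[OF A maximal_atlasI[OF A d] p(1) this] obtain r where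
      "r > 0" "smooth_on (ball (snd d p) r) (\<lambda>y. f (chart_inv d y))" by blast
    then show "\<exists>T. open T \<and> y \<in> T \<and> smooth_on T (\<lambda>y. f (chart_inv d y))"
      using p by (intro exI[of _ "ball (snd d p) r"]) auto
  qed
qed

lemma eventually_nhds_chart:
  assumes "is_chart c" "p \<in> fst c" "open V" "snd c p \<in> V"
    "\<And>q. q \<in> fst c \<Longrightarrow> snd c q \<in> V \<Longrightarrow> P q"
  shows "eventually P (nhds p)"
  unfolding eventually_nhds
  by (intro exI[of _ "{q \<in> fst c. snd c q \<in> V}"] conjI chart_vimage_open[OF assms(1,3)])
    (use assms(2,4,5) in auto)

lemma eventually_chart_nhds:
  assumes "is_chart c" "p \<in> fst c" "eventually P (nhds p)"
  obtains r where "r > 0" "ball (snd c p) r \<subseteq> snd c ` fst c"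
    "\<forall>y\<in>ball (snd c p) r. P (chart_inv c y)"
proof -
  obtain W where W: "open W" "p \<in> W" "\<And>q. q \<in> W \<Longrightarrow> P q" using assms(3) unfolding eventually_nhds by blast
  have "open (snd c ` (fst c \<inter> W))" using chart_image_open[OF assms(1) W(1)] .
  then obtain r where r: "r > 0" "ball (snd c p) r \<subseteq> snd c ` (fst c \<inter> W)"
    using W assms(2) openE[of "snd c ` (fst c \<inter> W)" "snd c p"] by blast
  show ?thesis
  proof (rule that[OF r(1)])
    show "ball (snd c p) r \<subseteq> snd c ` fst c" using r by blast
    show "\<forall>y\<in>ball (snd c p) r. P (chart_inv c y)"
    proof
    fix y assume "y \<in> ball (snd c p) r"
    then have "y \<in> snd c ` (fst c \<inter> W)" using r(2) by (rule_tac subsetD)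
    then obtain q where "q \<in> fst c" "q \<in> W" "y = snd c q" by blast
    then show "P (chart_inv c y)" by (simp add: chart_inv_left[OF assms(1)] W(3))
    qed
  qed
qed

section \<open>Closure properties of germs of smooth functions\<close>

lemma smooth_near_const:
  assumes A: "smooth_atlas A" and p: "p \<in> carrier_of A"
  shows "smooth_near A p (\<lambda>x. a)"
proof -
  obtain c where "c \<in> A" "p \<in> fst c" using p by (auto simp: carrier_of_def)
  then show ?thesis using smooth_nearI[OF A maximal_atlasI[OF A], of c p UNIV "\<lambda>y. a"] by auto
qed

lemma smooth_near_carrier: "smooth_near A p f \<Longrightarrow> p \<in> carrier_of A"
  by (auto simp: smooth_near_def)

lemma smooth_near_lift2:
  fixes A :: "('m::topological_space, 'e::euclidean_space) chart set"
  assumes A: "smooth_atlas A" and f: "smooth_near A p f" and g: "smooth_near A p g"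
    and H: "\<And>(V :: 'e set) F G. open V \<Longrightarrow> smooth_on V F \<Longrightarrow> smooth_on V G \<Longrightarrow> smooth_on V (\<lambda>y. H (F y) (G y))"
  shows "smooth_near A p (\<lambda>x. H (f x) (g x) :: real)"
proof -
  obtain c where c: "c \<in> A" "p \<in> fst c" using smooth_near_carrier[OF f] by (auto simp: carrier_of_def)
  note cm = maximal_atlasI[OF A c(1)]
  obtain r where r: "r > 0" "smooth_on (ball (snd c p) r) (\<lambda>y. f (chart_inv c y))"
    using smooth_near_ballE[OF A cm c(2) f] by blast
  obtain s where s: "s > 0" "smooth_on (ball (snd c p) s) (\<lambda>y. g (chart_inv c y))"
    using smooth_near_ballE[OF A cm c(2) g] by blast
  let ?V = "ball (snd c p) (min r s)"
  have "smooth_on ?V (\<lambda>y. H (f (chart_inv c y)) (g (chart_inv c y)))"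
    by (rule H[OF open_ball smooth_on_subset[OF r(2)] smooth_on_subset[OF s(2)]]) auto
  then show ?thesis
    by (rule smooth_nearI[OF A cm c(2), rotated 2]) (use r s in auto)
qed

lemma smooth_near_add: "smooth_atlas A \<Longrightarrow> smooth_near A p f \<Longrightarrow> smooth_near A p g \<Longrightarrow> smooth_near A p (\<lambda>x. f x + g x)"
  by (rule smooth_near_lift2[where H="(+)"]) (auto intro: smooth_on_add)

lemma smooth_near_mult: "smooth_atlas A \<Longrightarrow> smooth_near A p f \<Longrightarrow> smooth_near A p g \<Longrightarrow> smooth_near A p (\<lambda>x. f x * g x)"
  by (rule smooth_near_lift2[where H="(*)"]) (auto intro: smooth_on_mult)

lemma smooth_near_sum:
  assumes "smooth_atlas A" "p \<in> carrier_of A" "\<And>i. i \<in> I \<Longrightarrow> smooth_near A p (f i)"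
  shows "smooth_near A p (\<lambda>x. \<Sum>i\<in>I. f i x)"
  using assms(3)
  by (induction I rule: infinite_finite_induct)
    (auto intro: smooth_near_const[OF assms(1,2)] smooth_near_add[OF assms(1)])

lemma smooth_near_coord:
  assumes "smooth_atlas A" "c \<in> maximal_atlas A" "p \<in> fst c"
  shows "smooth_near A p (\<lambda>x. snd c x \<bullet> b)"
  by (rule smooth_nearI[OF assms, of UNIV "\<lambda>y. y \<bullet> b"])
    (auto intro!: smooth_on_inner smooth_on_ident simp: chart_inv_right)

lemma smooth_near_cong:
  assumes A: "smooth_atlas A" and f: "smooth_near A p f" and eq: "\<forall>\<^sub>F x in nhds p. f x = g x"
  shows "smooth_near A p g"
proof -
  obtain c where c: "c \<in> A" "p \<in> fst c" using smooth_near_carrier[OF f] by (auto simp: carrier_of_def)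
  note cm = maximal_atlasI[OF A c(1)]
  obtain r where r: "r > 0" "smooth_on (ball (snd c p) r) (\<lambda>y. f (chart_inv c y))"
    using smooth_near_ballE[OF A cm c(2) f] by blast
  from eventually_chart_nhds[OF maximal_atlasD(1)[OF cm] c(2) eq] obtain s where s: "s > 0"
    "ball (snd c p) s \<subseteq> snd c ` fst c" "\<forall>y\<in>ball (snd c p) s. f (chart_inv c y) = g (chart_inv c y)" .
  have "smooth_on (ball (snd c p) (min r s)) (\<lambda>y. f (chart_inv c y))"
    by (rule smooth_on_subset[OF r(2)]) auto
  then show ?thesis
    by (rule smooth_nearI[OF A cm c(2), rotated 2]) (use r s in auto)
qed

subsection \<open>Tangent vectors in coordinates\<close>

text \<open>The default 0 agrees with the normalisation in \<open>tangent_space\<close>, so that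
  derivations and coordinate vectors can be compared by plain equality of functions.\<close>

definition coord_tangent ::
  "('m::topological_space, 'e::euclidean_space) chart set \<Rightarrow> ('m, 'e) chart \<Rightarrow> 'm \<Rightarrow> 'e \<Rightarrow> 'm tangent" where
  "coord_tangent A c p w f =
     (if smooth_near A p f then frechet_derivative (\<lambda>y. f (chart_inv c y)) (at (snd c p)) w else 0)"

lemma smooth_near_differentiable:
  assumes "smooth_atlas A" "c \<in> maximal_atlas A" "p \<in> fst c" "smooth_near A p f"
  shows "(\<lambda>y. f (chart_inv c y)) differentiable (at (snd c p))"
proof -
  from smooth_near_ballE[OF assms] obtain r where r: "r > 0" "ball (snd c p) r \<subseteq> snd c ` fst c"
    "smooth_on (ball (snd c p) r) (\<lambda>y. f (chart_inv c y))" .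
  show ?thesis by (rule smooth_on_differentiable[OF r(3)]) (use r in simp)
qed

lemma coord_tangent_in_tangent_space:
  assumes A: "smooth_atlas A" and c: "c \<in> maximal_atlas A" and p: "p \<in> fst c"
  shows "coord_tangent A c p w \<in> tangent_space A p"
proof -
  note cc = maximal_atlasD(1)[OF c]
  have pc: "p \<in> carrier_of A" using maximal_atlasD(2)[OF c] p by blast
  have d: "((\<lambda>y. f (chart_inv c y)) has_derivative frechet_derivative (\<lambda>y. f (chart_inv c y)) (at (snd c p))) (at (snd c p))"
    if "smooth_near A p f" for f
    using smooth_near_differentiable[OF A c p that] by (simp add: frechet_derivative_works)
  show ?thesis unfolding tangent_space_def mem_Collect_eq
  proof (intro conjI allI impI)
    fix f assume "\<not> smooth_near A p f" then show "coord_tangent A c p w f = 0"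
      by (simp add: coord_tangent_def)
  next
    fix f g assume *: "smooth_near A p f \<and> smooth_near A p g \<and> (\<forall>\<^sub>F x in nhds p. f x = g x)"
    then have "\<forall>\<^sub>F x in nhds p. f x = g x" by blast
    from eventually_chart_nhds[OF cc p this] obtain s where "s > 0" "ball (snd c p) s \<subseteq> snd c ` fst c"
      "\<forall>y\<in>ball (snd c p) s. f (chart_inv c y) = g (chart_inv c y)" .
    then have "frechet_derivative (\<lambda>y. f (chart_inv c y)) (at (snd c p)) = frechet_derivative (\<lambda>y. g (chart_inv c y)) (at (snd c p))"
      by (intro frechet_derivative_transform_open[OF open_ball]) auto
    with * show "coord_tangent A c p w f = coord_tangent A c p w g"
      by (simp add: coord_tangent_def)
  next
    fix f g a b assume *: "smooth_near A p f \<and> smooth_near A p g"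
    have "smooth_near A p (\<lambda>x. a * f x + b * g x)"
      using * by (intro smooth_near_add smooth_near_mult smooth_near_const A pc) auto
    moreover have "frechet_derivative (\<lambda>y. a * f (chart_inv c y) + b * g (chart_inv c y)) (at (snd c p))
      = (\<lambda>w. a * frechet_derivative (\<lambda>y. f (chart_inv c y)) (at (snd c p)) w
           + b * frechet_derivative (\<lambda>y. g (chart_inv c y)) (at (snd c p)) w)"
      using * by (intro frechet_derivative_eqI has_derivative_add has_derivative_mult_right d) auto
    ultimately show "coord_tangent A c p w (\<lambda>x. a * f x + b * g x)
       = a * coord_tangent A c p w f + b * coord_tangent A c p w g"
      using * by (simp add: coord_tangent_def)
  next
    fix f g assume *: "smooth_near A p f \<and> smooth_near A p g"
    have "smooth_near A p (\<lambda>x. f x * g x)" using * by (intro smooth_near_mult A) auto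
    moreover have "frechet_derivative (\<lambda>y. f (chart_inv c y) * g (chart_inv c y)) (at (snd c p))
      = (\<lambda>w. f (chart_inv c (snd c p)) * frechet_derivative (\<lambda>y. g (chart_inv c y)) (at (snd c p)) w
           + frechet_derivative (\<lambda>y. f (chart_inv c y)) (at (snd c p)) w * g (chart_inv c (snd c p)))"
      using * by (intro frechet_derivative_eqI has_derivative_mult d) auto
    ultimately show "coord_tangent A c p w (\<lambda>x. f x * g x)
       = f p * coord_tangent A c p w g + g p * coord_tangent A c p w f"
      using * by (simp add: coord_tangent_def chart_inv_left[OF cc p])
  qed
qed

lemma tangent_space_sum:
  assumes A: "smooth_atlas A" and p: "p \<in> carrier_of A" and v: "v \<in> tangent_space A p"
    and f: "\<And>i. i \<in> I \<Longrightarrow> smooth_near A p (f i)"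
  shows "v (\<lambda>x. \<Sum>i\<in>I. f i x) = (\<Sum>i\<in>I. v (f i))"
proof -
  have lin: "v (\<lambda>x. a * f x + b * g x) = a * v f + b * v g" if "smooth_near A p f" "smooth_near A p g" for f g a b
    using v that by (simp add: tangent_space_def)
  have "v (\<lambda>x. 0 * 0 + 0 * 0) = 0 * v (\<lambda>x. 0) + 0 * v (\<lambda>x. 0)"
    using lin[of "\<lambda>x. 0" "\<lambda>x. 0" 0 0] smooth_near_const[OF A p] by blast
  then have 0: "v (\<lambda>x. 0) = 0" by simp
  show ?thesis using f
  proof (induction I rule: infinite_finite_induct)
    case (insert i I)
    have "v (\<lambda>x. 1 * f i x + 1 * (\<Sum>i\<in>I. f i x)) = 1 * v (f i) + 1 * v (\<lambda>x. \<Sum>i\<in>I. f i x)"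
      using insert.prems by (intro lin smooth_near_sum[OF A p]) auto
    then show ?case using insert by simp
  qed (simp_all add: 0)
qed

text \<open>By Hadamard's lemma, f is near p a constant plus a sum of products of a coordinate
  function vanishing at p with a smooth function \<open>G b\<close>. The derivation kills the
  constant, and the Leibniz rule leaves its value on the coordinate times the value of
  \<open>G b\<close> at p, which is a partial derivative of f.\<close>

lemma tangent_space_in_coordinates:
  assumes A: "smooth_atlas A" and c: "c \<in> maximal_atlas A" and p: "p \<in> fst c" and v: "v \<in> tangent_space A p"
  shows "v = coord_tangent A c p (\<Sum>b\<in>Basis. v (\<lambda>x. snd c x \<bullet> b) *\<^sub>R b)"
proof
  fix f
  note cc = maximal_atlasD(1)[OF c]
  have pc: "p \<in> carrier_of A" using maximal_atlasD(2)[OF c] p by blast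
  have lin: "v (\<lambda>x. a * f x + b * g x) = a * v f + b * v g" if "smooth_near A p f" "smooth_near A p g" for f g a b
    using v that by (simp add: tangent_space_def)
  have mul: "v (\<lambda>x. f x * g x) = f p * v g + g p * v f" if "smooth_near A p f" "smooth_near A p g" for f g
    using v that by (simp add: tangent_space_def)
  have germ: "v f = v g" if "smooth_near A p f" "smooth_near A p g" "\<forall>\<^sub>F x in nhds p. f x = g x" for f g
    using v that by (simp add: tangent_space_def)
  have con: "smooth_near A p (\<lambda>x. a)" for a using smooth_near_const[OF A pc] .
  \<comment> \<open>The Leibniz rule for the product of 1 with itself gives v 1 = v 1 + v 1.\<close>
  have "v (\<lambda>x. 1) = 0" using mul[OF con con, of 1 1] by simp
  then have vconst: "v (\<lambda>x. a) = 0" for a using lin[OF con con, of a 1 0 0] by simp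
  show "v f = coord_tangent A c p (\<Sum>b\<in>Basis. v (\<lambda>x. snd c x \<bullet> b) *\<^sub>R b) f"
  proof (cases "smooth_near A p f")
    case False then show ?thesis using v by (simp add: tangent_space_def coord_tangent_def)
  next
    case True
    let ?F = "\<lambda>y. f (chart_inv c y)" and ?y = "snd c p"
    obtain r where r: "r > 0" "ball ?y r \<subseteq> snd c ` fst c" "smooth_on (ball ?y r) ?F"
      using smooth_near_ballE[OF A c p True] by blast
    obtain G where G: "\<And>b. smooth_on (ball ?y r) (G b)" "\<And>b. G b ?y = frechet_derivative ?F (at ?y) b"
      "\<And>y. y \<in> ball ?y r \<Longrightarrow> ?F y = ?F ?y + (\<Sum>b\<in>Basis. ((y - ?y) \<bullet> b) * G b y)"
      using hadamard[OF r(3,1)] by blast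
    have G': "smooth_near A p (\<lambda>x. G b (snd c x))" for b
      by (rule smooth_nearI[OF A c p open_ball _ G(1)[of b]]) (use r in \<open>auto simp: chart_inv_right\<close>)
    \<comment> \<open>The units are spelled out so that the expression matches the linearity axiom
      of \<open>tangent_space\<close> literally.\<close>
    have co: "smooth_near A p (\<lambda>x. 1 * (snd c x \<bullet> b) + (- (?y \<bullet> b)) * 1)" for b
      by (intro smooth_near_add smooth_near_mult con A smooth_near_coord c p)
    let ?t = "\<lambda>b x. (1 * (snd c x \<bullet> b) + (- (?y \<bullet> b)) * 1) * G b (snd c x)"
    have t: "smooth_near A p (?t b)" for b by (intro smooth_near_mult co G' A)
    have vt: "v (?t b) = v (\<lambda>x. snd c x \<bullet> b) * frechet_derivative ?F (at ?y) b" for b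
      using mul[OF co[of b] G'[of b]] lin[OF smooth_near_coord[OF A c p] con, of 1 b "- (?y \<bullet> b)" 1] vconst[of 1]
      by (simp add: G(2))
    have "v f = v (\<lambda>x. 1 * f p + 1 * (\<Sum>b\<in>Basis. ?t b x))"
    proof (rule germ[OF True])
      show "smooth_near A p (\<lambda>x. 1 * f p + 1 * (\<Sum>b\<in>Basis. ?t b x))"
        by (intro smooth_near_add smooth_near_mult con smooth_near_sum A pc co G')
      show "\<forall>\<^sub>F x in nhds p. f x = 1 * f p + 1 * (\<Sum>b\<in>Basis. ?t b x)"
      proof (rule eventually_nhds_chart[OF cc p open_ball, of ?y r])
        fix q assume "q \<in> fst c" "snd c q \<in> ball ?y r"
        then show "f q = 1 * f p + 1 * (\<Sum>b\<in>Basis. ?t b q)"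
          using G(3)[of "snd c q"] by (simp add: chart_inv_left[OF cc] p inner_diff_left)
      qed (use r in auto)
    qed
    also have "\<dots> = 1 * v (\<lambda>x. f p) + 1 * v (\<lambda>x. \<Sum>b\<in>Basis. ?t b x)"
      by (intro lin con smooth_near_sum A pc t)
    also have "\<dots> = (\<Sum>b\<in>Basis. v (?t b))"
      using tangent_space_sum[OF A pc v t] vconst by simp
    also have "\<dots> = (\<Sum>b\<in>Basis. v (\<lambda>x. snd c x \<bullet> b) *\<^sub>R frechet_derivative ?F (at ?y) b)"
      by (simp only: vt real_scaleR_def)
    also have "\<dots> = frechet_derivative ?F (at ?y) (\<Sum>b\<in>Basis. v (\<lambda>x. snd c x \<bullet> b) *\<^sub>R b)"
      using linear_frechet_derivative[OF smooth_near_differentiable[OF A c p True]]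
      by (simp add: linear_sum linear_cmul o_def)
    finally show ?thesis using True by (simp add: coord_tangent_def)
  qed
qed

subsection \<open>Vector fields in coordinates\<close>

text \<open>While \<open>chart_rep\<close> reads off a candidate from the coordinate functions
  alone, this says that the coordinate field \<xi> determines X on all functions. For brackets and
  N-folds it is verified directly, without first placing them in
  \<open>vector_fields\<close>.\<close>

definition has_rep ::
  "('m::topological_space, 'e::euclidean_space) chart set \<Rightarrow> ('m, 'e) chart \<Rightarrow> ('m \<Rightarrow> 'm tangent) \<Rightarrow> ('e \<Rightarrow> 'e) \<Rightarrow> bool" where
  "has_rep A c X \<xi> \<longleftrightarrow> (\<forall>p\<in>fst c. X p = coord_tangent A c p (\<xi> (snd c p)))"

lemma coord_tangent_coord:
  assumes A: "smooth_atlas A" and c: "c \<in> maximal_atlas A" and p: "p \<in> fst c"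
  shows "coord_tangent A c p w (\<lambda>x. snd c x \<bullet> b) = w \<bullet> b"
proof -
  have "frechet_derivative (\<lambda>y. snd c (chart_inv c y) \<bullet> b) (at (snd c p)) = frechet_derivative (\<lambda>y. y \<bullet> b) (at (snd c p))"
    by (rule frechet_derivative_transform_open[OF is_chartD(2)[OF maximal_atlasD(1)[OF c]]])
      (use p in \<open>auto simp: chart_inv_right\<close>)
  also have "\<dots> = (\<lambda>w. w \<bullet> b)"
    by (rule frechet_derivative_eqI) (auto intro!: derivative_eq_intros)
  finally show ?thesis by (simp add: coord_tangent_def smooth_near_coord[OF A c p])
qed

lemma has_rep_chart_rep:
  assumes A: "smooth_atlas A" and c: "c \<in> maximal_atlas A" and X: "X \<in> vector_fields A"
  shows "has_rep A c X (chart_rep c X)"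
  unfolding has_rep_def
proof
  fix p assume p: "p \<in> fst c"
  then have "p \<in> carrier_of A" using maximal_atlasD(2)[OF c] by blast
  then have "X p \<in> tangent_space A p" using X by (simp add: vector_fields_def)
  from tangent_space_in_coordinates[OF A c p this]
  show "X p = coord_tangent A c p (chart_rep c X (snd c p))"
    by (simp add: chart_rep_def chart_inv_left[OF maximal_atlasD(1)[OF c] p])
qed

lemma chart_rep_unique:
  assumes A: "smooth_atlas A" and c: "c \<in> maximal_atlas A" and X: "has_rep A c X \<xi>" and y: "y \<in> snd c ` fst c"
  shows "chart_rep c X y = \<xi> y"
proof -
  have p: "chart_inv c y \<in> fst c" using y by (rule chart_inv_in)
  have "X (chart_inv c y) = coord_tangent A c (chart_inv c y) (\<xi> y)"
    using X p y by (simp add: has_rep_def chart_inv_right)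
  then show ?thesis
    by (simp add: chart_rep_def coord_tangent_coord[OF A c p] euclidean_representation)
qed

lemma smooth_on_chartI:
  assumes A: "smooth_atlas A" and c: "c \<in> maximal_atlas A" and f: "\<And>p. p \<in> fst c \<Longrightarrow> smooth_near A p f"
  shows "smooth_on (snd c ` fst c) (\<lambda>y. f (chart_inv c y))"
proof (rule smooth_on_local)
  fix y assume "y \<in> snd c ` fst c"
  then obtain p where p: "p \<in> fst c" "y = snd c p" by blast
  from smooth_near_ballE[OF A c p(1) f[OF p(1)]] obtain r where r: "r > 0" "ball (snd c p) r \<subseteq> snd c ` fst c"
    "smooth_on (ball (snd c p) r) (\<lambda>y. f (chart_inv c y))" .
  show "\<exists>T. open T \<and> y \<in> T \<and> smooth_on T (\<lambda>y. f (chart_inv c y))"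
    by (intro exI[of _ "ball (snd c p) r"]) (use r p in simp)
qed

lemma smooth_on_chart_rep:
  assumes A: "smooth_atlas A" and c: "c \<in> maximal_atlas A" and X: "X \<in> vector_fields A"
  shows "smooth_on (snd c ` fst c) (chart_rep c X)"
proof -
  note cc = maximal_atlasD[OF c]
  note o = is_chartD[OF cc(1)]
  have "smooth_fun A (fst c) (\<lambda>x. snd c x \<bullet> b)" for b
    unfolding smooth_fun_iff_near[OF A o(1) cc(2)] by (intro ballI smooth_near_coord A c)
  then have "smooth_fun A (fst c) (\<lambda>p. X p (\<lambda>x. snd c x \<bullet> b))" for b
    using X o(1) cc(2) by (simp add: vector_fields_def)
  then have "smooth_on (snd c ` fst c) (\<lambda>y. X (chart_inv c y) (\<lambda>x. snd c x \<bullet> b))" for b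
    unfolding smooth_fun_iff_near[OF A o(1) cc(2)] by (intro smooth_on_chartI[OF A c, where f="\<lambda>p. X p (\<lambda>x. snd c x \<bullet> b)"]) blast
  then show ?thesis unfolding chart_rep_def[abs_def]
    by (intro smooth_on_sum smooth_on_scaleR o(2) smooth_on_const)
qed

lemma has_rep_apply_near:
  assumes A: "smooth_atlas A" and c: "c \<in> maximal_atlas A" and p: "p \<in> fst c"
    and X: "has_rep A c X \<xi>" and f: "smooth_near A p f"
  obtains r where "r > 0" "ball (snd c p) r \<subseteq> snd c ` fst c"
    "smooth_on (ball (snd c p) r) (\<lambda>y. f (chart_inv c y))"
    "\<forall>y\<in>ball (snd c p) r. X (chart_inv c y) f = frechet_derivative (\<lambda>y. f (chart_inv c y)) (at y) (\<xi> y)"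
proof -
  from smooth_near_ballE[OF A c p f] obtain r where r: "r > 0" "ball (snd c p) r \<subseteq> snd c ` fst c"
    "smooth_on (ball (snd c p) r) (\<lambda>y. f (chart_inv c y))" .
  have "X (chart_inv c y) f = frechet_derivative (\<lambda>y. f (chart_inv c y)) (at y) (\<xi> y)"
    if y: "y \<in> ball (snd c p) r" for y
  proof -
    have y': "y \<in> snd c ` fst c" using r(2) y by (rule subsetD)
    then have q: "chart_inv c y \<in> fst c" by (rule chart_inv_in)
    have "smooth_near A (chart_inv c y) f"
      by (rule smooth_nearI[OF A c q open_ball _ r(3)]) (use y y' in \<open>simp_all add: chart_inv_right\<close>)
    then show ?thesis using X q y' by (simp add: has_rep_def coord_tangent_def chart_inv_right)
  qed
  then show ?thesis using r that by blast
qed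

lemma smooth_near_apply:
  assumes A: "smooth_atlas A" and c: "c \<in> maximal_atlas A" and p: "p \<in> fst c"
    and X: "has_rep A c X \<xi>" and \<xi>: "smooth_on (snd c ` fst c) \<xi>" and f: "smooth_near A p f"
  shows "smooth_near A p (\<lambda>q. X q f)"
proof -
  from has_rep_apply_near[OF A c p X f] obtain r where r: "r > 0" "ball (snd c p) r \<subseteq> snd c ` fst c"
    "smooth_on (ball (snd c p) r) (\<lambda>y. f (chart_inv c y))"
    "\<forall>y\<in>ball (snd c p) r. X (chart_inv c y) f = frechet_derivative (\<lambda>y. f (chart_inv c y)) (at y) (\<xi> y)" .
  show ?thesis
    by (rule smooth_nearI[OF A c p open_ball _ smooth_on_deriv_field[OF open_ball r(3) smooth_on_subset[OF \<xi> r(2)]]])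
      (use r in auto)
qed

definition coord_bracket :: "('a::real_normed_vector \<Rightarrow> 'a) \<Rightarrow> ('a \<Rightarrow> 'a) \<Rightarrow> 'a \<Rightarrow> 'a" where
  "coord_bracket \<xi> \<eta> y = frechet_derivative \<eta> (at y) (\<xi> y) - frechet_derivative \<xi> (at y) (\<eta> y)"

lemma smooth_on_coord_bracket:
  fixes \<xi> :: "'a::euclidean_space \<Rightarrow> 'a"
  shows "open S \<Longrightarrow> smooth_on S \<xi> \<Longrightarrow> smooth_on S \<eta> \<Longrightarrow> smooth_on S (coord_bracket \<xi> \<eta>)"
  unfolding coord_bracket_def[abs_def] by (intro smooth_on_diff smooth_on_deriv_field)

lemma coord_bracket_cong:
  assumes "open S" "y \<in> S" "\<And>z. z \<in> S \<Longrightarrow> \<xi> z = \<xi>' z" "\<And>z. z \<in> S \<Longrightarrow> \<eta> z = \<eta>' z"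
  shows "coord_bracket \<xi> \<eta> y = coord_bracket \<xi>' \<eta>' y"
  using assms(2-4) frechet_derivative_transform_open[OF assms(1,2,3)] frechet_derivative_transform_open[OF assms(1,2,4)]
  by (simp add: coord_bracket_def)

lemma frechet_derivative_deriv_field:
  fixes F :: "'e::euclidean_space \<Rightarrow> real"
  assumes S: "open S" "x \<in> S" and F: "smooth_on S F" and \<eta>: "smooth_on S \<eta>"
  shows "frechet_derivative (\<lambda>y. frechet_derivative F (at y) (\<eta> y)) (at x) w
    = frechet_derivative F (at x) (frechet_derivative \<eta> (at x) w)
      + (\<Sum>b\<in>Basis. (\<eta> x \<bullet> b) * frechet_derivative (\<lambda>y. frechet_derivative F (at y) b) (at x) w)"
proof -
  have "frechet_derivative (\<lambda>y. frechet_derivative F (at y) (\<eta> y)) (at x)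
    = frechet_derivative (\<lambda>y. \<Sum>b\<in>Basis. (\<eta> y \<bullet> b) * frechet_derivative F (at y) b) (at x)"
  proof (rule frechet_derivative_transform_open[OF S])
    fix y assume "y \<in> S"
    then show "frechet_derivative F (at y) (\<eta> y) = (\<Sum>b\<in>Basis. (\<eta> y \<bullet> b) * frechet_derivative F (at y) b)"
      using frechet_derivative_Basis_sum[OF smooth_on_differentiable[OF F], of y "\<eta> y"] by simp
  qed
  also have "\<dots> = (\<lambda>w. \<Sum>b\<in>Basis. (\<eta> x \<bullet> b) * frechet_derivative (\<lambda>y. frechet_derivative F (at y) b) (at x) w
      + (frechet_derivative \<eta> (at x) w \<bullet> b) * frechet_derivative F (at x) b)"
    by (intro frechet_derivative_eqI has_derivative_sum has_derivative_mult has_derivative_inner_left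
        smooth_on_has_derivative[OF smooth_on_deriv[OF F] S(2)] smooth_on_has_derivative[OF \<eta> S(2)])
  finally have "frechet_derivative (\<lambda>y. frechet_derivative F (at y) (\<eta> y)) (at x) w
      = (\<Sum>b\<in>Basis. (frechet_derivative \<eta> (at x) w \<bullet> b) * frechet_derivative F (at x) b)
      + (\<Sum>b\<in>Basis. (\<eta> x \<bullet> b) * frechet_derivative (\<lambda>y. frechet_derivative F (at y) b) (at x) w)"
    by (simp add: sum.distrib)
  also have "(\<Sum>b\<in>Basis. (frechet_derivative \<eta> (at x) w \<bullet> b) * frechet_derivative F (at x) b)
     = frechet_derivative F (at x) (frechet_derivative \<eta> (at x) w)"
    using frechet_derivative_Basis_sum[OF smooth_on_differentiable[OF F S(2)], of "frechet_derivative \<eta> (at x) w"]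
    by (simp only: real_scaleR_def)
  finally show ?thesis .
qed

text \<open>By the product rule, each of the two terms is a first-order term plus a Hessian term.
  The Hessian terms agree because second derivatives are symmetric, and they cancel.\<close>

lemma commutator_deriv_fields:
  fixes F :: "'e::euclidean_space \<Rightarrow> real"
  assumes S: "open S" "x \<in> S" and F: "smooth_on S F" and \<xi>: "smooth_on S \<xi>" and \<eta>: "smooth_on S \<eta>"
  shows "frechet_derivative (\<lambda>y. frechet_derivative F (at y) (\<eta> y)) (at x) (\<xi> x)
       - frechet_derivative (\<lambda>y. frechet_derivative F (at y) (\<xi> y)) (at x) (\<eta> x)
       = frechet_derivative F (at x) (coord_bracket \<xi> \<eta> x)"
proof -
  let ?H = "\<lambda>b b'. frechet_derivative (\<lambda>y. frechet_derivative F (at y) b) (at x) b'"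
  have exp: "frechet_derivative (\<lambda>y. frechet_derivative F (at y) b) (at x) w = (\<Sum>b'\<in>Basis. (w \<bullet> b') * ?H b b')" for b w
    using frechet_derivative_Basis_sum[OF smooth_on_differentiable[OF smooth_on_deriv[OF F] S(2)], of b w] by simp
  have "(\<Sum>b\<in>Basis. (\<eta> x \<bullet> b) * frechet_derivative (\<lambda>y. frechet_derivative F (at y) b) (at x) (\<xi> x))
      = (\<Sum>b\<in>Basis. \<Sum>b'\<in>Basis. (\<eta> x \<bullet> b) * ((\<xi> x \<bullet> b') * ?H b b'))"
    by (simp only: exp[of _ "\<xi> x"] sum_distrib_left)
  also have "\<dots> = (\<Sum>b'\<in>Basis. \<Sum>b\<in>Basis. (\<eta> x \<bullet> b) * ((\<xi> x \<bullet> b') * ?H b b'))"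
    by (rule sum.swap)
  also have "\<dots> = (\<Sum>b'\<in>Basis. \<Sum>b\<in>Basis. (\<xi> x \<bullet> b') * ((\<eta> x \<bullet> b) * ?H b' b))"
  proof (intro sum.cong refl)
    fix b' b
    show "(\<eta> x \<bullet> b) * ((\<xi> x \<bullet> b') * ?H b b') = (\<xi> x \<bullet> b') * ((\<eta> x \<bullet> b) * ?H b' b)"
      using second_derivative_symmetric[OF S(1) F S(2), of b b'] by simp
  qed
  also have "\<dots> = (\<Sum>b\<in>Basis. (\<xi> x \<bullet> b) * frechet_derivative (\<lambda>y. frechet_derivative F (at y) b) (at x) (\<eta> x))"
    by (simp only: exp[of _ "\<eta> x"] sum_distrib_left)
  finally show ?thesis
    using linear_diff[OF linear_frechet_derivative[OF smooth_on_differentiable[OF F S(2)]]]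
    by (simp add: frechet_derivative_deriv_field[OF S F] \<xi> \<eta> coord_bracket_def)
qed

lemma has_rep_lie_bracket:
  assumes A: "smooth_atlas A" and c: "c \<in> maximal_atlas A"
    and X: "has_rep A c X \<xi>" and Y: "has_rep A c Y \<eta>"
    and \<xi>: "smooth_on (snd c ` fst c) \<xi>" and \<eta>: "smooth_on (snd c ` fst c) \<eta>"
  shows "has_rep A c (lie_bracket A X Y) (coord_bracket \<xi> \<eta>)"
  unfolding has_rep_def
proof (intro ballI ext)
  fix p f assume p: "p \<in> fst c"
  show "lie_bracket A X Y p f = coord_tangent A c p (coord_bracket \<xi> \<eta> (snd c p)) f"
  proof (cases "smooth_near A p f")
    case False then show ?thesis by (simp add: lie_bracket_def coord_tangent_def)
  next
    case True
    let ?F = "\<lambda>y. f (chart_inv c y)"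
    from has_rep_apply_near[OF A c p X True] obtain r where r: "r > 0" "ball (snd c p) r \<subseteq> snd c ` fst c"
      "smooth_on (ball (snd c p) r) ?F"
      "\<forall>y\<in>ball (snd c p) r. X (chart_inv c y) f = frechet_derivative ?F (at y) (\<xi> y)" .
    from has_rep_apply_near[OF A c p Y True] obtain s where s: "s > 0" "ball (snd c p) s \<subseteq> snd c ` fst c"
      "smooth_on (ball (snd c p) s) ?F"
      "\<forall>y\<in>ball (snd c p) s. Y (chart_inv c y) f = frechet_derivative ?F (at y) (\<eta> y)" .
    have "X p (\<lambda>q. Y q f) = frechet_derivative (\<lambda>y. Y (chart_inv c y) f) (at (snd c p)) (\<xi> (snd c p))"
      using X p smooth_near_apply[OF A c p Y \<eta> True] by (simp add: has_rep_def coord_tangent_def)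
    also have "\<dots> = frechet_derivative (\<lambda>y. frechet_derivative ?F (at y) (\<eta> y)) (at (snd c p)) (\<xi> (snd c p))"
      by (rule fun_cong[OF frechet_derivative_transform_open[OF open_ball]]) (use s in auto)
    finally have 1: "X p (\<lambda>q. Y q f) = frechet_derivative (\<lambda>y. frechet_derivative ?F (at y) (\<eta> y)) (at (snd c p)) (\<xi> (snd c p))" .
    have "Y p (\<lambda>q. X q f) = frechet_derivative (\<lambda>y. X (chart_inv c y) f) (at (snd c p)) (\<eta> (snd c p))"
      using Y p smooth_near_apply[OF A c p X \<xi> True] by (simp add: has_rep_def coord_tangent_def)
    also have "\<dots> = frechet_derivative (\<lambda>y. frechet_derivative ?F (at y) (\<xi> y)) (at (snd c p)) (\<eta> (snd c p))"
      by (rule fun_cong[OF frechet_derivative_transform_open[OF open_ball]]) (use r in auto)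
    finally have 2: "Y p (\<lambda>q. X q f) = frechet_derivative (\<lambda>y. frechet_derivative ?F (at y) (\<xi> y)) (at (snd c p)) (\<eta> (snd c p))" .
    have "lie_bracket A X Y p f = frechet_derivative ?F (at (snd c p)) (coord_bracket \<xi> \<eta> (snd c p))"
      unfolding lie_bracket_def using True
        commutator_deriv_fields[OF open_ball _ r(3) smooth_on_subset[OF \<xi> r(2)] smooth_on_subset[OF \<eta> r(2)], of "snd c p"] r(1)
      by (simp add: 1 2)
    then show ?thesis using True by (simp add: coord_tangent_def)
  qed
qed

subsection \<open>Constructing vector fields\<close>

lemma vector_fields_add_scaled:
  assumes A: "smooth_atlas A" and X: "X \<in> vector_fields A" and Y: "Y \<in> vector_fields A"
  shows "(\<lambda>p f. X p f + a * Y p f) \<in> vector_fields A"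
  unfolding vector_fields_def mem_Collect_eq
proof (intro conjI ballI allI impI)
  fix p assume p: "p \<in> carrier_of A"
  then have XY: "X p \<in> tangent_space A p" "Y p \<in> tangent_space A p" using X Y by (auto simp: vector_fields_def)
  obtain c where c: "c \<in> A" "p \<in> fst c" using p by (auto simp: carrier_of_def)
  note cm = maximal_atlasI[OF A c(1)]
  let ?w = "\<lambda>v. \<Sum>b\<in>Basis. v (\<lambda>x. snd c x \<bullet> b) *\<^sub>R b"
  have "X p f + a * Y p f = coord_tangent A c p (?w (X p) + a *\<^sub>R ?w (Y p)) f" for f
    using fun_cong[OF tangent_space_in_coordinates[OF A cm c(2) XY(1)], of f]
      fun_cong[OF tangent_space_in_coordinates[OF A cm c(2) XY(2)], of f]
      linear_frechet_derivative[OF smooth_near_differentiable[OF A cm c(2)], of f]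
    by (simp add: coord_tangent_def linear_add linear_cmul)
  then show "(\<lambda>f. X p f + a * Y p f) \<in> tangent_space A p"
    using coord_tangent_in_tangent_space[OF A cm c(2), of "?w (X p) + a *\<^sub>R ?w (Y p)"] by presburger
next
  fix p assume "p \<notin> carrier_of A"
  then show "(\<lambda>f. X p f + a * Y p f) = (\<lambda>f. 0)" using X Y by (simp add: vector_fields_def)
next
  fix U f assume *: "open U \<and> U \<subseteq> carrier_of A \<and> smooth_fun A U f"
  then have "smooth_fun A U (\<lambda>p. X p f)" "smooth_fun A U (\<lambda>p. Y p f)" using X Y by (auto simp: vector_fields_def)
  then have "\<forall>p\<in>U. smooth_near A p (\<lambda>p. X p f)" "\<forall>p\<in>U. smooth_near A p (\<lambda>p. Y p f)"
    using * smooth_fun_iff_near[OF A, of U] by simp_all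
  then have "\<forall>p\<in>U. smooth_near A p (\<lambda>p. X p f + a * Y p f)"
    using * by (intro ballI smooth_near_add smooth_near_mult smooth_near_const A) auto
  then show "smooth_fun A U (\<lambda>p. X p f + a * Y p f)"
    using * smooth_fun_iff_near[OF A, of U] by simp
qed

lemma vector_fields_add_sum:
  assumes A: "smooth_atlas A" and X: "X \<in> vector_fields A" and h: "\<And>t. t \<in> T \<Longrightarrow> h t \<in> vector_fields A"
  shows "(\<lambda>p f. X p f + (\<Sum>t\<in>T. a t * h t p f)) \<in> vector_fields A"
  using h
proof (induction T rule: infinite_finite_induct)
  case (insert t T)
  then have "(\<lambda>p f. (X p f + (\<Sum>t\<in>T. a t * h t p f)) + a t * h t p f) \<in> vector_fields A"
    by (intro vector_fields_add_scaled A) auto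
  then show ?case using insert by (simp add: algebra_simps)
qed (use X in simp_all)

lemma chart_rep_add_sum:
  "chart_rep c (\<lambda>p f. X p f + (\<Sum>t\<in>T. a t * h t p f)) y
    = chart_rep c X y + (\<Sum>t\<in>T. a t *\<^sub>R chart_rep c (h t) y)"
proof -
  have "(\<Sum>b\<in>Basis. (\<Sum>t\<in>T. a t * h t (chart_inv c y) (\<lambda>x. snd c x \<bullet> b)) *\<^sub>R b)
    = (\<Sum>t\<in>T. \<Sum>b\<in>Basis. (a t * h t (chart_inv c y) (\<lambda>x. snd c x \<bullet> b)) *\<^sub>R b)"
    unfolding scaleR_sum_left by (rule sum.swap)
  then show ?thesis unfolding chart_rep_def
    by (simp add: scaleR_left_distrib sum.distrib scaleR_sum_right)
qed

definition push_field ::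
  "('m::topological_space, 'e::euclidean_space) chart set \<Rightarrow> ('m, 'e) chart \<Rightarrow> ('e \<Rightarrow> 'e) \<Rightarrow> 'm \<Rightarrow> 'm tangent" where
  "push_field A c \<eta> p = (if p \<in> fst c then coord_tangent A c p (\<eta> (snd c p)) else (\<lambda>f. 0))"

lemma has_rep_push_field: "has_rep A c (push_field A c \<eta>) \<eta>"
  by (simp add: has_rep_def push_field_def)

lemma coord_tangent_0:
  assumes "smooth_atlas A" "c \<in> maximal_atlas A" "p \<in> fst c"
  shows "coord_tangent A c p 0 f = 0"
  using linear_0[OF linear_frechet_derivative[OF smooth_near_differentiable[OF assms]]]
  by (simp add: coord_tangent_def)

lemma push_field_zero:
  assumes "smooth_atlas A" "c \<in> maximal_atlas A" "\<And>y. y \<notin> K \<Longrightarrow> \<eta> y = 0" "K \<subseteq> snd c ` fst c"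
    "p \<notin> chart_inv c ` K"
  shows "push_field A c \<eta> p = (\<lambda>f. 0)"
proof (cases "p \<in> fst c")
  case True
  have "snd c p \<notin> K"
    using assms(5) chart_inv_left[OF maximal_atlasD(1)[OF assms(2)] True] by (metis image_eqI)
  then show ?thesis using True assms(3) by (auto simp: push_field_def coord_tangent_0[OF assms(1,2)])
qed (simp add: push_field_def)

lemma compact_chart_inv_image:
  assumes "is_chart c" "compact K" "K \<subseteq> snd c ` fst c"
  shows "compact (chart_inv c ` K)"
  using compact_continuous_image[OF continuous_on_subset[OF is_chartD(4)[OF assms(1)] assms(3)] assms(2)] .

text \<open>Smoothness is in question only at points outside the chart domain. The compact set that
  carries the field is closed because the manifold is Hausdorff, so such a point has a neighbourhood
  on which the field vanishes.\<close>

lemma push_field_in_vector_fields: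
  fixes A :: "('m::t2_space, 'e::euclidean_space) chart set"
  assumes A: "smooth_atlas A" and c: "c \<in> maximal_atlas A"
    and \<eta>: "smooth_on (snd c ` fst c) \<eta>" "\<And>y. y \<notin> K \<Longrightarrow> \<eta> y = 0"
    and K: "compact K" "K \<subseteq> snd c ` fst c"
  shows "push_field A c \<eta> \<in> vector_fields A"
  unfolding vector_fields_def mem_Collect_eq
proof (intro conjI ballI allI impI)
  note cc = maximal_atlasD[OF c]
  fix p assume p: "p \<in> carrier_of A"
  have "(\<lambda>f. 0) \<in> tangent_space A p" by (simp add: tangent_space_def)
  then show "push_field A c \<eta> p \<in> tangent_space A p"
    using coord_tangent_in_tangent_space[OF A c] by (simp add: push_field_def)
next
  fix p assume "p \<notin> carrier_of A"
  then show "push_field A c \<eta> p = (\<lambda>f. 0)" using maximal_atlasD(2)[OF c] by (auto simp: push_field_def)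
next
  fix U f assume *: "open U \<and> U \<subseteq> carrier_of A \<and> smooth_fun A U f"
  have "smooth_near A p (\<lambda>p. push_field A c \<eta> p f)" if p: "p \<in> U" for p
  proof -
    have f: "smooth_near A p f" using * p smooth_fun_iff_near[OF A] by blast
    show ?thesis
    proof (cases "p \<in> fst c")
      case True
      show ?thesis by (rule smooth_near_apply[OF A c True has_rep_push_field \<eta>(1) f])
    next
      case False
      have "closed (chart_inv c ` K)"
        by (rule compact_imp_closed[OF compact_chart_inv_image[OF maximal_atlasD(1)[OF c] K]])
      moreover have "p \<notin> chart_inv c ` K"
        using False chart_inv_in[OF subsetD[OF K(2)]] by blast
      ultimately have "\<forall>\<^sub>F q in nhds p. q \<in> - chart_inv c ` K"
        by (intro eventually_nhds_in_open) auto
      then have "\<forall>\<^sub>F q in nhds p. 0 = push_field A c \<eta> q f"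
        by (rule eventually_mono) (simp add: push_field_zero[OF A c \<eta>(2) K(2)])
      then show ?thesis
        by (rule smooth_near_cong[OF A smooth_near_const[OF A smooth_near_carrier[OF f]]])
    qed
  qed
  then show "smooth_fun A U (\<lambda>p. push_field A c \<eta> p f)" using * smooth_fun_iff_near[OF A, of U] by simp
qed

subsection \<open>The configuration space as a manifold\<close>

lemma linear_axis: "linear (axis i :: 'e::euclidean_space \<Rightarrow> 'e ^ 'k::finite)"
  by (rule linearI) (auto simp: vec_eq_iff axis_def)

lemma bounded_linear_axis: "bounded_linear (axis i :: 'e::euclidean_space \<Rightarrow> 'e ^ 'k::finite)"
  using linear_axis by (simp add: linear_conv_bounded_linear)

lemma norm_axis: "norm (axis i x :: 'e::euclidean_space ^ 'k::finite) = norm x"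
  unfolding norm_eq_sqrt_inner inner_axis by (simp add: axis_def)

lemma sum_axis: "(\<Sum>i\<in>UNIV. axis i (x i)) = (\<chi> i. (x i :: 'e::euclidean_space))"
  by (simp add: vec_eq_iff axis_def if_distrib cong: if_cong)

lemma has_derivative_vec_lambda:
  fixes f :: "'k::finite \<Rightarrow> 'a::real_normed_vector \<Rightarrow> 'e::euclidean_space"
  assumes "\<And>i. (f i has_derivative f' i) (at x)"
  shows "((\<lambda>x. \<chi> i. f i x) has_derivative (\<lambda>v. \<chi> i. f' i v)) (at x)"
  unfolding sum_axis[symmetric]
  by (intro has_derivative_sum bounded_linear.has_derivative[OF bounded_linear_axis] assms)

definition product_chart ::
  "('m::topological_space, 'e::euclidean_space) chart set \<Rightarrow> ('k::finite \<Rightarrow> ('m, 'e) chart) \<Rightarrow> ('m ^ 'k, 'e ^ 'k) chart" where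
  "product_chart A c = ({x. \<forall>i. x $ i \<in> fst (c i)} - fat_diagonal A, \<lambda>x. \<chi> i. snd (c i) (x $ i))"

lemma config_atlas_eq: "config_atlas A = {product_chart A c | c. \<forall>i. c i \<in> A}"
  by (simp add: config_atlas_def product_chart_def)

lemma product_chart_domain:
  assumes "\<And>i. c i \<in> A"
  shows "fst (product_chart A c) = {x. (\<forall>i. x $ i \<in> fst (c i)) \<and> (\<forall>i j. i \<noteq> j \<longrightarrow> x $ i \<noteq> x $ j)}"
  using assms by (auto simp: product_chart_def fat_diagonal_def carrier_of_def)

lemma snd_product_chart_nth [simp]: "snd (product_chart A c) x $ i = snd (c i) (x $ i)"
  by (simp add: product_chart_def)

locale chart_family =
  fixes A :: "('m::t2_space, 'e::euclidean_space) chart set" and c :: "'k::finite \<Rightarrow> ('m, 'e) chart"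
  assumes A: "smooth_atlas A" and cA: "c i \<in> A"
begin

abbreviation "C \<equiv> product_chart A c"

lemma ci: "is_chart (c i)" and cm: "c i \<in> maximal_atlas A"
  using A cA maximal_atlasI[OF A cA] by (auto simp: smooth_atlas_def)

text \<open>Besides lying in the given chart domains, the points have to be distinct. This is an
  open condition because the manifold is Hausdorff.\<close>

lemma open_domain: "open (fst C)"
proof -
  have "fst C = {x. \<forall>i. x $ i \<in> fst (c i)} \<inter> (\<Inter>(i,j)\<in>{(i,j). i \<noteq> j}. {x. x $ i \<noteq> x $ j})"
    by (auto simp: product_chart_domain[of c A, OF cA])
  moreover have "open {x :: 'm ^ 'k. \<forall>i. x $ i \<in> fst (c i)}"
    by (rule open_vector_box) (use is_chartD(1)[OF ci] in blast)
  moreover have "open {x :: 'm ^ 'k. x $ i \<noteq> x $ j}" for i j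
    by (intro open_Collect_neq continuous_intros)
  ultimately show ?thesis by (auto intro!: open_Int open_INT)
qed

lemma inj: "inj_on (snd C) (fst C)"
proof (rule inj_onI)
  fix a b assume ab: "a \<in> fst C" "b \<in> fst C" "snd C a = snd C b"
  have "a $ i = b $ i" for i
  proof (rule inj_onD[OF is_chartD(5)[OF ci[of i]]])
    show "snd (c i) (a $ i) = snd (c i) (b $ i)" using ab(3) by (metis snd_product_chart_nth)
  qed (use ab in \<open>simp_all add: product_chart_domain[of c A, OF cA]\<close>)
  then show "a = b" by (simp add: vec_eq_iff)
qed

lemma inv_eq:
  assumes "y \<in> snd C ` fst C"
  shows "chart_inv C y = (\<chi> i. chart_inv (c i) (y $ i))" "y $ i \<in> snd (c i) ` fst (c i)"
proof -
  from assms obtain x where x: "x \<in> fst C" "y = snd C x" by blast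
  have xi: "x $ i \<in> fst (c i)" for i using x(1) by (simp add: product_chart_domain[of c A, OF cA])
  then show "y $ i \<in> snd (c i) ` fst (c i)" using x by simp
  have 1: "(\<chi> i. chart_inv (c i) (y $ i)) = x"
    using xi x by (simp add: vec_eq_iff chart_inv_left[OF ci])
  from inj have "chart_inv C y = x" using x by (simp add: inv_into_f_f)
  with 1 show "chart_inv C y = (\<chi> i. chart_inv (c i) (y $ i))" by simp
qed

lemma continuous_inv_box:
  "continuous_on {y. \<forall>i. y $ i \<in> snd (c i) ` fst (c i)} (\<lambda>y. \<chi> i. chart_inv (c i) (y $ i))"
proof (rule continuous_on_vec_lambda)
  fix i
  show "continuous_on {y. \<forall>i. y $ i \<in> snd (c i) ` fst (c i)} (\<lambda>y. chart_inv (c i) (y $ i))"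
    by (rule continuous_on_compose2[OF is_chartD(4)[OF ci[of i]]]) (auto intro!: continuous_intros)
qed

text \<open>Removing the fat diagonal destroys the product form of the image. It is described
  instead as a preimage under the componentwise inverse, which is continuous on the full product,
  and this gives openness.\<close>

lemma image_eq:
  "snd C ` fst C = {y. \<forall>i. y $ i \<in> snd (c i) ` fst (c i)} \<inter> (\<lambda>y. \<chi> i. chart_inv (c i) (y $ i)) -` fst C"
proof (intro equalityI subsetI)
  fix y assume y: "y \<in> snd C ` fst C"
  then have "chart_inv C y \<in> fst C" by (rule chart_inv_in)
  then show "y \<in> {y. \<forall>i. y $ i \<in> snd (c i) ` fst (c i)} \<inter> (\<lambda>y. \<chi> i. chart_inv (c i) (y $ i)) -` fst C"
    using inv_eq[OF y] by simp
next
  fix y assume y: "y \<in> {y. \<forall>i. y $ i \<in> snd (c i) ` fst (c i)} \<inter> (\<lambda>y. \<chi> i. chart_inv (c i) (y $ i)) -` fst C"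
  have "y = snd C (\<chi> i. chart_inv (c i) (y $ i))"
    using y by (simp add: vec_eq_iff chart_inv_right)
  then show "y \<in> snd C ` fst C" using y by blast
qed

lemma open_image: "open (snd C ` fst C)"
proof -
  have "open {y :: 'e ^ 'k. \<forall>i. y $ i \<in> snd (c i) ` fst (c i)}"
    by (rule open_vector_box) (use is_chartD(2)[OF ci] in blast)
  then show ?thesis unfolding image_eq
    by (rule continuous_open_preimage[OF continuous_inv_box _ open_domain])
qed

lemma continuous_chart: "continuous_on (fst C) (snd C)"
proof -
  have "continuous_on (fst C) (\<lambda>x. \<chi> i. snd (c i) (x $ i))"
  proof (rule continuous_on_vec_lambda)
    fix i show "continuous_on (fst C) (\<lambda>x. snd (c i) (x $ i))"
      by (rule continuous_on_compose2[OF is_chartD(3)[OF ci[of i]]])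
        (auto intro!: continuous_intros simp: product_chart_domain[of c A, OF cA])
  qed
  then show ?thesis by (simp add: product_chart_def)
qed

lemma is_chart_C: "is_chart C"
  unfolding is_chart_def
proof (intro conjI open_domain open_image homeomorphismI continuous_chart)
  show "continuous_on (snd C ` fst C) (chart_inv C)"
  proof (rule continuous_on_eq)
    show "continuous_on (snd C ` fst C) (\<lambda>y. \<chi> i. chart_inv (c i) (y $ i))"
      by (rule continuous_on_subset[OF continuous_inv_box]) (use image_eq in blast)
  qed (simp add: inv_eq)
  show "snd C (chart_inv C y) = y" if "y \<in> snd C ` fst C" for y
    using that by (rule chart_inv_right)
  show "chart_inv C (snd C x) = x" if "x \<in> fst C" for x
    by (rule inv_into_f_f[OF inj that])
qed (auto intro!: inv_into_into)

end

lemma smooth_atlas_config_atlas: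
  fixes A :: "('m::t2_space, 'e::euclidean_space) chart set"
  assumes A: "smooth_atlas A"
  shows "smooth_atlas (config_atlas A :: ('m ^ 'k::finite, 'e ^ 'k) chart set)"
  unfolding smooth_atlas_def
proof (intro conjI ballI)
  fix C :: "('m ^ 'k, 'e ^ 'k) chart" assume "C \<in> config_atlas A"
  then obtain c where c: "C = product_chart A c" "\<And>i. c i \<in> A" by (auto simp: config_atlas_eq)
  interpret c: chart_family A c by standard (use A c in auto)
  show "is_chart C" using c.is_chart_C c by simp
  fix D :: "('m ^ 'k, 'e ^ 'k) chart" assume "D \<in> config_atlas A"
  then obtain d where d: "D = product_chart A d" "\<And>i. d i \<in> A" by (auto simp: config_atlas_eq)
  interpret d: chart_family A d by standard (use A d in auto)
  let ?S = "snd C ` (fst C \<inter> fst D)"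
  have o: "open ?S" using chart_image_open[OF \<open>is_chart C\<close>] d.open_domain d(1) by blast
  have "smooth_on ?S (\<lambda>y. \<chi> i. (snd (d i) \<circ> chart_inv (c i)) (y $ i))"
  proof (rule smooth_on_vec_lambda[OF o])
    fix i
    have "smooth_transition (c i) (d i)" using A c(2) d(2) by (simp add: smooth_atlas_def)
    then have "smooth_on (snd (c i) ` (fst (c i) \<inter> fst (d i))) (snd (d i) \<circ> chart_inv (c i))"
      by (simp add: smooth_transition_def)
    then show "smooth_on ?S (\<lambda>y. (snd (d i) \<circ> chart_inv (c i)) (y $ i))"
      by (rule smooth_on_compose[OF o chart_image_open[OF c.ci is_chartD(1)[OF d.ci]], rotated 1])
        (auto intro!: smooth_on_nth simp: c(1) d(1) product_chart_domain[of c A, OF c(2)] product_chart_domain[of d A, OF d(2)])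
  qed
  then show "smooth_transition C D" unfolding smooth_transition_def
  proof (rule smooth_on_cong[OF o, rotated])
    fix y assume "y \<in> ?S"
    then have "y \<in> snd C ` fst C" by blast
    then show "(\<chi> i. (snd (d i) \<circ> chart_inv (c i)) (y $ i)) = (snd D \<circ> chart_inv C) y"
      using c.inv_eq(1)[of y] by (simp add: c(1) d(1) vec_eq_iff)
  qed
qed

context chart_family
begin

lemma C_in_config_atlas: "C \<in> config_atlas A" using cA by (auto simp: config_atlas_eq)

text \<open>In the product chart, the i-th summand of \<open>nfold\<close> differentiates f along
  the slice in which only the i-th block of coordinates moves. By the chain rule this is the
  derivative of f in a direction \<open>axis i\<close>, and linearity puts the blocks
  together.\<close>

lemma has_rep_nfold:
  assumes X: "\<And>i. has_rep A (c i) X (\<xi> i)"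
  shows "has_rep (config_atlas A) C (nfold A X) (\<lambda>y. \<chi> i. \<xi> i (y $ i))"
  unfolding has_rep_def
proof (intro ballI ext)
  fix \<gamma> :: "'m ^ 'k" and f assume \<gamma>: "\<gamma> \<in> fst C"
  have Cm: "C \<in> maximal_atlas (config_atlas A)"
    by (intro maximal_atlasI smooth_atlas_config_atlas A C_in_config_atlas)
  show "nfold A X \<gamma> f = coord_tangent (config_atlas A) C \<gamma> (\<chi> i. \<xi> i (snd C \<gamma> $ i)) f"
  proof (cases "smooth_near (config_atlas A) \<gamma> f")
    case False then show ?thesis by (simp add: nfold_def coord_tangent_def)
  next
    case True
    let ?F = "\<lambda>y. f (chart_inv C y)" and ?y = "snd C \<gamma>"
    from smooth_near_ballE[OF smooth_atlas_config_atlas[OF A] Cm \<gamma> True] obtain r where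
      r: "r > 0" "ball ?y r \<subseteq> snd C ` fst C" "smooth_on (ball ?y r) ?F" .
    have lin: "linear (frechet_derivative ?F (at ?y))"
      by (rule linear_frechet_derivative[OF smooth_on_differentiable[OF r(3)]]) (use r in simp)
    have "X (\<gamma> $ i) (\<lambda>q. f (\<chi> j. if j = i then q else \<gamma> $ j)) = frechet_derivative ?F (at ?y) (axis i (\<xi> i (?y $ i)))" for i
    proof -
      let ?\<phi> = "\<lambda>q. f (\<chi> j. if j = i then q else \<gamma> $ j)"
      let ?u = "\<lambda>z. ?y + axis i (z - ?y $ i)"
      have \<gamma>i: "\<gamma> $ j \<in> fst (c j)" for j using \<gamma> by (simp add: product_chart_domain[of c A, OF cA])
      have lax: "linear (axis i :: 'e \<Rightarrow> 'e ^ 'k)" and bl: "bounded_linear (axis i :: 'e \<Rightarrow> 'e ^ 'k)"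
        by (rule linear_axis bounded_linear_axis)+
      have ub: "?u z \<in> ball ?y r" if "z \<in> ball (?y $ i) r" for z
        using that by (simp add: dist_norm norm_axis norm_minus_commute)
      have su: "smooth_on (ball (?y $ i) r) ?u"
      proof -
        have "smooth_on (ball (?y $ i) r) (\<lambda>z. (?y - axis i (?y $ i)) + axis i z)"
          by (intro smooth_on_add smooth_on_const smooth_on_bounded_linear[OF bl] open_ball)
        then show ?thesis by (simp add: linear_diff[OF lax] algebra_simps)
      qed
      have sm: "smooth_on (ball (?y $ i) r) (\<lambda>z. ?F (?u z))"
        by (rule smooth_on_compose[OF open_ball open_ball _ r(3) su]) (use ub in blast)
      have eq: "?\<phi> (chart_inv (c i) z) = ?F (?u z)" if z: "z \<in> ball (?y $ i) r" for z
      proof -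
        have "chart_inv C (?u z) = (\<chi> j. chart_inv (c j) (?u z $ j))"
          using inv_eq(1)[OF subsetD[OF r(2) ub[OF z]]] .
        also have "\<dots> = (\<chi> j. if j = i then chart_inv (c i) z else \<gamma> $ j)"
          using \<gamma>i by (auto simp: vec_eq_iff axis_def chart_inv_left[OF ci])
        finally show ?thesis by simp
      qed
      have near: "smooth_near A (\<gamma> $ i) ?\<phi>"
        by (rule smooth_nearI[OF A cm \<gamma>i open_ball _ sm]) (use r(1) eq in auto)
      have "X (\<gamma> $ i) ?\<phi> = frechet_derivative (\<lambda>z. ?\<phi> (chart_inv (c i) z)) (at (?y $ i)) (\<xi> i (?y $ i))"
      proof -
        have "X (\<gamma> $ i) = coord_tangent A (c i) (\<gamma> $ i) (\<xi> i (?y $ i))"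
          using X[of i] \<gamma>i[of i] by (simp add: has_rep_def)
        then show ?thesis using near by (simp add: coord_tangent_def)
      qed
      also have "frechet_derivative (\<lambda>z. ?\<phi> (chart_inv (c i) z)) (at (?y $ i)) = frechet_derivative (\<lambda>z. ?F (?u z)) (at (?y $ i))"
        by (rule frechet_derivative_transform_open[OF open_ball _ eq]) (use r in auto)
      also have "\<dots> = (\<lambda>v. frechet_derivative ?F (at ?y) (axis i v))"
      proof (rule frechet_derivative_eqI)
        have uu: "?u (?y $ i) = ?y" using linear_0[OF lax] by simp
        have "((\<lambda>z. axis i (z - ?y $ i)) has_derivative axis i) (at (?y $ i))"
          by (rule bounded_linear.has_derivative[OF bl, of "\<lambda>z. z - ?y $ i" "\<lambda>v. v"]) (auto intro!: derivative_eq_intros)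
        then have du: "(?u has_derivative axis i) (at (?y $ i))"
          using has_derivative_add[OF has_derivative_const] by fastforce
        have "(?F has_derivative frechet_derivative ?F (at ?y)) (at (?u (?y $ i)))"
          unfolding uu by (rule smooth_on_has_derivative[OF r(3)]) (use r in simp)
        from diff_chain_at[OF du this]
        show "((\<lambda>z. ?F (?u z)) has_derivative (\<lambda>v. frechet_derivative ?F (at ?y) (axis i v))) (at (?y $ i))"
          by (simp add: o_def)
      qed
      finally show ?thesis .
    qed
    then have "nfold A X \<gamma> f = (\<Sum>i\<in>UNIV. frechet_derivative ?F (at ?y) (axis i (\<xi> i (?y $ i))))"
      using True by (simp only: nfold_def if_True)
    also have "\<dots> = frechet_derivative ?F (at ?y) (\<Sum>i\<in>UNIV. axis i (\<xi> i (?y $ i)))"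
      by (simp only: linear_sum[OF lin])
    also have "(\<Sum>i\<in>UNIV. axis i (\<xi> i (?y $ i))) = (\<chi> i. \<xi> i (?y $ i))"
      by (rule sum_axis)
    finally show ?thesis using True by (simp add: coord_tangent_def)
  qed
qed

end

lemma frechet_derivative_product_field:
  fixes \<xi> :: "'k::finite \<Rightarrow> 'e::euclidean_space \<Rightarrow> 'e"
  assumes "\<And>i. \<xi> i differentiable (at (y $ i))"
  shows "frechet_derivative (\<lambda>y. \<chi> i. \<xi> i (y $ i)) (at y) = (\<lambda>v. \<chi> i. frechet_derivative (\<xi> i) (at (y $ i)) (v $ i))"
proof (rule frechet_derivative_eqI, rule has_derivative_vec_lambda)
  fix i
  have "((\<lambda>y. y $ i) has_derivative (\<lambda>v. v $ i)) (at y)"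
    by (rule bounded_linear_imp_has_derivative) (rule bounded_linear_vec_nth)
  from diff_chain_at[OF this] assms[of i]
  show "((\<lambda>y. \<xi> i (y $ i)) has_derivative (\<lambda>v. frechet_derivative (\<xi> i) (at (y $ i)) (v $ i))) (at y)"
    by (simp add: frechet_derivative_works o_def)
qed

text \<open>The coordinate form of [X^N, Y^N] = [X, Y]^N. The derivative of a product field is block
  diagonal.\<close>

lemma coord_bracket_product_field:
  fixes \<xi> \<eta> :: "'k::finite \<Rightarrow> 'e::euclidean_space \<Rightarrow> 'e"
  assumes "\<And>i. \<xi> i differentiable (at (y $ i))" "\<And>i. \<eta> i differentiable (at (y $ i))"
  shows "coord_bracket (\<lambda>y. \<chi> i. \<xi> i (y $ i)) (\<lambda>y. \<chi> i. \<eta> i (y $ i)) y = (\<chi> i. coord_bracket (\<xi> i) (\<eta> i) (y $ i))"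
  using frechet_derivative_product_field[of \<xi> y] frechet_derivative_product_field[of \<eta> y] assms
  by (simp add: coord_bracket_def vec_eq_iff)

subsection \<open>Iterated brackets in coordinates\<close>

primrec ad_iter :: "('a::real_normed_vector \<Rightarrow> 'a) \<Rightarrow> ('a \<Rightarrow> 'a) \<Rightarrow> nat \<Rightarrow> 'a \<Rightarrow> 'a" where
  "ad_iter \<xi> \<eta> 0 = \<eta>"
| "ad_iter \<xi> \<eta> (Suc k) = coord_bracket \<xi> (ad_iter \<xi> \<eta> k)"

lemma smooth_on_ad_iter:
  fixes \<xi> :: "'a::euclidean_space \<Rightarrow> 'a"
  shows "open S \<Longrightarrow> smooth_on S \<xi> \<Longrightarrow> smooth_on S \<eta> \<Longrightarrow> smooth_on S (ad_iter \<xi> \<eta> k)"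
  by (induction k) (auto intro: smooth_on_coord_bracket)

lemma ad_iter_cong:
  assumes "open S" "\<And>z. z \<in> S \<Longrightarrow> \<xi> z = \<xi>' z" "\<And>z. z \<in> S \<Longrightarrow> \<eta> z = \<eta>' z" "y \<in> S"
  shows "ad_iter \<xi> \<eta> k y = ad_iter \<xi>' \<eta>' k y"
  using assms(4) by (induction k arbitrary: y) (auto simp: assms(3) intro!: coord_bracket_cong[OF assms(1) _ assms(2)])

lemma ad_iter_product_field:
  fixes \<xi> \<eta> :: "'k::finite \<Rightarrow> 'e::euclidean_space \<Rightarrow> 'e"
  assumes S: "\<And>i. open (S i)" and \<xi>: "\<And>i. smooth_on (S i) (\<xi> i)" and \<eta>: "\<And>i. smooth_on (S i) (\<eta> i)"
    and y: "\<And>i. y $ i \<in> S i"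
  shows "ad_iter (\<lambda>y. \<chi> i. \<xi> i (y $ i)) (\<lambda>y. \<chi> i. \<eta> i (y $ i)) k y = (\<chi> i. ad_iter (\<xi> i) (\<eta> i) k (y $ i))"
  using y
proof (induction k arbitrary: y)
  case (Suc k)
  let ?T = "{y :: 'e ^ 'k. \<forall>i. y $ i \<in> S i}"
  have o: "open ?T" by (rule open_vector_box) (use S in blast)
  have "ad_iter (\<lambda>y. \<chi> i. \<xi> i (y $ i)) (\<lambda>y. \<chi> i. \<eta> i (y $ i)) (Suc k) y
     = coord_bracket (\<lambda>y. \<chi> i. \<xi> i (y $ i)) (\<lambda>y. \<chi> i. ad_iter (\<xi> i) (\<eta> i) k (y $ i)) y"
    unfolding ad_iter.simps by (rule coord_bracket_cong[OF o]) (use Suc in auto)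
  also have "\<dots> = (\<chi> i. coord_bracket (\<xi> i) (ad_iter (\<xi> i) (\<eta> i) k) (y $ i))"
    by (rule coord_bracket_product_field)
      (use smooth_on_differentiable[OF \<xi> Suc.prems] smooth_on_differentiable[OF smooth_on_ad_iter[OF S \<xi> \<eta>] Suc.prems] in auto)
  finally show ?case by simp
qed simp

text \<open>Brackets with a sum \<xi> + a \<eta> of generators are not iterated brackets but linear
  combinations of them. The combinations are formed among coordinate fields, where closure under
  bracketing is a matter of bilinearity; values outside the chart image are left free.\<close>

inductive bracket_span ::
  "('m::topological_space, 'e::euclidean_space) chart set \<Rightarrow> ('m, 'e) chart \<Rightarrow> ('m \<Rightarrow> 'm tangent) set \<Rightarrow> ('e \<Rightarrow> 'e) \<Rightarrow> bool"
  for A c F where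
  base: "X \<in> iterated_brackets A F \<Longrightarrow> has_rep A c X \<xi> \<Longrightarrow> smooth_on (snd c ` fst c) \<xi> \<Longrightarrow> bracket_span A c F \<xi>"
| comb: "bracket_span A c F \<xi> \<Longrightarrow> bracket_span A c F \<eta> \<Longrightarrow> (\<And>y. y \<in> snd c ` fst c \<Longrightarrow> \<zeta> y = \<xi> y + a *\<^sub>R \<eta> y)
    \<Longrightarrow> bracket_span A c F \<zeta>"

lemma smooth_on_bracket_span:
  assumes c: "is_chart c" shows "bracket_span A c F \<xi> \<Longrightarrow> smooth_on (snd c ` fst c) \<xi>"
proof (induction rule: bracket_span.induct)
  case (comb \<xi> \<eta> \<zeta> a)
  have "smooth_on (snd c ` fst c) (\<lambda>y. \<xi> y + a *\<^sub>R \<eta> y)"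
    by (intro smooth_on_add smooth_on_scaleR is_chartD(2)[OF c] comb.IH smooth_on_const)
  then show ?case by (rule smooth_on_cong[OF is_chartD(2)[OF c], rotated]) (simp add: comb)
qed

lemma frechet_derivative_add_scaled:
  assumes "\<xi> differentiable (at y)" "\<eta> differentiable (at y)"
  shows "frechet_derivative (\<lambda>y. \<xi> y + a *\<^sub>R \<eta> y) (at y)
      = (\<lambda>v. frechet_derivative \<xi> (at y) v + a *\<^sub>R frechet_derivative \<eta> (at y) v)"
  using assms by (intro frechet_derivative_eqI has_derivative_add has_derivative_scaleR_right)
    (simp_all add: frechet_derivative_works[symmetric])

lemma coord_bracket_add_right:
  assumes "\<xi> differentiable (at y)" "\<eta> differentiable (at y)" "\<eta>' differentiable (at y)"
  shows "coord_bracket \<xi> (\<lambda>y. \<eta> y + a *\<^sub>R \<eta>' y) y = coord_bracket \<xi> \<eta> y + a *\<^sub>R coord_bracket \<xi> \<eta>' y"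
  using linear_frechet_derivative[OF assms(1)] assms
  by (simp add: coord_bracket_def frechet_derivative_add_scaled linear_add linear_cmul algebra_simps)

lemma coord_bracket_add_left:
  assumes "\<xi> differentiable (at y)" "\<xi>' differentiable (at y)" "\<eta> differentiable (at y)"
  shows "coord_bracket (\<lambda>y. \<xi> y + a *\<^sub>R \<xi>' y) \<eta> y = coord_bracket \<xi> \<eta> y + a *\<^sub>R coord_bracket \<xi>' \<eta> y"
  using linear_frechet_derivative[OF assms(3)] assms
  by (simp add: coord_bracket_def frechet_derivative_add_scaled linear_add linear_cmul algebra_simps)

lemma bracket_span_coord_bracket:
  assumes A: "smooth_atlas A" and c: "c \<in> maximal_atlas A" and X: "X \<in> iterated_brackets A F"
    and \<xi>: "has_rep A c X \<xi>" "smooth_on (snd c ` fst c) \<xi>"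
  shows "bracket_span A c F \<eta> \<Longrightarrow> bracket_span A c F (coord_bracket \<xi> \<eta>)"
proof (induction rule: bracket_span.induct)
  case (base Y \<eta>)
  show ?case
    by (rule bracket_span.base[OF iterated_brackets.bracket[OF X base(1)]
      has_rep_lie_bracket[OF A c \<xi>(1) base(2) \<xi>(2) base(3)]])
      (intro smooth_on_coord_bracket is_chartD(2) maximal_atlasD(1)[OF c] \<xi> base)
next
  case (comb \<eta> \<eta>' \<zeta> a)
  note cc = maximal_atlasD(1)[OF c]
  show ?case
  proof (rule bracket_span.comb[OF comb.IH])
    fix y assume y: "y \<in> snd c ` fst c"
    have "coord_bracket \<xi> \<zeta> y = coord_bracket \<xi> (\<lambda>y. \<eta> y + a *\<^sub>R \<eta>' y) y"
      by (rule coord_bracket_cong[OF is_chartD(2)[OF cc] y]) (simp_all add: comb)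
    also have "\<dots> = coord_bracket \<xi> \<eta> y + a *\<^sub>R coord_bracket \<xi> \<eta>' y"
      by (rule coord_bracket_add_right)
        (intro smooth_on_differentiable[OF _ y] \<xi> smooth_on_bracket_span[OF cc comb.hyps(1)]
          smooth_on_bracket_span[OF cc comb.hyps(2)])+
    finally show "coord_bracket \<xi> \<zeta> y = coord_bracket \<xi> \<eta> y + a *\<^sub>R coord_bracket \<xi> \<eta>' y" .
  qed
qed

text \<open>The operator ad is linear in its first argument, so each step is a combination of
  brackets with the two generators, to which \<open>bracket_span_coord_bracket\<close>
  applies.\<close>

lemma bracket_span_ad_iter:
  assumes A: "smooth_atlas A" and c: "c \<in> maximal_atlas A" and X: "X \<in> F" "Y \<in> F"
    and \<xi>: "has_rep A c X \<xi>" "smooth_on (snd c ` fst c) \<xi>"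
    and \<eta>: "has_rep A c Y \<eta>" "smooth_on (snd c ` fst c) \<eta>"
  shows "bracket_span A c F (ad_iter (\<lambda>y. \<xi> y + a *\<^sub>R \<eta> y) \<eta> k)"
proof (induction k)
  case 0 show ?case using X \<eta> by (auto intro: bracket_span.base iterated_brackets.base)
next
  case (Suc k)
  let ?\<zeta> = "ad_iter (\<lambda>y. \<xi> y + a *\<^sub>R \<eta> y) \<eta> k"
  have b: "bracket_span A c F (coord_bracket \<xi> ?\<zeta>)" "bracket_span A c F (coord_bracket \<eta> ?\<zeta>)"
    by (rule bracket_span_coord_bracket[OF A c iterated_brackets.base[OF X(1)] \<xi> Suc])
       (rule bracket_span_coord_bracket[OF A c iterated_brackets.base[OF X(2)] \<eta> Suc])
  show ?case
  proof (rule bracket_span.comb[OF b])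
    fix y assume y: "y \<in> snd c ` fst c"
    show "ad_iter (\<lambda>y. \<xi> y + a *\<^sub>R \<eta> y) \<eta> (Suc k) y = coord_bracket \<xi> ?\<zeta> y + a *\<^sub>R coord_bracket \<eta> ?\<zeta> y"
      unfolding ad_iter.simps
      by (rule coord_bracket_add_left)
        (intro smooth_on_differentiable[OF _ y] \<xi> \<eta> smooth_on_bracket_span[OF maximal_atlasD(1)[OF c] Suc])+
  qed
qed

text \<open>\<open>chart_rep\<close> is defined for every X but reads only its values on coordinate
  functions. The condition selects the brackets which that vector really determines, so that linear
  relations between vectors carry over to derivations.\<close>

definition represented_brackets ::
  "('m::topological_space, 'e::euclidean_space) chart set \<Rightarrow> ('m, 'e) chart \<Rightarrow> ('m \<Rightarrow> 'm tangent) set \<Rightarrow> ('m \<Rightarrow> 'm tangent) set" where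
  "represented_brackets A c F = {X \<in> iterated_brackets A F. has_rep A c X (chart_rep c X)}"

lemma bracket_span_value:
  assumes A: "smooth_atlas A" and c: "c \<in> maximal_atlas A" and y: "y \<in> snd c ` fst c"
  shows "bracket_span A c F \<xi> \<Longrightarrow> \<xi> y \<in> span ((\<lambda>X. chart_rep c X y) ` represented_brackets A c F)"
proof (induction rule: bracket_span.induct)
  case (base X \<xi>)
  have "has_rep A c X (chart_rep c X)"
    using base(2) chart_rep_unique[OF A c base(2)] by (simp add: has_rep_def)
  then have "X \<in> represented_brackets A c F" using base by (simp add: represented_brackets_def)
  then have "chart_rep c X y \<in> span ((\<lambda>X. chart_rep c X y) ` represented_brackets A c F)"
    by (intro span_base imageI)
  then show ?case using chart_rep_unique[OF A c base(2) y] by simp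
next
  case (comb \<xi> \<eta> \<zeta> a)
  then show ?case using y by (simp add: span_add span_scale)
qed

lemma bracket_generating_atI:
  assumes A: "smooth_atlas A" and c: "c \<in> maximal_atlas A" and p: "p \<in> fst c"
    and sp: "span ((\<lambda>X. chart_rep c X (snd c p)) ` represented_brackets A c F) = UNIV"
  shows "bracket_generating_at A F p"
  unfolding bracket_generating_at_def
proof
  let ?y = "snd c p" and ?R = "represented_brackets A c F"
  fix v assume v: "v \<in> tangent_space A p"
  define w where "w = (\<Sum>b\<in>Basis. v (\<lambda>x. snd c x \<bullet> b) *\<^sub>R b)"
  have vw: "v = coord_tangent A c p w" unfolding w_def by (rule tangent_space_in_coordinates[OF A c p v])
  have "w \<in> span ((\<lambda>X. chart_rep c X ?y) ` ?R)" using sp by simp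
  then obtain T r where T: "finite T" "T \<subseteq> (\<lambda>X. chart_rep c X ?y) ` ?R" "w = (\<Sum>u\<in>T. r u *\<^sub>R u)"
    unfolding span_explicit by blast
  from T(2) have "\<forall>u\<in>T. \<exists>X. X \<in> ?R \<and> chart_rep c X ?y = u" by blast
  \<comment> \<open>One bracket is chosen for each vector of the combination. Since
    \<open>chart_rep\<close> inverts the choice, distinct vectors receive distinct brackets, and the
    sum over vectors can be reindexed as a sum over brackets.\<close>
  then obtain \<sigma> where \<sigma>: "\<forall>u\<in>T. \<sigma> u \<in> ?R \<and> chart_rep c (\<sigma> u) ?y = u"
    using bchoice[of T "\<lambda>u X. X \<in> ?R \<and> chart_rep c X ?y = u"] by blast
  have inj: "inj_on \<sigma> T" using \<sigma> by (metis inj_onI)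
  have app: "\<sigma> u p f = coord_tangent A c p u f" if "u \<in> T" for u f
    using \<sigma> that p by (auto simp: represented_brackets_def has_rep_def)
  have "v f = (\<Sum>X\<in>\<sigma> ` T. r (chart_rep c X ?y) * X p f)" for f
  proof -
    have "(\<Sum>X\<in>\<sigma> ` T. r (chart_rep c X ?y) * X p f) = (\<Sum>u\<in>T. r u * coord_tangent A c p u f)"
      using \<sigma> app by (simp add: sum.reindex[OF inj])
    also have "\<dots> = coord_tangent A c p w f"
      using linear_frechet_derivative[OF smooth_near_differentiable[OF A c p], of f]
      by (simp add: coord_tangent_def T(3) linear_sum linear_cmul)
    finally show ?thesis by (simp add: vw)
  qed
  moreover have "\<sigma> ` T \<subseteq> iterated_brackets A F" using \<sigma> by (auto simp: represented_brackets_def)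
  ultimately show "\<exists>S a. finite S \<and> S \<subseteq> iterated_brackets A F \<and> v = (\<lambda>f. \<Sum>X\<in>S. a X * X p f)"
    using T(1) by (intro exI[of _ "\<sigma> ` T"] exI[of _ "\<lambda>X. r (chart_rep c X ?y)"]) auto
qed

subsection \<open>Uniform bounds on derivatives\<close>

text \<open>These are the derivatives measured by \<open>whitney_nbhd\<close>, here with a
  non-strict bound.\<close>

definition jet_le :: "nat \<Rightarrow> 'a::euclidean_space set \<Rightarrow> ('a \<Rightarrow> 'b::real_normed_vector) \<Rightarrow> real \<Rightarrow> bool" where
  "jet_le p K f r \<longleftrightarrow> (\<forall>vs. set vs \<subseteq> Basis \<and> length vs \<le> p \<longrightarrow> (\<forall>y\<in>K. norm (iter_deriv vs f y) \<le> r))"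

lemma jet_le_Suc:
  "jet_le (Suc p) K f r \<longleftrightarrow> (\<forall>y\<in>K. norm (f y) \<le> r) \<and> (\<forall>b\<in>Basis. jet_le p K (\<lambda>y. frechet_derivative f (at y) b) r)"
proof
  assume L: "jet_le (Suc p) K f r"
  show "(\<forall>y\<in>K. norm (f y) \<le> r) \<and> (\<forall>b\<in>Basis. jet_le p K (\<lambda>y. frechet_derivative f (at y) b) r)"
  proof
    show "\<forall>y\<in>K. norm (f y) \<le> r" using L[unfolded jet_le_def, rule_format, of "[]"] by simp
    show "\<forall>b\<in>Basis. jet_le p K (\<lambda>y. frechet_derivative f (at y) b) r" unfolding jet_le_def
    proof safe
      fix b :: 'a and vs :: "'a list" and y assume "b \<in> Basis" "set vs \<subseteq> Basis" "length vs \<le> p" "y \<in> K"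
      then show "norm (iter_deriv vs (\<lambda>y. frechet_derivative f (at y) b) y) \<le> r"
        using L[unfolded jet_le_def, rule_format, of "vs @ [b]" y] by (simp add: iter_deriv_snoc)
    qed
  qed
next
  assume R: "(\<forall>y\<in>K. norm (f y) \<le> r) \<and> (\<forall>b\<in>Basis. jet_le p K (\<lambda>y. frechet_derivative f (at y) b) r)"
  show "jet_le (Suc p) K f r" unfolding jet_le_def
  proof safe
    fix vs :: "'a list" and y assume *: "set vs \<subseteq> Basis" "length vs \<le> Suc p" "y \<in> K"
    show "norm (iter_deriv vs f y) \<le> r"
    proof (cases vs rule: rev_cases)
      case (snoc ws v)
      then show ?thesis using * R by (auto simp: iter_deriv_snoc jet_le_def)
    qed (use * R in auto)
  qed
qed

lemma jet_le_0: "jet_le 0 K f r \<longleftrightarrow> (\<forall>y\<in>K. norm (f y) \<le> r)"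
  by (simp add: jet_le_def)

lemma jet_le_mono: "jet_le p K f r \<Longrightarrow> q \<le> p \<Longrightarrow> r \<le> s \<Longrightarrow> jet_le q K f s"
  unfolding jet_le_def by (meson order_trans)

lemma jet_le_cong:
  assumes "open S" "K \<subseteq> S" "\<And>y. y \<in> S \<Longrightarrow> f y = g y" "jet_le p K f r"
  shows "jet_le p K g r"
  unfolding jet_le_def
proof (intro allI impI ballI)
  fix vs :: "'a list" and y assume *: "set vs \<subseteq> Basis \<and> length vs \<le> p" "y \<in> K"
  have "iter_deriv vs f y = iter_deriv vs g y"
    by (rule iter_deriv_cong_open[OF assms(1,3)]) (use * assms(2) in auto)
  then show "norm (iter_deriv vs g y) \<le> r" using assms(4) * by (metis jet_le_def)
qed

lemma jet_le_add:
  assumes S: "open S" "K \<subseteq> S"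
  shows "smooth_on S f \<Longrightarrow> smooth_on S g \<Longrightarrow> jet_le p K f r \<Longrightarrow> jet_le p K g s \<Longrightarrow> jet_le p K (\<lambda>y. f y + g y) (r + s)"
proof (induction p arbitrary: f g)
  case 0 then show ?case by (auto simp: jet_le_0 intro!: norm_triangle_mono)
next
  case (Suc p)
  note j = Suc.prems(3,4)[unfolded jet_le_Suc]
  show ?case unfolding jet_le_Suc
  proof (intro conjI ballI)
    fix b :: 'a assume b: "b \<in> Basis"
    have "jet_le p K (\<lambda>y. frechet_derivative f (at y) b + frechet_derivative g (at y) b) (r + s)"
      using j b by (intro Suc.IH smooth_on_deriv Suc.prems) auto
    then show "jet_le p K (\<lambda>y. frechet_derivative (\<lambda>y. f y + g y) (at y) b) (r + s)"
      by (rule jet_le_cong[OF S, rotated])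
        (simp add: frechet_derivative_add smooth_on_differentiable[OF Suc.prems(1)] smooth_on_differentiable[OF Suc.prems(2)])
  qed (use j in \<open>auto intro!: norm_triangle_mono\<close>)
qed

text \<open>By the product rule each derivative turns one product into two, which doubles the bound
  at every order.\<close>

lemma jet_le_scaleR:
  fixes f :: "'a::euclidean_space \<Rightarrow> real" and g :: "'a \<Rightarrow> 'b::real_normed_vector"
  assumes S: "open S" "K \<subseteq> S" and r: "0 \<le> r" "0 \<le> s"
  shows "smooth_on S f \<Longrightarrow> smooth_on S g \<Longrightarrow> jet_le p K f r \<Longrightarrow> jet_le p K g s
    \<Longrightarrow> jet_le p K (\<lambda>y. f y *\<^sub>R g y) (2 ^ p * (r * s))"
proof (induction p arbitrary: f g)
  case 0 then show ?case using r by (auto simp: jet_le_0 intro!: mult_mono)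
next
  case (Suc p)
  note j = Suc.prems(3,4)[unfolded jet_le_Suc]
  have jp: "jet_le p K f r" "jet_le p K g s" using Suc.prems(3,4) by (auto intro: jet_le_mono)
  show ?case unfolding jet_le_Suc
  proof (intro conjI ballI)
    fix y assume "y \<in> K"
    then have "norm (f y *\<^sub>R g y) \<le> 1 * (r * s)" using j r by (auto intro!: mult_mono)
    also have "\<dots> \<le> 2 ^ Suc p * (r * s)" using r by (intro mult_right_mono) (simp_all add: one_le_power del: power_Suc)
    finally show "norm (f y *\<^sub>R g y) \<le> 2 ^ Suc p * (r * s)" .
  next
    fix b :: 'a assume b: "b \<in> Basis"
    have "jet_le p K (\<lambda>y. f y *\<^sub>R frechet_derivative g (at y) b + frechet_derivative f (at y) b *\<^sub>R g y)
      (2 ^ p * (r * s) + 2 ^ p * (r * s))"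
      using j b jp by (intro jet_le_add[OF S] smooth_on_scaleR Suc.IH smooth_on_deriv Suc.prems S) auto
    then show "jet_le p K (\<lambda>y. frechet_derivative (\<lambda>y. f y *\<^sub>R g y) (at y) b) (2 ^ Suc p * (r * s))"
    proof (simp only: power_Suc mult_2 distrib_right, rule_tac jet_le_cong[OF S, rotated])
      fix y assume "y \<in> S"
      then have "((\<lambda>y. f y *\<^sub>R g y) has_derivative
          (\<lambda>v. f y *\<^sub>R frechet_derivative g (at y) v + frechet_derivative f (at y) v *\<^sub>R g y)) (at y)"
        by (intro has_derivative_scaleR smooth_on_has_derivative[OF Suc.prems(1)] smooth_on_has_derivative[OF Suc.prems(2)])
      from frechet_derivative_eqI[OF this]
      show "f y *\<^sub>R frechet_derivative g (at y) b + frechet_derivative f (at y) b *\<^sub>R g y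
        = frechet_derivative (\<lambda>y. f y *\<^sub>R g y) (at y) b" by simp
    qed
  qed
qed

lemma jet_le_inner_Basis:
  fixes f :: "'a::euclidean_space \<Rightarrow> 'b::euclidean_space"
  assumes S: "open S" "K \<subseteq> S" and e: "e \<in> Basis"
  shows "smooth_on S f \<Longrightarrow> jet_le p K f r \<Longrightarrow> jet_le p K (\<lambda>y. f y \<bullet> e) r"
proof (induction p arbitrary: f)
  case 0 then show ?case using e Basis_le_norm order_trans unfolding jet_le_0 real_norm_def by blast
next
  case (Suc p)
  show ?case unfolding jet_le_Suc
  proof (intro conjI ballI)
    fix y assume "y \<in> K"
    then show "norm (f y \<bullet> e) \<le> r"
      using Suc.prems(2)[unfolded jet_le_Suc] Basis_le_norm[OF e, of "f y"] by force
  next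
    fix b :: 'a assume b: "b \<in> Basis"
    have "jet_le p K (\<lambda>y. frechet_derivative f (at y) b \<bullet> e) r"
      using Suc.prems(2)[unfolded jet_le_Suc] b by (intro Suc.IH smooth_on_deriv Suc.prems) auto
    then show "jet_le p K (\<lambda>y. frechet_derivative (\<lambda>y. f y \<bullet> e) (at y) b) r"
    proof (rule jet_le_cong[OF S, rotated])
      fix y assume "y \<in> S"
      from frechet_derivative_eqI[OF has_derivative_inner_left[OF smooth_on_has_derivative[OF Suc.prems(1) this]]]
      show "frechet_derivative f (at y) b \<bullet> e = frechet_derivative (\<lambda>y. f y \<bullet> e) (at y) b" by simp
    qed
  qed
qed

lemma jet_le_sum:
  fixes f :: "'i \<Rightarrow> 'a::euclidean_space \<Rightarrow> 'b::real_normed_vector"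
  assumes S: "open S" "K \<subseteq> S" and "finite I"
  shows "(\<And>i. i \<in> I \<Longrightarrow> smooth_on S (f i)) \<Longrightarrow> (\<And>i. i \<in> I \<Longrightarrow> jet_le p K (f i) r) \<Longrightarrow>
    jet_le p K (\<lambda>y. \<Sum>i\<in>I. f i y) (real (card I) * r)"
  using assms(3)
proof (induction I rule: finite_induct)
  case empty
  have "iter_deriv vs (\<lambda>y. 0 :: 'b) = (\<lambda>y. 0)" for vs :: "'a list" by (induction vs) auto
  then show ?case by (simp add: jet_le_def)
next
  case (insert i I)
  have "jet_le p K (\<lambda>y. f i y + (\<Sum>i\<in>I. f i y)) (r + real (card I) * r)"
    using insert by (intro jet_le_add[OF S] smooth_on_sum S) auto
  then show ?case using insert by (simp add: algebra_simps)
qed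

lemma jet_le_deriv_field:
  fixes \<xi> \<eta> :: "'a::euclidean_space \<Rightarrow> 'a"
  assumes S: "open S" "K \<subseteq> S" and sm: "smooth_on S \<xi>" "smooth_on S \<eta>"
    and j: "jet_le p K \<xi> r" "jet_le (Suc p) K \<eta> s" and r: "0 \<le> r" "0 \<le> s"
  shows "jet_le p K (\<lambda>y. frechet_derivative \<eta> (at y) (\<xi> y)) (real DIM('a) * (2 ^ p * (r * s)))"
proof -
  have "jet_le p K (\<lambda>y. \<Sum>b\<in>Basis. (\<xi> y \<bullet> b) *\<^sub>R frechet_derivative \<eta> (at y) b) (real DIM('a) * (2 ^ p * (r * s)))"
    using j(2)[unfolded jet_le_Suc]
    by (intro jet_le_sum[OF S] smooth_on_scaleR jet_le_scaleR[OF S r] jet_le_inner_Basis[OF S] smooth_on_inner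
        smooth_on_deriv sm S smooth_on_const j finite_Basis) auto
  then show ?thesis
  proof (rule jet_le_cong[OF S, rotated])
    fix y assume "y \<in> S"
    from frechet_derivative_Basis_sum[OF smooth_on_differentiable[OF sm(2) this], of "\<xi> y"]
    show "(\<Sum>b\<in>Basis. (\<xi> y \<bullet> b) *\<^sub>R frechet_derivative \<eta> (at y) b) = frechet_derivative \<eta> (at y) (\<xi> y)" by (rule sym)
  qed
qed

lemma jet_le_minus: "jet_le p K f r \<Longrightarrow> open S \<Longrightarrow> K \<subseteq> S \<Longrightarrow> smooth_on S f \<Longrightarrow> jet_le p K (\<lambda>y. - f y) r"
proof -
  assume j: "jet_le p K f r" and S: "open S" "K \<subseteq> S" "smooth_on S f"
  have "iter_deriv vs (\<lambda>y. - f y) y = - iter_deriv vs f y" if "y \<in> S" for vs y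
    using that
  proof (induction vs arbitrary: y)
    case (Cons v vs)
    have "frechet_derivative (iter_deriv vs (\<lambda>y. - f y)) (at y) = frechet_derivative (\<lambda>y. - iter_deriv vs f y) (at y)"
      by (rule frechet_derivative_transform_open[OF S(1) Cons.prems Cons.IH])
    also have "\<dots> = (\<lambda>v. - frechet_derivative (iter_deriv vs f) (at y) v)"
      by (intro frechet_derivative_eqI has_derivative_minus smooth_on_has_derivative[OF smooth_on_iter_deriv[OF S(3)] Cons.prems])
    finally show ?case by simp
  qed simp
  then show ?thesis using j S(2) by (auto simp: jet_le_def subset_iff)
qed

lemma jet_le_coord_bracket:
  fixes \<xi> \<eta> :: "'a::euclidean_space \<Rightarrow> 'a"
  assumes S: "open S" "K \<subseteq> S" and sm: "smooth_on S \<xi>" "smooth_on S \<eta>"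
    and j: "jet_le (Suc p) K \<xi> r" "jet_le (Suc p) K \<eta> s" and r: "0 \<le> r" "0 \<le> s"
  shows "jet_le p K (coord_bracket \<xi> \<eta>) (2 * real DIM('a) * 2 ^ p * (r * s))"
proof -
  have j': "jet_le p K \<xi> r" "jet_le p K \<eta> s" using j by (auto intro: jet_le_mono)
  have "jet_le p K (\<lambda>y. frechet_derivative \<eta> (at y) (\<xi> y) + - frechet_derivative \<xi> (at y) (\<eta> y))
    (real DIM('a) * (2 ^ p * (r * s)) + real DIM('a) * (2 ^ p * (s * r)))"
    by (intro jet_le_add[OF S] smooth_on_minus smooth_on_deriv_field S sm
        jet_le_minus[OF _ S] jet_le_deriv_field[OF S] j j' r)
  then show ?thesis by (simp add: coord_bracket_def[abs_def] algebra_simps)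
qed

lemma finite_Basis_lists: "finite {vs :: 'a::euclidean_space list. set vs \<subseteq> Basis \<and> length vs \<le> p}"
  by (rule finite_lists_length_le) simp

lemma jet_le_exists:
  fixes f :: "'a::euclidean_space \<Rightarrow> 'b::real_normed_vector"
  assumes "compact K" "K \<subseteq> S" "smooth_on S f"
  obtains r where "r > 0" "jet_le p K f r"
proof -
  have "\<exists>r. \<forall>y\<in>K. norm (iter_deriv vs f y) \<le> r" for vs
  proof -
    have "continuous_on K (iter_deriv vs f)"
      by (rule continuous_on_subset[OF smooth_on_continuous_on[OF smooth_on_iter_deriv[OF assms(3)]] assms(2)])
    then have "bounded (iter_deriv vs f ` K)" using assms(1) by (intro compact_imp_bounded compact_continuous_image)
    then show ?thesis by (auto simp: bounded_iff)
  qed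
  then obtain R where R: "\<And>vs y. y \<in> K \<Longrightarrow> norm (iter_deriv vs f y) \<le> R vs" by metis
  let ?L = "{vs :: 'a list. set vs \<subseteq> Basis \<and> length vs \<le> p}"
  let ?r = "Max (insert 1 (R ` ?L))"
  have fin: "finite (insert 1 (R ` ?L))" using finite_Basis_lists by blast
  have "jet_le p K f ?r" unfolding jet_le_def
  proof (intro allI impI ballI)
    fix vs y assume "set vs \<subseteq> (Basis :: 'a set) \<and> length vs \<le> p" "y \<in> K"
    then show "norm (iter_deriv vs f y) \<le> ?r"
      using R[of y vs] Max_ge[OF fin, of "R vs"] by fastforce
  qed
  moreover have "?r > 0" using Max_ge[OF fin, of 1] by simp
  ultimately show ?thesis using that by blast
qed

lemma coord_bracket_diff:
  assumes "\<xi> differentiable (at y)" "\<xi>' differentiable (at y)" "\<eta> differentiable (at y)" "\<eta>' differentiable (at y)"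
  shows "coord_bracket \<xi>' \<eta>' y - coord_bracket \<xi> \<eta> y
    = coord_bracket (\<lambda>y. \<xi>' y - \<xi> y) \<eta>' y + coord_bracket \<xi> (\<lambda>y. \<eta>' y - \<eta> y) y"
  using coord_bracket_add_left[of \<xi>' y \<xi> \<eta>' "-1"] coord_bracket_add_right[of \<xi> y \<eta>' \<eta> "-1"] assms by simp

text \<open>Every bracket costs one derivative, hence the order p + k. The difference of two
  brackets is split bilinearly by \<open>coord_bracket_diff\<close>, so that a bound on one factor
  and smallness of the other suffice.\<close>

lemma ad_iter_jet_continuous:
  fixes \<xi> \<eta> :: "'a::euclidean_space \<Rightarrow> 'a"
  assumes S: "open S" "K \<subseteq> S" and K: "compact K" and sm: "smooth_on S \<xi>" "smooth_on S \<eta>"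
  shows "\<epsilon> > 0 \<Longrightarrow> \<exists>\<delta>>0. \<forall>\<xi>' \<eta>'. smooth_on S \<xi>' \<longrightarrow> smooth_on S \<eta>' \<longrightarrow>
     jet_le (p + k) K (\<lambda>y. \<xi>' y - \<xi> y) \<delta> \<longrightarrow> jet_le (p + k) K (\<lambda>y. \<eta>' y - \<eta> y) \<delta> \<longrightarrow>
     jet_le p K (\<lambda>y. ad_iter \<xi>' \<eta>' k y - ad_iter \<xi> \<eta> k y) \<epsilon>"
proof (induction k arbitrary: p \<epsilon>)
  case 0 then show ?case by (intro exI[of _ \<epsilon>]) auto
next
  case (Suc k)
  let ?a = "ad_iter \<xi> \<eta> k"
  note sa = smooth_on_ad_iter[OF S(1)]
  obtain R1 where R1: "R1 > 0" "jet_le (Suc p) K \<xi> R1" using jet_le_exists[OF K S(2) sm(1)] .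
  obtain R2 where R2: "R2 > 0" "jet_le (Suc p) K ?a R2" using jet_le_exists[OF K S(2) sa[OF sm]] .
  define R where "R = max R1 R2"
  have R: "R > 0" "jet_le (Suc p) K \<xi> R" "jet_le (Suc p) K ?a R"
    using R1 R2 by (auto simp: R_def intro: jet_le_mono)
  define C where "C = 2 * real DIM('a) * 2 ^ p"
  have C: "C > 0" by (simp add: C_def)
  \<comment> \<open>The two parts of the split difference are bounded by C \<epsilon>0 (R + 1) and C
    R \<epsilon>0, so the denominator makes their sum at most \<epsilon>. Asking the induction
    hypothesis for closeness 1 as well keeps the perturbed iterate below R + 1.\<close>
  define \<epsilon>0 where "\<epsilon>0 = \<epsilon> / (2 * C * (R + 1))"
  have \<epsilon>0: "\<epsilon>0 > 0" "2 * C * (R + 1) * \<epsilon>0 = \<epsilon>" using Suc.prems C R by (auto simp: \<epsilon>0_def)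
  from Suc.IH[of "min 1 \<epsilon>0" "Suc p"] \<epsilon>0(1) obtain \<delta> where \<delta>: "\<delta> > 0"
    "\<And>\<xi>' \<eta>'. smooth_on S \<xi>' \<Longrightarrow> smooth_on S \<eta>' \<Longrightarrow>
     jet_le (Suc p + k) K (\<lambda>y. \<xi>' y - \<xi> y) \<delta> \<Longrightarrow> jet_le (Suc p + k) K (\<lambda>y. \<eta>' y - \<eta> y) \<delta> \<Longrightarrow>
     jet_le (Suc p) K (\<lambda>y. ad_iter \<xi>' \<eta>' k y - ad_iter \<xi> \<eta> k y) (min 1 \<epsilon>0)" by auto
  show ?case
  proof (intro exI[of _ "min \<delta> \<epsilon>0"] conjI allI impI)
    show "min \<delta> \<epsilon>0 > 0" using \<delta> \<epsilon>0 by simp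
    fix \<xi>' \<eta>' assume s': "smooth_on S \<xi>'" "smooth_on S \<eta>'"
      and j: "jet_le (p + Suc k) K (\<lambda>y. \<xi>' y - \<xi> y) (min \<delta> \<epsilon>0)" "jet_le (p + Suc k) K (\<lambda>y. \<eta>' y - \<eta> y) (min \<delta> \<epsilon>0)"
    let ?a' = "ad_iter \<xi>' \<eta>' k"
    have da: "jet_le (Suc p) K (\<lambda>y. ?a' y - ?a y) (min 1 \<epsilon>0)"
      by (rule \<delta>(2)[OF s']) (use j in \<open>auto intro: jet_le_mono\<close>)
    have "jet_le (Suc p) K (\<lambda>y. ?a y + (?a' y - ?a y)) (R + min 1 \<epsilon>0)"
      by (intro jet_le_add[OF S] smooth_on_diff sa sm s' S R da)
    then have a': "jet_le (Suc p) K ?a' (R + 1)" by (auto intro: jet_le_mono)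
    have d\<xi>: "jet_le (Suc p) K (\<lambda>y. \<xi>' y - \<xi> y) \<epsilon>0" using j(1) by (auto intro: jet_le_mono)
    have d\<eta>: "jet_le (Suc p) K (\<lambda>y. ?a' y - ?a y) \<epsilon>0" using da by (auto intro: jet_le_mono)
    have "jet_le p K (\<lambda>y. coord_bracket (\<lambda>y. \<xi>' y - \<xi> y) ?a' y + coord_bracket \<xi> (\<lambda>y. ?a' y - ?a y) y)
       (C * (\<epsilon>0 * (R + 1)) + C * (R * \<epsilon>0))"
      unfolding C_def using R(1) \<epsilon>0(1)
      by (intro jet_le_add[OF S] jet_le_coord_bracket[OF S] smooth_on_coord_bracket smooth_on_diff sa sm s' S d\<xi> d\<eta> a' R(2)) auto
    moreover have "C * (\<epsilon>0 * (R + 1)) + C * (R * \<epsilon>0) \<le> \<epsilon>"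
    proof -
      have "C * \<epsilon>0 > 0" using C \<epsilon>0 by simp
      then show ?thesis using \<epsilon>0(2) by (simp add: algebra_simps)
    qed
    ultimately have "jet_le p K (\<lambda>y. coord_bracket (\<lambda>y. \<xi>' y - \<xi> y) ?a' y + coord_bracket \<xi> (\<lambda>y. ?a' y - ?a y) y) \<epsilon>"
      by (rule_tac jet_le_mono) auto
    then show "jet_le p K (\<lambda>y. ad_iter \<xi>' \<eta>' (Suc k) y - ad_iter \<xi> \<eta> (Suc k) y) \<epsilon>"
    proof (rule jet_le_cong[OF S, rotated])
      fix y assume y: "y \<in> S"
      show "coord_bracket (\<lambda>y. \<xi>' y - \<xi> y) ?a' y + coord_bracket \<xi> (\<lambda>y. ?a' y - ?a y) y
        = ad_iter \<xi>' \<eta>' (Suc k) y - ad_iter \<xi> \<eta> (Suc k) y"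
        unfolding ad_iter.simps
        by (rule coord_bracket_diff[symmetric]) (intro smooth_on_differentiable[OF _ y] sa sm s')+
    qed
  qed
qed

subsection \<open>Stability of the spanning condition\<close>

text \<open>Spanning in dual form. Its negation hands over an annihilating covector, from which
  degenerate parameters are encoded, and compactness of the unit sphere makes it stable.\<close>

definition nondegenerate :: "('i \<Rightarrow> 'v::real_inner) \<Rightarrow> 'i set \<Rightarrow> bool" where
  "nondegenerate w I \<longleftrightarrow> (\<forall>l. l \<noteq> 0 \<longrightarrow> (\<exists>k\<in>I. l \<bullet> w k \<noteq> 0))"

lemma nondegenerate_span:
  fixes w :: "'i \<Rightarrow> 'v::euclidean_space"
  assumes "nondegenerate w I" shows "span (w ` I) = UNIV"
proof (rule ccontr)
  assume "span (w ` I) \<noteq> UNIV"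
  then have "dim (w ` I) < DIM('v)" using dim_eq_full[of "w ` I"] dim_subset_UNIV[of "w ` I"] by linarith
  then obtain l where "l \<noteq> 0" "\<And>y. y \<in> span (w ` I) \<Longrightarrow> orthogonal l y"
    using orthogonal_to_subspace_exists by blast
  moreover from this obtain k where "k \<in> I" "l \<bullet> w k \<noteq> 0" using assms unfolding nondegenerate_def by blast
  ultimately show False using span_base[of "w k" "w ` I"] unfolding orthogonal_def by blast
qed

text \<open>On the compact product of Q with the unit sphere, the sum of the absolute values of l
  paired with the vectors attains a positive minimum. Moving each vector by at most \<epsilon>
  changes this sum by at most \<epsilon> times the number of vectors.\<close>

lemma nondegenerate_robust:
  fixes v :: "'i \<Rightarrow> 'a::metric_space \<Rightarrow> 'v::euclidean_space"
  assumes Q: "compact Q" and I: "finite I" and cont: "\<And>k. k \<in> I \<Longrightarrow> continuous_on Q (v k)"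
    and nd: "\<And>y. y \<in> Q \<Longrightarrow> nondegenerate (\<lambda>k. v k y) I"
  shows "\<exists>\<epsilon>>0. \<forall>y\<in>Q. \<forall>w. (\<forall>k\<in>I. norm (w k - v k y) \<le> \<epsilon>) \<longrightarrow> nondegenerate w I"
proof (cases "Q = {}")
  case True then show ?thesis by (auto intro!: exI[of _ 1])
next
  case False
  let ?K = "Q \<times> sphere (0 :: 'v) 1"
  obtain e :: 'v where "e \<in> Basis" using nonempty_Basis by blast
  then have ne: "?K \<noteq> {}" using False by (auto intro!: exI[of _ e])
  let ?m = "\<lambda>(y, l). \<Sum>k\<in>I. \<bar>l \<bullet> v k y\<bar>"
  have "continuous_on ?K ?m"
    unfolding split_beta
    by (intro continuous_intros continuous_on_compose2[OF cont]) auto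
  from continuous_attains_inf[OF compact_Times[OF Q compact_sphere] ne this]
  obtain q where q: "q \<in> ?K" "\<And>z. z \<in> ?K \<Longrightarrow> ?m q \<le> ?m z" by blast
  obtain y0 l0 where yl: "q = (y0, l0)" "y0 \<in> Q" "norm l0 = 1" using q(1) by (cases q) simp
  then have "l0 \<noteq> 0" by auto
  then obtain k where "k \<in> I" "l0 \<bullet> v k y0 \<noteq> 0" using nd[OF yl(2)] unfolding nondegenerate_def by blast
  then have pos: "?m q > 0" using I yl by (auto intro!: sum_pos2[of I k])
  \<comment> \<open>The extra 1 makes \<open>card I\<close> times this bound strictly smaller than
    the minimum.\<close>
  let ?e = "?m q / (real (card I) + 1)"
  show ?thesis
  proof (intro exI[of _ ?e] conjI ballI allI impI)
    show "?e > 0" using pos by simp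
    fix y w assume y: "y \<in> Q" and w: "\<forall>k\<in>I. norm (w k - v k y) \<le> ?e"
    show "nondegenerate w I" unfolding nondegenerate_def
    proof (intro allI impI, rule ccontr)
      fix l :: 'v assume l: "l \<noteq> 0" and "\<not> (\<exists>k\<in>I. l \<bullet> w k \<noteq> 0)"
      then have z: "(l /\<^sub>R norm l) \<bullet> w k = 0" if "k \<in> I" for k using that by simp
      let ?u = "l /\<^sub>R norm l"
      have u: "norm ?u = 1" using l by simp
      have "\<bar>?u \<bullet> v k y\<bar> \<le> ?e" if k: "k \<in> I" for k
      proof -
        have "\<bar>?u \<bullet> v k y\<bar> = \<bar>?u \<bullet> (w k - v k y)\<bar>" using z[OF k] unfolding inner_diff_right by linarith
        also have "\<dots> \<le> norm ?u * norm (w k - v k y)" by (rule Cauchy_Schwarz_ineq2)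
        finally show ?thesis using w k u by force
      qed
      then have "(\<Sum>k\<in>I. \<bar>?u \<bullet> v k y\<bar>) \<le> real (card I) * ?e" using sum_bounded_above[of I "\<lambda>k. \<bar>?u \<bullet> v k y\<bar>" ?e] by simp
      also have "\<dots> < ?m q" using pos by (simp add: field_simps)
      finally have "?m (y, ?u) < ?m q" by simp
      moreover have "?m q \<le> ?m (y, ?u)" using u y by (intro q(2)) auto
      ultimately show False by simp
    qed
  qed
qed

subsection \<open>Degenerate parameters form a null set\<close>

text \<open>A copy of the basis as a finite type, so that
  \<open>'v basis_index \<times> bool\<close> can index vectors. It has twice as many elements as
  the dimension, that is 2nN for \<open>'v = 'e ^ 'k\<close>.\<close>

typedef (overloaded) 'a basis_index = "Basis :: 'a::euclidean_space set"
  using nonempty_Basis by blast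

instance basis_index :: (euclidean_space) finite
proof
  have "(UNIV :: 'a basis_index set) = Abs_basis_index ` Basis"
    using type_definition.Abs_image[OF type_definition_basis_index] by (rule sym)
  then show "finite (UNIV :: 'a basis_index set)" using finite_imageI[OF finite_Basis] by metis
qed

lemma bij_betw_Rep_basis_index: "bij_betw Rep_basis_index UNIV (Basis :: 'a::euclidean_space set)"
  by (simp add: bij_betw_def inj_on_def Rep_basis_index_inject type_definition.Rep_range[OF type_definition_basis_index])

text \<open>Increments are compared with the base point x only. This is weaker than a Lipschitz
  condition on T, but it is the form that \<open>negligible_locally_Lipschitz_image\<close>
  takes.\<close>

lemma differentiable_imp_pointwise_Lipschitz:
  fixes f :: "'a::euclidean_space \<Rightarrow> 'b::euclidean_space"
  assumes "f differentiable (at x)"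
  obtains T B where "open T" "x \<in> T" "B \<ge> 0" "\<forall>y\<in>T. norm (f y - f x) \<le> B * norm (y - x)"
proof -
  obtain f' where f': "(f has_derivative f') (at x)" using assms by (auto simp: differentiable_def)
  then have bl: "bounded_linear f'" by (rule has_derivative_bounded_linear)
  from f' have "\<forall>e>0. \<exists>d>0. \<forall>y. norm (y - x) < d \<longrightarrow> norm (f y - f x - f' (y - x)) \<le> e * norm (y - x)"
    unfolding has_derivative_at_alt by blast
  then obtain d where d: "d > 0" "\<And>y. norm (y - x) < d \<Longrightarrow> norm (f y - f x - f' (y - x)) \<le> 1 * norm (y - x)"
    using zero_less_one by blast
  show ?thesis
  proof (rule that[of "ball x d" "1 + onorm f'"])
    show "1 + onorm f' \<ge> 0" using onorm_pos_le[OF bl] by simp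
    show "\<forall>y\<in>ball x d. norm (f y - f x) \<le> (1 + onorm f') * norm (y - x)"
    proof
    fix y assume "y \<in> ball x d"
    then have "norm (y - x) < d" by (simp add: dist_norm norm_minus_commute)
    from d(2)[OF this] have "norm (f y - f x) \<le> norm (y - x) + norm (f' (y - x))"
      using norm_triangle_sub[of "f y - f x" "f' (y - x)"] by simp
    also have "\<dots> \<le> norm (y - x) + onorm f' * norm (y - x)" using onorm[OF bl] by simp
    finally show "norm (f y - f x) \<le> (1 + onorm f') * norm (y - x)" by (simp add: algebra_simps)
    qed
  qed (use d in auto)
qed

text \<open>
  If some covector annihilates all components of \<open>G y t\<close>, normalise its \<open>e\<close>-component to 1. Then
  the \<open>e\<close>-components of \<open>G y t\<close> are redundant, and \<open>y\<close> and the other components of the covector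
  can be stored in their place. There are more such places than data to store, so that the codes
  lie in a hyperplane, and \<open>t\<close> is a locally Lipschitz function of its code.
\<close>

lemma negligible_degenerate_parameters:
  fixes G :: "'v::euclidean_space \<Rightarrow> 'v ^ ('v basis_index \<times> bool) \<Rightarrow> 'v ^ ('v basis_index \<times> bool)"
  assumes d: "\<And>y t. y \<in> K \<Longrightarrow> (\<lambda>y. G y t) differentiable (at y)"
    and C: "C \<ge> 0" "\<And>y t t'. y \<in> K \<Longrightarrow> norm (t - t') \<le> C * norm (G y t - G y t')"
  shows "negligible {t. \<exists>y\<in>K. \<not> nondegenerate (\<lambda>k. G y t $ k) UNIV}"
proof -
  \<comment> \<open>The slots of a code X are the e-components of its entries. Those with flag
    \<open>True\<close> hold the coordinates of y, those with flag \<open>False\<close> the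
    coordinates of the covector other than the one along e; \<open>dec\<close> reads them
    back.\<close>
  define dec :: "'v \<Rightarrow> bool \<Rightarrow> 'v ^ ('v basis_index \<times> bool) \<Rightarrow> 'v"
    where "dec e a X = (\<Sum>i\<in>UNIV. (X $ (i, a) \<bullet> e) *\<^sub>R Rep_basis_index i)" for e a X
  define pr :: "'v \<Rightarrow> 'v \<Rightarrow> 'v" where "pr e v = v - (v \<bullet> e) *\<^sub>R e" for e v
  \<comment> \<open>This restores the redundant components. The covector is l = e +
    \<open>dec e False X\<close>, with e-component 1, and l annihilates a vector v exactly if the
    e-component of v is minus the pairing of l with \<open>pr e v\<close>.\<close>
  define Md :: "'v \<Rightarrow> 'v ^ ('v basis_index \<times> bool) \<Rightarrow> 'v ^ ('v basis_index \<times> bool)"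
    where "Md e X = (\<chi> k. pr e (X $ k) - ((e + dec e False X) \<bullet> pr e (X $ k)) *\<^sub>R e)" for e X
  \<comment> \<open>For d the dimension, y takes d of the 2d slots and the normalised covector d -
    1. The slot \<open>(Abs_basis_index e, False)\<close> is left over, and its vanishing is the
    equation of the hyperplane.\<close>
  define S where "S e = {X. X $ (Abs_basis_index e, False) \<bullet> e = 0 \<and> dec e True X \<in> K \<and>
     (\<exists>t. Md e X = G (dec e True X) t)}" for e
  define g where "g e X = (SOME t. Md e X = G (dec e True X) t)" for e X
  have inj: "t = t'" if "y \<in> K" "G y t = G y t'" for y t t'
    using C(2)[OF that(1), of t t'] that(2) by simp
  have g: "Md e X = G (dec e True X) (g e X)" if "X \<in> S e" for e X
    using that unfolding S_def g_def by (auto intro: someI_ex)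
  have sum_rep: "(\<Sum>i\<in>UNIV. (v \<bullet> Rep_basis_index i) *\<^sub>R Rep_basis_index i) = v" for v :: 'v
    using sum.reindex_bij_betw[OF bij_betw_Rep_basis_index, of "\<lambda>b. (v \<bullet> b) *\<^sub>R b"]
    by (simp add: euclidean_representation)
  have "negligible (g e ` S e)" if e: "e \<in> Basis" for e
  proof (rule negligible_locally_Lipschitz_image)
    have "negligible {X :: 'v ^ ('v basis_index \<times> bool). axis (Abs_basis_index e, False) e \<bullet> X = 0}"
      using e by (intro negligible_hyperplane) (auto simp: axis_eq_0_iff)
    then show "negligible (S e)"
      by (rule negligible_subset) (auto simp: S_def inner_axis inner_commute)
  next
    fix X assume X: "X \<in> S e"
    \<comment> \<open>With the parameter frozen at \<open>g e X\<close>, this function vanishes at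
      X. At another code Z it is the change of G, over the y stored in Z, from the parameter
      \<open>g e X\<close> to \<open>g e Z\<close>. The estimate with constant C then bounds the
      change of \<open>g e\<close>.\<close>
    let ?f = "\<lambda>Z. Md e Z - G (dec e True Z) (g e X)"
    have sd: "smooth_on UNIV (dec e a)" for a
      unfolding dec_def[abs_def] by (intro smooth_on_sum smooth_on_scaleR smooth_on_inner smooth_on_const smooth_on_nth open_UNIV)
    have "smooth_on UNIV (Md e)"
      unfolding Md_def[abs_def] pr_def
      by (intro smooth_on_vec_lambda smooth_on_diff smooth_on_scaleR smooth_on_inner smooth_on_add smooth_on_const smooth_on_nth sd open_UNIV)
    then have "Md e differentiable (at X)" by (rule smooth_on_differentiable) simp
    moreover have "(\<lambda>y. G y (g e X)) differentiable (at (dec e True X))" using X by (intro d) (simp add: S_def)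
    then have "(\<lambda>Z. G (dec e True Z) (g e X)) differentiable (at X)"
      using differentiable_chain_at[OF smooth_on_differentiable[OF sd]] by (simp add: o_def)
    ultimately have "?f differentiable (at X)" by (rule differentiable_diff)
    from differentiable_imp_pointwise_Lipschitz[OF this] obtain T B where
      TB: "open T" "X \<in> T" "B \<ge> 0" "\<forall>Z\<in>T. norm (?f Z - ?f X) \<le> B * norm (Z - X)" .
    show "\<exists>T B. open T \<and> X \<in> T \<and> (\<forall>Z\<in>S e \<inter> T. norm (g e Z - g e X) \<le> B * norm (Z - X))"
    proof (intro exI conjI ballI)
      fix Z assume Z: "Z \<in> S e \<inter> T"
      have "norm (g e Z - g e X) \<le> C * norm (G (dec e True Z) (g e Z) - G (dec e True Z) (g e X))"
        by (rule C(2)) (use Z in \<open>simp add: S_def\<close>)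
      also have "G (dec e True Z) (g e Z) - G (dec e True Z) (g e X) = ?f Z - ?f X"
        using g[of Z e] g[OF X] Z by simp
      also have "C * norm (?f Z - ?f X) \<le> C * (B * norm (Z - X))"
        using TB(4) Z C(1) by (intro mult_left_mono) auto
      finally show "norm (g e Z - g e X) \<le> (C * B) * norm (Z - X)" by simp
    qed fact+
  qed simp
  then have "negligible (\<Union>e\<in>Basis. g e ` S e)" by (intro negligible_Union) auto
  then show ?thesis
  proof (rule negligible_subset, intro subsetI)
    fix t assume "t \<in> {t. \<exists>y\<in>K. \<not> nondegenerate (\<lambda>k. G y t $ k) UNIV}"
    then obtain y where y: "y \<in> K" and "\<not> nondegenerate (\<lambda>k. G y t $ k) UNIV" by blast
    then obtain l0 where l0: "l0 \<noteq> 0" "\<And>k. l0 \<bullet> G y t $ k = 0"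
      unfolding nondegenerate_def by blast
    from l0(1) obtain e where e: "e \<in> Basis" "l0 \<bullet> e \<noteq> 0" using euclidean_all_zero_iff by blast
    define l where "l = l0 /\<^sub>R (l0 \<bullet> e)"
    have l: "l \<bullet> e = 1" "\<And>k. l \<bullet> G y t $ k = 0" using e l0 by (simp_all add: l_def)
    define s where "s k = (if snd k then y \<bullet> Rep_basis_index (fst k)
       else if fst k = Abs_basis_index e then 0 else l \<bullet> Rep_basis_index (fst k))" for k
    define X where "X = (\<chi> k. pr e (G y t $ k) + s k *\<^sub>R e)"
    have ee: "e \<bullet> e = 1" using e by simp
    have pre: "pr e v \<bullet> e = 0" for v by (simp add: pr_def inner_diff_left ee)
    have Xe: "X $ k \<bullet> e = s k" for k by (simp add: X_def inner_add_left pre ee)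
    have prX: "pr e (X $ k) = pr e (G y t $ k)" for k
      unfolding pr_def[of e "X $ k"] Xe by (simp add: X_def)
    have rE: "Rep_basis_index (Abs_basis_index e) = e" using e by (simp add: Abs_basis_index_inverse)
    have dT: "dec e True X = y" by (simp add: dec_def Xe s_def sum_rep)
    have "l = (\<Sum>i\<in>UNIV. (l \<bullet> Rep_basis_index i) *\<^sub>R Rep_basis_index i)" by (rule sum_rep[symmetric])
    also have "\<dots> = e + (\<Sum>i\<in>UNIV - {Abs_basis_index e}. (l \<bullet> Rep_basis_index i) *\<^sub>R Rep_basis_index i)"
      by (subst sum.remove[of _ "Abs_basis_index e"]) (simp_all add: rE l)
    also have "(\<Sum>i\<in>UNIV - {Abs_basis_index e}. (l \<bullet> Rep_basis_index i) *\<^sub>R Rep_basis_index i) = dec e False X"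
      unfolding dec_def Xe s_def
      by (subst (2) sum.remove[of _ "Abs_basis_index e"]) simp_all
    finally have dF: "e + dec e False X = l" by simp
    have M: "Md e X = G y t"
    proof -
      have "pr e (X $ k) - (l \<bullet> pr e (X $ k)) *\<^sub>R e = G y t $ k" for k
        unfolding prX by (simp add: pr_def inner_diff_right l)
      then show ?thesis by (simp add: Md_def dF vec_eq_iff)
    qed
    have XS: "X \<in> S e" using M y Xe[of "(Abs_basis_index e, False)"] by (auto simp: S_def dT s_def)
    have "g e X = t" using inj[OF y] g[OF XS] by (simp add: dT M)
    then show "t \<in> (\<Union>e\<in>Basis. g e ` S e)" using e XS by blast
  qed
qed

subsection \<open>Iterated brackets of polynomial fields\<close>

text \<open>A single step of the count in \<open>ad_iter_power\<close>: differentiating the power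
  along Y costs one factor and leaves the coefficient Y x \<bullet> b.\<close>

lemma coord_bracket_power:
  fixes Y g :: "'e::euclidean_space \<Rightarrow> 'e"
  assumes Y: "Y differentiable (at x)" and g: "g differentiable (at x)"
  shows "coord_bracket Y (\<lambda>x. ((x - y) \<bullet> b) ^ Suc n *\<^sub>R g x) x
    = ((x - y) \<bullet> b) ^ n *\<^sub>R ((real (Suc n) * (Y x \<bullet> b)) *\<^sub>R g x + ((x - y) \<bullet> b) *\<^sub>R coord_bracket Y g x)"
proof -
  have "((\<lambda>x. (x - y) \<bullet> b) has_derivative (\<lambda>v. v \<bullet> b)) (at x)" by (auto intro!: derivative_eq_intros)
  from has_derivative_power[OF this, of "Suc n"]
  have "((\<lambda>x. ((x - y) \<bullet> b) ^ Suc n) has_derivative (\<lambda>v. real (Suc n) * (v \<bullet> b) * ((x - y) \<bullet> b) ^ n)) (at x)"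
    by simp
  from has_derivative_scaleR[OF this, of g "frechet_derivative g (at x)"]
  have "frechet_derivative (\<lambda>x. ((x - y) \<bullet> b) ^ Suc n *\<^sub>R g x) (at x)
     = (\<lambda>v. ((x - y) \<bullet> b) ^ Suc n *\<^sub>R frechet_derivative g (at x) v + (real (Suc n) * (v \<bullet> b) * ((x - y) \<bullet> b) ^ n) *\<^sub>R g x)"
    using g by (intro frechet_derivative_eqI) (simp add: frechet_derivative_works[symmetric])
  then show ?thesis
    unfolding coord_bracket_def
    by (simp add: linear_cmul[OF linear_frechet_derivative[OF Y]] scaleR_diff_right scaleR_add_right mult_ac del: of_nat_Suc)
qed

text \<open>
  Each bracket with \<open>Y\<close> lowers the order of vanishing along the hyperplane through \<open>y\<close> orthogonal
  to \<open>b\<close> by exactly one, because \<open>Y\<close> is transversal to it.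
\<close>

lemma ad_iter_power:
  fixes Y g :: "'e::euclidean_space \<Rightarrow> 'e"
  assumes S: "open S" "y \<in> S" and Y: "smooth_on S Y" "Y y \<bullet> b \<noteq> 0" and g: "smooth_on S g"
  shows "k \<le> j \<Longrightarrow> \<exists>g' c. smooth_on S g' \<and> c \<noteq> 0 \<and> g' y = c *\<^sub>R g y \<and>
     (\<forall>x\<in>S. ad_iter Y (\<lambda>x. ((x - y) \<bullet> b) ^ j *\<^sub>R g x) k x = ((x - y) \<bullet> b) ^ (j - k) *\<^sub>R g' x)"
proof (induction k)
  case 0 show ?case using g by (intro exI[of _ g] exI[of _ 1]) simp
next
  case (Suc k)
  then obtain g' c where IH: "smooth_on S g'" "c \<noteq> 0" "g' y = c *\<^sub>R g y"
    "\<And>x. x \<in> S \<Longrightarrow> ad_iter Y (\<lambda>x. ((x - y) \<bullet> b) ^ j *\<^sub>R g x) k x = ((x - y) \<bullet> b) ^ (j - k) *\<^sub>R g' x" by auto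
  define n where "n = j - Suc k"
  have n: "j - k = Suc n" using Suc.prems by (simp add: n_def)
  let ?g = "\<lambda>x. (real (Suc n) * (Y x \<bullet> b)) *\<^sub>R g' x + ((x - y) \<bullet> b) *\<^sub>R coord_bracket Y g' x"
  show ?case
  proof (intro exI[of _ ?g] exI[of _ "real (Suc n) * (Y y \<bullet> b) * c"] conjI ballI)
    show "smooth_on S ?g"
      by (intro smooth_on_add smooth_on_scaleR smooth_on_mult smooth_on_inner smooth_on_diff smooth_on_ident
          smooth_on_const smooth_on_coord_bracket S Y IH)
    show "real (Suc n) * (Y y \<bullet> b) * c \<noteq> 0" using Y IH by simp
    show "?g y = (real (Suc n) * (Y y \<bullet> b) * c) *\<^sub>R g y" by (simp add: IH)
    fix x assume x: "x \<in> S"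
    have "ad_iter Y (\<lambda>x. ((x - y) \<bullet> b) ^ j *\<^sub>R g x) (Suc k) x = coord_bracket Y (\<lambda>x. ((x - y) \<bullet> b) ^ Suc n *\<^sub>R g' x) x"
      unfolding ad_iter.simps by (rule coord_bracket_cong[OF S(1) x]) (simp_all add: IH(4) n)
    also have "\<dots> = ((x - y) \<bullet> b) ^ n *\<^sub>R ?g x"
      by (rule coord_bracket_power) (intro smooth_on_differentiable[OF _ x] Y IH)+
    finally show "ad_iter Y (\<lambda>x. ((x - y) \<bullet> b) ^ j *\<^sub>R g x) (Suc k) x = ((x - y) \<bullet> b) ^ (j - Suc k) *\<^sub>R ?g x"
      by (simp only: n_def)
  qed
qed

text \<open>Division by s - s0 with the value at s0 as remainder, following Horner's scheme. The
  quotient has smaller degree, which bounds multiplicities in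
  \<open>vector_polynomial_factor\<close>.\<close>

lemma vector_polynomial_division:
  fixes w :: "nat \<Rightarrow> 'v::real_vector"
  shows "\<exists>w'. \<forall>s::real. (\<Sum>j\<le>Suc m. s ^ j *\<^sub>R w j) = (\<Sum>j\<le>Suc m. s0 ^ j *\<^sub>R w j) + (s - s0) *\<^sub>R (\<Sum>j\<le>m. s ^ j *\<^sub>R w' j)"
proof (induction m arbitrary: w)
  case 0 show ?case by (intro exI[of _ "\<lambda>_. w 1"]) (simp add: algebra_simps)
next
  case (Suc m)
  have shift: "(\<Sum>j\<le>Suc n. s ^ j *\<^sub>R w j) = w 0 + s *\<^sub>R (\<Sum>j\<le>n. s ^ j *\<^sub>R w (Suc j))" for s :: real and n and w :: "nat \<Rightarrow> 'v"
    by (subst sum.atMost_Suc_shift) (simp add: scaleR_sum_right)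
  obtain w' where w': "\<And>s::real. (\<Sum>j\<le>Suc m. s ^ j *\<^sub>R w (Suc j))
      = (\<Sum>j\<le>Suc m. s0 ^ j *\<^sub>R w (Suc j)) + (s - s0) *\<^sub>R (\<Sum>j\<le>m. s ^ j *\<^sub>R w' j)"
    using Suc[of "\<lambda>j. w (Suc j)"] by blast
  let ?p = "\<Sum>j\<le>Suc m. s0 ^ j *\<^sub>R w (Suc j)"
  let ?w = "\<lambda>j. case j of 0 \<Rightarrow> ?p | Suc j \<Rightarrow> w' j"
  show ?case
  proof (intro exI[of _ ?w] allI)
    fix s :: real
    let ?q = "\<Sum>j\<le>m. s ^ j *\<^sub>R w' j"
    have q: "(\<Sum>j\<le>Suc m. s ^ j *\<^sub>R ?w j) = ?p + s *\<^sub>R ?q" unfolding shift[of s ?w m] by simp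
    show "(\<Sum>j\<le>Suc (Suc m). s ^ j *\<^sub>R w j) = (\<Sum>j\<le>Suc (Suc m). s0 ^ j *\<^sub>R w j) + (s - s0) *\<^sub>R (\<Sum>j\<le>Suc m. s ^ j *\<^sub>R ?w j)"
      unfolding q shift[of s w "Suc m"] shift[of s0 w "Suc m"] w'[of s]
      by (simp only: algebra_simps scaleR_scaleR)
  qed
qed

text \<open>The exponent j0 is the multiplicity of the zero at s0. Dividing by s - s0 as long as the
  value at s0 vanishes stops after at most m steps.\<close>

lemma vector_polynomial_factor:
  fixes w :: "nat \<Rightarrow> 'v::real_vector"
  assumes "\<exists>s::real. (\<Sum>j\<le>m. s ^ j *\<^sub>R w j) \<noteq> 0"
  shows "\<exists>j0\<le>m. \<exists>m' w'. (\<forall>s::real. (\<Sum>j\<le>m. s ^ j *\<^sub>R w j) = (s - s0) ^ j0 *\<^sub>R (\<Sum>j\<le>m'. s ^ j *\<^sub>R w' j))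
    \<and> (\<Sum>j\<le>m'. s0 ^ j *\<^sub>R w' j) \<noteq> 0"
  using assms
proof (induction m arbitrary: w)
  case 0 then show ?case by (intro exI[of _ 0] conjI exI[of _ w]) auto
next
  case (Suc m)
  show ?case
  proof (cases "(\<Sum>j\<le>Suc m. s0 ^ j *\<^sub>R w j) = 0")
    case False
    then show ?thesis by (intro exI[of _ 0] conjI exI[of _ "Suc m"] exI[of _ w]) auto
  next
    case True
    obtain w1 where w1: "\<And>s::real. (\<Sum>j\<le>Suc m. s ^ j *\<^sub>R w j) = (s - s0) *\<^sub>R (\<Sum>j\<le>m. s ^ j *\<^sub>R w1 j)"
      using vector_polynomial_division[where m=m and w=w and ?s0.0=s0] True by auto
    have "\<exists>s::real. (\<Sum>j\<le>m. s ^ j *\<^sub>R w1 j) \<noteq> 0" using Suc.prems unfolding w1 by auto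
    from Suc.IH[OF this] obtain j0 m' w' where IH: "j0 \<le> m"
      "\<And>s::real. (\<Sum>j\<le>m. s ^ j *\<^sub>R w1 j) = (s - s0) ^ j0 *\<^sub>R (\<Sum>j\<le>m'. s ^ j *\<^sub>R w' j)"
      "(\<Sum>j\<le>m'. s0 ^ j *\<^sub>R w' j) \<noteq> 0" by blast
    then show ?thesis unfolding w1
      by (intro exI[of _ "Suc j0"] conjI exI[of _ m'] exI[of _ w']) auto
  qed
qed

lemma vector_polynomial_eq_0:
  fixes w :: "nat \<Rightarrow> 'v::euclidean_space"
  assumes "\<And>s::real. (\<Sum>j\<le>m. s ^ j *\<^sub>R w j) = 0" "j \<le> m"
  shows "w j = 0"
proof (rule euclidean_eqI)
  fix e :: 'v assume "e \<in> Basis"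
  have "(\<Sum>j\<le>m. (w j \<bullet> e) * s ^ j) = 0" for s :: real
    using arg_cong[OF assms(1)[of s], of "\<lambda>v. v \<bullet> e"] by (simp add: inner_sum_left mult.commute)
  then have "\<forall>j\<le>m. w j \<bullet> e = 0" using zero_polynom_imp_zero_coeffs[of "\<lambda>j. w j \<bullet> e" m] by blast
  then show "w j \<bullet> e = 0 \<bullet> e" using assms(2) by simp
qed

text \<open>If the polynomial were nonzero, let j0 be its multiplicity at y \<bullet> b. By
  \<open>ad_iter_power\<close> the bracket of order j0 at y is a nonzero multiple of the remaining
  factor, which does not vanish there. Since j0 is at most m, this bracket is among those assumed to
  vanish.\<close>

lemma ad_iter_polynomial_inject:
  fixes Y :: "'e::euclidean_space \<Rightarrow> 'e"
  assumes S: "open S" "y \<in> S" and Y: "smooth_on S Y" "Y y \<bullet> b \<noteq> 0" and \<beta>: "smooth_on S \<beta>" "\<beta> y \<noteq> (0::real)"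
    and z: "\<And>k. k \<le> m \<Longrightarrow> ad_iter Y (\<lambda>x. \<beta> x *\<^sub>R (\<Sum>j\<le>m. (x \<bullet> b) ^ j *\<^sub>R w j)) k y = 0" and j: "j \<le> m"
  shows "w j = 0"
proof (rule vector_polynomial_eq_0[OF _ j], rule ccontr)
  fix s assume "(\<Sum>j\<le>m. s ^ j *\<^sub>R w j) \<noteq> 0"
  then obtain j0 m' w' where f: "j0 \<le> m"
    "\<And>s::real. (\<Sum>j\<le>m. s ^ j *\<^sub>R w j) = (s - y \<bullet> b) ^ j0 *\<^sub>R (\<Sum>j\<le>m'. s ^ j *\<^sub>R w' j)"
    "(\<Sum>j\<le>m'. (y \<bullet> b) ^ j *\<^sub>R w' j) \<noteq> 0"
    using vector_polynomial_factor[where m=m and w=w and ?s0.0="y \<bullet> b"] by blast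
  let ?g = "\<lambda>x. \<beta> x *\<^sub>R (\<Sum>j\<le>m'. (x \<bullet> b) ^ j *\<^sub>R w' j)"
  have "smooth_on S ?g"
    by (intro smooth_on_scaleR smooth_on_sum smooth_on_power smooth_on_inner smooth_on_ident smooth_on_const S \<beta>)
  from ad_iter_power[OF S Y this order_refl, of j0] obtain g' c where
    g': "c \<noteq> 0" "g' y = c *\<^sub>R ?g y"
    "\<forall>x\<in>S. ad_iter Y (\<lambda>x. ((x - y) \<bullet> b) ^ j0 *\<^sub>R ?g x) j0 x = ((x - y) \<bullet> b) ^ (j0 - j0) *\<^sub>R g' x" by blast
  have "(\<lambda>x. \<beta> x *\<^sub>R (\<Sum>j\<le>m. (x \<bullet> b) ^ j *\<^sub>R w j)) = (\<lambda>x. ((x - y) \<bullet> b) ^ j0 *\<^sub>R ?g x)"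
    unfolding f(2) by (simp add: inner_diff_left mult.commute)
  then have "g' y = 0" using g'(3) S(2) z[OF f(1)] by simp
  then show False using g'(1,2) f(3) \<beta>(2) by simp
qed

lemma ad_iter_add_scaled:
  fixes Y :: "'e::euclidean_space \<Rightarrow> 'e"
  assumes S: "open S" and Y: "smooth_on S Y" and sm: "smooth_on S \<eta>" "smooth_on S h"
  shows "y \<in> S \<Longrightarrow> ad_iter Y (\<lambda>x. \<eta> x + a *\<^sub>R h x) k y = ad_iter Y \<eta> k y + a *\<^sub>R ad_iter Y h k y"
proof (induction k arbitrary: y)
  case (Suc k)
  have "ad_iter Y (\<lambda>x. \<eta> x + a *\<^sub>R h x) (Suc k) y = coord_bracket Y (\<lambda>x. ad_iter Y \<eta> k x + a *\<^sub>R ad_iter Y h k x) y"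
    unfolding ad_iter.simps by (rule coord_bracket_cong[OF S Suc.prems]) (simp_all add: Suc.IH)
  also have "\<dots> = ad_iter Y \<eta> (Suc k) y + a *\<^sub>R ad_iter Y h (Suc k) y"
    unfolding ad_iter.simps
    by (rule coord_bracket_add_right) (intro smooth_on_differentiable[OF _ Suc.prems] smooth_on_ad_iter S Y sm)+
  finally show ?case .
qed simp

lemma ad_iter_add_sum:
  fixes Y :: "'e::euclidean_space \<Rightarrow> 'e"
  assumes S: "open S" and Y: "smooth_on S Y" and \<eta>: "smooth_on S \<eta>" and y: "y \<in> S"
  shows "(\<And>\<tau>. \<tau> \<in> T \<Longrightarrow> smooth_on S (h \<tau>)) \<Longrightarrow>
    ad_iter Y (\<lambda>x. \<eta> x + (\<Sum>\<tau>\<in>T. a \<tau> *\<^sub>R h \<tau> x)) k y = ad_iter Y \<eta> k y + (\<Sum>\<tau>\<in>T. a \<tau> *\<^sub>R ad_iter Y (h \<tau>) k y)"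
proof (induction T rule: infinite_finite_induct)
  case (insert \<tau> T)
  have "ad_iter Y (\<lambda>x. (\<eta> x + (\<Sum>\<tau>\<in>T. a \<tau> *\<^sub>R h \<tau> x)) + a \<tau> *\<^sub>R h \<tau> x) k y
    = ad_iter Y (\<lambda>x. \<eta> x + (\<Sum>\<tau>\<in>T. a \<tau> *\<^sub>R h \<tau> x)) k y + a \<tau> *\<^sub>R ad_iter Y (h \<tau>) k y"
    using insert.prems by (intro ad_iter_add_scaled[OF S Y _ _ y] smooth_on_add smooth_on_sum smooth_on_scaleR S \<eta> smooth_on_const) auto
  then show ?case using insert by (simp add: add_ac)
qed simp_all

lemma ad_iter_zero:
  fixes Y :: "'e::euclidean_space \<Rightarrow> 'e"
  assumes S: "open S" and Y: "smooth_on S Y" and y: "y \<in> S"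
  shows "ad_iter Y (\<lambda>x. 0) k y = 0"
  using ad_iter_add_scaled[OF S Y smooth_on_const smooth_on_const y, of 0 "-1" 0 k] by simp

subsection \<open>Generic perturbations in coordinates\<close>

definition monomial_field :: "('e \<Rightarrow> real) \<Rightarrow> 'e \<Rightarrow> nat \<Rightarrow> 'e \<Rightarrow> 'e::euclidean_space \<Rightarrow> 'e" where
  "monomial_field \<beta> b n e x = (\<beta> x * (x \<bullet> b) ^ n) *\<^sub>R e"

lemma smooth_on_monomial_field: "open S \<Longrightarrow> smooth_on S \<beta> \<Longrightarrow> smooth_on S (monomial_field \<beta> b n e)"
  unfolding monomial_field_def[abs_def]
  by (intro smooth_on_scaleR smooth_on_mult smooth_on_power smooth_on_inner smooth_on_ident smooth_on_const)

text \<open>Translates between scalar parameters, one for each index and basis vector, and a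
  polynomial whose vector coefficient of degree n is the parameter of index
  \<open>inv en n\<close>.\<close>

lemma sum_monomial_field:
  assumes en: "bij_betw en (UNIV :: 'q::finite set) {..m}"
  shows "(\<Sum>(j, e)\<in>UNIV \<times> Basis. (t j \<bullet> e) *\<^sub>R monomial_field \<beta> b (en j) e x)
    = \<beta> x *\<^sub>R (\<Sum>n\<le>m. (x \<bullet> b) ^ n *\<^sub>R t (inv en n))"
proof -
  have "(\<Sum>(j, e)\<in>UNIV \<times> Basis. (t j \<bullet> e) *\<^sub>R monomial_field \<beta> b (en j) e x)
    = (\<Sum>j\<in>UNIV. \<Sum>e\<in>Basis. (\<beta> x * (x \<bullet> b) ^ en j) *\<^sub>R (t j \<bullet> e) *\<^sub>R e)"
    unfolding sum.cartesian_product[symmetric] by (simp add: monomial_field_def mult.commute)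
  also have "\<dots> = (\<Sum>j\<in>UNIV. (\<beta> x * (x \<bullet> b) ^ en j) *\<^sub>R t j)"
    by (simp only: scaleR_sum_right[symmetric] euclidean_representation)
  also have "\<dots> = (\<Sum>j\<in>UNIV. (\<beta> x * (x \<bullet> b) ^ en j) *\<^sub>R t (inv en (en j)))"
    using en by (simp add: bij_betw_def)
  also have "\<dots> = (\<Sum>n\<le>m. (\<beta> x * (x \<bullet> b) ^ n) *\<^sub>R t (inv en n))"
    by (rule sum.reindex_bij_betw[OF en])
  finally show ?thesis by (simp add: scaleR_sum_right)
qed

lemma ball_not_subset_negligible:
  assumes "negligible N" "\<epsilon> > 0" shows "\<not> ball (x :: 'a::euclidean_space) \<epsilon> \<subseteq> N"
proof
  assume "ball x \<epsilon> \<subseteq> N"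
  from negligible_subset[OF assms(1) this] show False
    using open_not_negligible[of "ball x \<epsilon>"] assms(2) by simp
qed

text \<open>The brackets at y are affine in t, because \<open>Y i\<close> does not involve t. Their
  linear part is injective by \<open>ad_iter_polynomial_inject\<close>, used at each point of the
  configuration separately, and the inverse is bounded uniformly over the compact Q. Hence
  \<open>negligible_degenerate_parameters\<close> applies, and no ball is a null set.\<close>

lemma generic_parameters:
  fixes Y \<eta> :: "'k::finite \<Rightarrow> 'e::euclidean_space \<Rightarrow> 'e" and Q :: "('e ^ 'k) set"
    and en :: "('e ^ 'k) basis_index \<times> bool \<Rightarrow> nat"
  assumes S: "\<And>i. open (S i)" and Y: "\<And>i. smooth_on (S i) (Y i)" and \<eta>: "\<And>i. smooth_on (S i) (\<eta> i)"
    and \<beta>: "\<And>i. smooth_on (S i) (\<beta> i)" and Q: "compact Q"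
    and QS: "\<And>y i. y \<in> Q \<Longrightarrow> y $ i \<in> S i" and Yb: "\<And>y i. y \<in> Q \<Longrightarrow> Y i (y $ i) \<bullet> b i \<noteq> 0"
    and \<beta>0: "\<And>y i. y \<in> Q \<Longrightarrow> \<beta> i (y $ i) \<noteq> 0"
    and en: "bij_betw en UNIV {..m}" and \<epsilon>: "\<epsilon> > 0"
  shows "\<exists>t :: ('e ^ 'k) ^ (('e ^ 'k) basis_index \<times> bool). norm t < \<epsilon> \<and> (\<forall>y\<in>Q. nondegenerate
    (\<lambda>n. \<chi> i. ad_iter (Y i) (\<lambda>x. \<eta> i x + (\<Sum>(j, e)\<in>UNIV \<times> Basis. (t $ j $ i \<bullet> e) *\<^sub>R monomial_field (\<beta> i) (b i) (en j) e x)) n (y $ i)) {..m})"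
proof -
  define T where "T = (UNIV :: (('e ^ 'k) basis_index \<times> bool) set) \<times> (Basis :: 'e set)"
  define H where "H i \<tau> = monomial_field (\<beta> i) (b i) (en (fst \<tau>)) (snd \<tau>)" for i \<tau>
  define a where "a t i \<tau> = t $ fst \<tau> $ i \<bullet> snd \<tau>"
    for t :: "('e ^ 'k) ^ (('e ^ 'k) basis_index \<times> bool)" and i and \<tau> :: "(('e ^ 'k) basis_index \<times> bool) \<times> 'e"
  define V where "V i \<tau> k = ad_iter (Y i) (H i \<tau>) k" for i \<tau> k
  \<comment> \<open>The enumeration \<open>en\<close> is used twice, for the order of the bracket
    and for the degree of the monomial, so that brackets and parameters share one index type and the
    linear map is square.\<close>
  define B where "B y t = (\<chi> k. \<chi> i. \<Sum>\<tau>\<in>T. a t i \<tau> *\<^sub>R V i \<tau> (en k) (y $ i))"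
    for y :: "'e ^ 'k" and t :: "('e ^ 'k) ^ (('e ^ 'k) basis_index \<times> bool)"
  define G where "G y t = (\<chi> k. \<chi> i. ad_iter (Y i) (\<eta> i) (en k) (y $ i)) + B y t" for y t
  have sH: "smooth_on (S i) (H i \<tau>)" for i \<tau> unfolding H_def by (intro smooth_on_monomial_field S \<beta>)
  have sV: "smooth_on (S i) (V i \<tau> k)" for i \<tau> k unfolding V_def by (intro smooth_on_ad_iter S Y sH)
  have conv: "(\<Sum>(j, e)\<in>UNIV \<times> Basis. (t $ j $ i \<bullet> e) *\<^sub>R monomial_field (\<beta> i) (b i) (en j) e x) = (\<Sum>\<tau>\<in>T. a t i \<tau> *\<^sub>R H i \<tau> x)" for t i x
    by (simp add: T_def a_def H_def split_beta)
  have Beq: "B y t $ k $ i = ad_iter (Y i) (\<lambda>x. 0 + (\<Sum>\<tau>\<in>T. a t i \<tau> *\<^sub>R H i \<tau> x)) (en k) (y $ i)" if "y \<in> Q" for y t k i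
  proof -
    have "ad_iter (Y i) (\<lambda>x. 0 + (\<Sum>\<tau>\<in>T. a t i \<tau> *\<^sub>R H i \<tau> x)) (en k) (y $ i)
      = ad_iter (Y i) (\<lambda>x. 0) (en k) (y $ i) + (\<Sum>\<tau>\<in>T. a t i \<tau> *\<^sub>R ad_iter (Y i) (H i \<tau>) (en k) (y $ i))"
      by (rule ad_iter_add_sum[OF S Y smooth_on_const QS[OF that] sH])
    then show ?thesis by (simp add: B_def V_def ad_iter_zero[OF S Y QS[OF that]])
  qed
  have Geq: "G y t $ k $ i = ad_iter (Y i) (\<lambda>x. \<eta> i x + (\<Sum>\<tau>\<in>T. a t i \<tau> *\<^sub>R H i \<tau> x)) (en k) (y $ i)" if "y \<in> Q" for y t k i
  proof -
    have "ad_iter (Y i) (\<lambda>x. \<eta> i x + (\<Sum>\<tau>\<in>T. a t i \<tau> *\<^sub>R H i \<tau> x)) (en k) (y $ i)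
      = ad_iter (Y i) (\<eta> i) (en k) (y $ i) + (\<Sum>\<tau>\<in>T. a t i \<tau> *\<^sub>R ad_iter (Y i) (H i \<tau>) (en k) (y $ i))"
      by (rule ad_iter_add_sum[OF S Y \<eta> QS[OF that] sH])
    then show ?thesis by (simp add: G_def B_def V_def)
  qed
  have Gdiff: "G y t - G y t' = B y (t - t')" for y t t'
    by (simp add: G_def B_def a_def vec_eq_iff inner_diff_left scaleR_left_diff_distrib sum_subtractf)
  have Bscale: "B y (c *\<^sub>R t) = c *\<^sub>R B y t" for y c t
    by (simp add: B_def a_def vec_eq_iff scaleR_sum_right)
  have Binj: "t = 0" if y: "y \<in> Q" and z: "B y t = 0" for y t
  proof -
    have "t $ inv en n $ i = 0" if n: "n \<le> m" for n i
    proof (rule ad_iter_polynomial_inject[OF S QS[OF y] Y Yb[OF y] \<beta> \<beta>0[OF y] _ n])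
      fix k assume "k \<le> m"
      then obtain q where q: "k = en q" using en unfolding bij_betw_def by (metis atMost_iff imageE)
      show "ad_iter (Y i) (\<lambda>x. \<beta> i x *\<^sub>R (\<Sum>j\<le>m. (x \<bullet> b i) ^ j *\<^sub>R t $ inv en j $ i)) k (y $ i) = 0"
        using Beq[OF y, of t q i] z sum_monomial_field[OF en, of "\<lambda>j. t $ j $ i" "\<beta> i" "b i"]
        by (simp add: conv[symmetric] q)
    qed
    moreover have "inv en (en q) = q" "en q \<le> m" for q using en by (auto simp: bij_betw_def)
    ultimately have "t $ q $ i = 0" for q i by metis
    then show ?thesis by (simp add: vec_eq_iff)
  qed
  have cB: "continuous_on (Q \<times> UNIV) (\<lambda>p. B (fst p) (snd p))"
  proof -
    have "continuous_on (Q \<times> UNIV) (\<lambda>p. V i \<tau> k (fst p $ i))" for i \<tau> k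
      by (rule continuous_on_compose2[OF smooth_on_continuous_on[OF sV]])
        (auto intro!: continuous_intros QS)
    then show ?thesis unfolding B_def a_def by (intro continuous_intros)
  qed
  \<comment> \<open>C is the reciprocal of the least norm of B on the product of Q with the unit
    sphere, positive by injectivity; homogeneity in t extends the estimate to all t.\<close>
  obtain C where C: "C \<ge> 0" "\<And>y t. y \<in> Q \<Longrightarrow> norm t \<le> C * norm (B y t)"
  proof (cases "Q = {}")
    case True then show ?thesis using that[of 0] by simp
  next
    case False
    let ?K = "Q \<times> sphere (0 :: ('e ^ 'k) ^ (('e ^ 'k) basis_index \<times> bool)) 1"
    obtain e :: "('e ^ 'k) ^ (('e ^ 'k) basis_index \<times> bool)" where e: "e \<in> Basis" using nonempty_Basis by blast
    then have "e \<in> sphere 0 1" by simp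
    then have ne: "?K \<noteq> {}" using False by blast
    have "continuous_on ?K (\<lambda>p. norm (B (fst p) (snd p)))"
      by (intro continuous_on_norm continuous_on_subset[OF cB]) auto
    from continuous_attains_inf[OF compact_Times[OF Q compact_sphere] ne this]
    obtain q where q: "q \<in> ?K" "\<And>z. z \<in> ?K \<Longrightarrow> norm (B (fst q) (snd q)) \<le> norm (B (fst z) (snd z))" by blast
    define \<mu> where "\<mu> = norm (B (fst q) (snd q))"
    have "snd q \<noteq> 0" "fst q \<in> Q" using q(1) by (auto simp: mem_Times_iff)
    then have \<mu>: "\<mu> > 0" using Binj[of "fst q" "snd q"] by (auto simp: \<mu>_def)
    show ?thesis
    proof (rule that[of "1 / \<mu>"])
      fix y t assume y: "y \<in> Q"
      show "norm t \<le> 1 / \<mu> * norm (B y t)"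
      proof (cases "t = 0")
        case False
        have "\<mu> \<le> norm (B y (t /\<^sub>R norm t))" using q(2)[of "(y, t /\<^sub>R norm t)"] y False by (simp add: \<mu>_def)
        also have "\<dots> = norm (B y t) / norm t" by (simp add: Bscale divide_inverse)
        finally show ?thesis using \<mu> False by (simp add: field_simps)
      qed (use \<mu> in simp)
    qed (use \<mu> in simp)
  qed
  have neg: "negligible {t. \<exists>y\<in>Q. \<not> nondegenerate (\<lambda>k. G y t $ k) UNIV}"
  proof (rule negligible_degenerate_parameters[OF _ C(1)])
    show "norm (t - t') \<le> C * norm (G y t - G y t')" if "y \<in> Q" for y t t'
      unfolding Gdiff by (rule C(2)[OF that])
    fix y t assume y: "y \<in> Q"
    let ?U = "{y :: 'e ^ 'k. \<forall>i. y $ i \<in> S i}"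
    have o: "open ?U" by (rule open_vector_box) (use S in blast)
    have comp: "smooth_on ?U (\<lambda>y. f (y $ i))" if "smooth_on (S i) f" for f :: "'e \<Rightarrow> 'e" and i
      by (rule smooth_on_compose[OF o S _ that smooth_on_nth]) auto
    have "smooth_on ?U (\<lambda>y. ad_iter (Y i) (\<eta> i) k (y $ i))" "smooth_on ?U (\<lambda>y. V i \<tau> k (y $ i))" for i \<tau> k
      by (rule comp[OF smooth_on_ad_iter[OF S Y \<eta>]], rule comp[OF sV])
    then have "smooth_on ?U (\<lambda>y. G y t)"
      unfolding G_def B_def
      by (intro smooth_on_add smooth_on_vec_lambda smooth_on_sum smooth_on_scaleR smooth_on_const o)
    then show "(\<lambda>y. G y t) differentiable (at y)" by (rule smooth_on_differentiable) (use QS[OF y] in simp)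
  qed
  from ball_not_subset_negligible[OF neg \<epsilon>, of 0]
  obtain t :: "('e ^ 'k) ^ (('e ^ 'k) basis_index \<times> bool)" where
    t: "t \<in> ball 0 \<epsilon>" "\<And>y. y \<in> Q \<Longrightarrow> nondegenerate (\<lambda>k. G y t $ k) UNIV"
    by blast
  have "nondegenerate
    (\<lambda>n. \<chi> i. ad_iter (Y i) (\<lambda>x. \<eta> i x + (\<Sum>(j, e)\<in>UNIV \<times> Basis. (t $ j $ i \<bullet> e) *\<^sub>R monomial_field (\<beta> i) (b i) (en j) e x)) n (y $ i)) {..m}"
    (is "nondegenerate ?w _") if y: "y \<in> Q" for y
  proof -
    have "G y t $ k = ?w (en k)" for k using Geq[OF y] by (simp add: vec_eq_iff conv)
    then have "nondegenerate (\<lambda>k. ?w (en k)) UNIV" using t(2)[OF y] by simp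
    moreover have "en k \<in> {..m}" for k using en by (auto simp: bij_betw_def)
    ultimately show ?thesis unfolding nondegenerate_def by blast
  qed
  then show ?thesis using t(1) by (intro exI[of _ t]) auto
qed

text \<open>The pair (v0, v1) that creates a common zero at y is determined by y, after division by
  \<beta> y. Such pairs form the differentiable image of a subset of an n-dimensional space in one
  of dimension 2n, hence a null set.\<close>

lemma nonvanishing_parameters:
  fixes \<xi>0 \<xi>1 :: "'e::euclidean_space \<Rightarrow> 'e"
  assumes S: "K \<subseteq> S" and sm: "smooth_on S \<xi>0" "smooth_on S \<xi>1" "smooth_on S \<beta>"
    and \<beta>: "\<And>y. y \<in> K \<Longrightarrow> \<beta> y \<noteq> (0::real)" and \<epsilon>: "\<epsilon> > 0"
  shows "\<exists>v0 v1. norm v0 < \<epsilon> \<and> norm v1 < \<epsilon> \<and> (\<forall>y\<in>K. \<xi>0 y + \<beta> y *\<^sub>R v0 \<noteq> 0 \<or> \<xi>1 y + \<beta> y *\<^sub>R v1 \<noteq> 0)"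
proof -
  let ?f = "\<lambda>y. (- (inverse (\<beta> y) *\<^sub>R \<xi>0 y), - (inverse (\<beta> y) *\<^sub>R \<xi>1 y))"
  have "?f differentiable (at y within K)" if y: "y \<in> K" for y
  proof (rule differentiable_at_withinI)
    have yS: "y \<in> S" using S y by blast
    note D = smooth_on_has_derivative[OF sm(3) yS] smooth_on_has_derivative[OF sm(1) yS] smooth_on_has_derivative[OF sm(2) yS]
    note i = Deriv.has_derivative_inverse[OF \<beta>[OF y] D(1)]
    show "?f differentiable (at y)" unfolding differentiable_def
      by (rule exI) (rule has_derivative_Pair[OF has_derivative_minus[OF has_derivative_scaleR[OF i D(2)]]
        has_derivative_minus[OF has_derivative_scaleR[OF i D(3)]]])
  qed
  then have "?f differentiable_on K" unfolding differentiable_on_def by (rule ballI)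
  then have neg: "negligible (?f ` K)" by (intro negligible_differentiable_image_lowdim) auto
  from ball_not_subset_negligible[OF neg \<epsilon>, of 0]
  obtain v where v: "v \<in> ball 0 \<epsilon>" "v \<notin> ?f ` K" by blast
  have "norm (fst v) < \<epsilon>" "norm (snd v) < \<epsilon>"
    using v(1) norm_fst_le[of "fst v" "snd v"] norm_snd_le[of "snd v" "fst v"] by auto
  moreover have "\<xi>0 y + \<beta> y *\<^sub>R fst v \<noteq> 0 \<or> \<xi>1 y + \<beta> y *\<^sub>R snd v \<noteq> 0" if y: "y \<in> K" for y
  proof (rule ccontr)
    assume "\<not> ?thesis"
    then have "\<xi>0 y = - (\<beta> y *\<^sub>R fst v)" "\<xi>1 y = - (\<beta> y *\<^sub>R snd v)" by (simp_all add: eq_neg_iff_add_eq_0)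
    then have "v = ?f y" using \<beta>[OF y] by (simp add: prod_eq_iff)
    then show False using v(2) y by blast
  qed
  ultimately show ?thesis by blast
qed

subsection \<open>Small perturbations in the Whitney topology\<close>

lemma iter_deriv_add_scaled:
  assumes S: "open S" and sm: "smooth_on S f" "smooth_on S g"
  shows "y \<in> S \<Longrightarrow> iter_deriv vs (\<lambda>y. f y + a *\<^sub>R g y) y = iter_deriv vs f y + a *\<^sub>R iter_deriv vs g y"
proof (induction vs arbitrary: y)
  case (Cons v vs)
  have "frechet_derivative (iter_deriv vs (\<lambda>y. f y + a *\<^sub>R g y)) (at y)
    = frechet_derivative (\<lambda>y. iter_deriv vs f y + a *\<^sub>R iter_deriv vs g y) (at y)"
    by (rule frechet_derivative_transform_open[OF S Cons.prems Cons.IH])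
  then show ?case
    by (simp add: frechet_derivative_add_scaled smooth_on_differentiable[OF smooth_on_iter_deriv[OF sm(1)] Cons.prems]
        smooth_on_differentiable[OF smooth_on_iter_deriv[OF sm(2)] Cons.prems])
qed simp

lemma iter_deriv_add_sum:
  assumes S: "open S" and f: "smooth_on S f" and y: "y \<in> S"
  shows "(\<And>t. t \<in> T \<Longrightarrow> smooth_on S (h t)) \<Longrightarrow>
    iter_deriv vs (\<lambda>y. f y + (\<Sum>t\<in>T. a t *\<^sub>R h t y)) y = iter_deriv vs f y + (\<Sum>t\<in>T. a t *\<^sub>R iter_deriv vs (h t) y)"
proof (induction T rule: infinite_finite_induct)
  case (insert t T)
  have "iter_deriv vs (\<lambda>y. (f y + (\<Sum>t\<in>T. a t *\<^sub>R h t y)) + a t *\<^sub>R h t y) y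
    = iter_deriv vs (\<lambda>y. f y + (\<Sum>t\<in>T. a t *\<^sub>R h t y)) y + a t *\<^sub>R iter_deriv vs (h t) y"
    using insert.prems by (intro iter_deriv_add_scaled[OF S _ _ y] smooth_on_add smooth_on_sum smooth_on_scaleR S f smooth_on_const) auto
  then show ?case using insert by (simp add: add_ac)
qed simp_all

definition perturb :: "('m \<Rightarrow> 'm tangent) \<Rightarrow> 't set \<Rightarrow> ('t \<Rightarrow> 'm \<Rightarrow> 'm tangent) \<Rightarrow> ('t \<Rightarrow> real) \<Rightarrow> 'm \<Rightarrow> 'm tangent" where
  "perturb X T h a = (\<lambda>p f. X p f + (\<Sum>t\<in>T. a t * h t p f))"

text \<open>On a noncompact manifold a small multiple of a field need not be small in the Whitney
  topology. Here the perturbation lives in the compact C, which meets the chart domains of only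
  finitely many members of a locally finite family. One \<delta> serves these, and in the other
  charts the coordinate expression does not change.\<close>

lemma perturb_in_whitney_nbhd:
  fixes A :: "('m::t2_space, 'e::euclidean_space) chart set"
  assumes A: "smooth_atlas A" and F: "whitney_family A \<F>" and X0: "X0 \<in> vector_fields A"
    and X: "X \<in> whitney_nbhd A l \<F> X0" and T: "finite T"
    and h: "\<And>t. t \<in> T \<Longrightarrow> h t \<in> vector_fields A" and C: "compact C" "C \<subseteq> carrier_of A"
    and hC: "\<And>t p. t \<in> T \<Longrightarrow> p \<notin> C \<Longrightarrow> h t p = (\<lambda>f. 0)"
  shows "\<forall>\<^sub>F \<delta> in at_right 0. \<forall>a. (\<forall>t\<in>T. \<bar>a t\<bar> < \<delta>) \<longrightarrow> perturb X T h a \<in> whitney_nbhd A l \<F> X0"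
proof -
  have Xv: "X \<in> vector_fields A" using X by (simp add: whitney_nbhd_def)
  define \<F>' where "\<F>' = {t\<in>\<F>. fst (fst t) \<inter> C \<noteq> {}}"
  define L where "L = {vs :: 'e list. set vs \<subseteq> Basis \<and> length vs \<le> l}"
  have finL: "finite L" unfolding L_def by (rule finite_Basis_lists)
  have fin: "finite \<F>'"
  proof -
    have "\<forall>p\<in>C. \<exists>W. open W \<and> p \<in> W \<and> finite {t\<in>\<F>. fst (fst t) \<inter> W \<noteq> {}}"
      using F C(2) unfolding whitney_family_def by blast
    then obtain W where W: "\<And>p. p \<in> C \<Longrightarrow> open (W p) \<and> p \<in> W p \<and> finite {t\<in>\<F>. fst (fst t) \<inter> W p \<noteq> {}}"
      using bchoice[of C "\<lambda>p W. open W \<and> p \<in> W \<and> finite {t\<in>\<F>. fst (fst t) \<inter> W \<noteq> {}}"] by blast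
    obtain D where D: "D \<subseteq> C" "finite D" "C \<subseteq> (\<Union>p\<in>D. W p)"
      using compactE_image[OF C(1), of C W] W by blast
    have "\<F>' \<subseteq> (\<Union>p\<in>D. {t\<in>\<F>. fst (fst t) \<inter> W p \<noteq> {}})" using D(3) unfolding \<F>'_def by blast
    moreover have "finite (\<Union>p\<in>D. {t\<in>\<F>. fst (fst t) \<inter> W p \<noteq> {}})"
      using D W by (intro finite_UN_I) (auto dest: subsetD)
    ultimately show ?thesis by (rule finite_subset)
  qed
  have F': "c \<in> maximal_atlas A" "compact K" "K \<subseteq> fst c" if "(c, K, \<epsilon>) \<in> \<F>" for c K \<epsilon>
    using F that unfolding whitney_family_def by fastforce+
  have close: "norm (iter_deriv vs (chart_rep c X) y - iter_deriv vs (chart_rep c X0) y) < \<epsilon>"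
    if "(c, K, \<epsilon>) \<in> \<F>" "vs \<in> L" "y \<in> snd c ` K" for c K \<epsilon> vs y
    using X that unfolding whitney_nbhd_def L_def by fastforce
  have rep: "chart_rep c (perturb X T h a) = (\<lambda>y. chart_rep c X y + (\<Sum>t\<in>T. a t *\<^sub>R chart_rep c (h t) y))" for c a
    unfolding perturb_def by (rule ext) (rule chart_rep_add_sum)
  have main: "\<forall>\<^sub>F \<delta> in at_right 0. \<forall>a. (\<forall>t\<in>T. \<bar>a t\<bar> < \<delta>) \<longrightarrow> (\<forall>y\<in>snd (fst q) ` fst (snd q).
      norm (iter_deriv vs (chart_rep (fst q) (perturb X T h a)) y - iter_deriv vs (chart_rep (fst q) X0) y) < snd (snd q))"
    if q: "q \<in> \<F>'" and vs: "vs \<in> L" for q vs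
  proof -
    obtain c K \<epsilon> where qe: "q = (c, K, \<epsilon>)" by (cases q) auto
    have qF: "(c, K, \<epsilon>) \<in> \<F>" using q qe by (simp add: \<F>'_def)
    note c = F'[OF qF] and cc = maximal_atlasD(1)[OF F'(1)[OF qF]]
    let ?S = "snd c ` fst c" and ?K = "snd c ` K"
    have oS: "open ?S" by (rule is_chartD(2)[OF cc])
    have KS: "?K \<subseteq> ?S" using c(3) by blast
    have cK: "compact ?K"
      by (rule compact_continuous_image[OF continuous_on_subset[OF is_chartD(3)[OF cc] c(3)] c(2)])
    have sm: "smooth_on ?S (chart_rep c X)" "smooth_on ?S (chart_rep c X0)" "\<And>t. t \<in> T \<Longrightarrow> smooth_on ?S (chart_rep c (h t))"
      using smooth_on_chart_rep[OF A c(1)] Xv X0 h by auto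
    have cont: "continuous_on ?K (iter_deriv vs f)" if "smooth_on ?S f" for f :: "'e \<Rightarrow> 'e"
      by (rule continuous_on_subset[OF smooth_on_continuous_on[OF smooth_on_iter_deriv[OF that]] KS])
    \<comment> \<open>The bound satisfied by X is strict and \<open>?K\<close> is compact, so a
      margin \<mu> is left for the perturbation.\<close>
    obtain \<mu> where \<mu>: "\<mu> > 0" "\<And>y. y \<in> ?K \<Longrightarrow> norm (iter_deriv vs (chart_rep c X) y - iter_deriv vs (chart_rep c X0) y) + \<mu> \<le> \<epsilon>"
    proof (cases "?K = {}")
      case True then show ?thesis using that[of 1] by simp
    next
      case False
      have "continuous_on ?K (\<lambda>y. norm (iter_deriv vs (chart_rep c X) y - iter_deriv vs (chart_rep c X0) y))"
        by (intro continuous_intros cont sm)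
      from continuous_attains_sup[OF cK False this] obtain z where z: "z \<in> ?K"
        "\<And>y. y \<in> ?K \<Longrightarrow> norm (iter_deriv vs (chart_rep c X) y - iter_deriv vs (chart_rep c X0) y)
          \<le> norm (iter_deriv vs (chart_rep c X) z - iter_deriv vs (chart_rep c X0) z)" by blast
      show ?thesis
        by (rule that[of "\<epsilon> - norm (iter_deriv vs (chart_rep c X) z - iter_deriv vs (chart_rep c X0) z)"])
          (use close[OF qF vs z(1)] z(2) in auto)
    qed
    have "\<exists>R. \<forall>t\<in>T. \<forall>y\<in>?K. norm (iter_deriv vs (chart_rep c (h t)) y) \<le> R"
    proof -
      have "bounded (\<Union>t\<in>T. iter_deriv vs (chart_rep c (h t)) ` ?K)"
        using T by (intro bounded_UN) (auto intro!: compact_imp_bounded compact_continuous_image cont sm cK)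
      then show ?thesis unfolding bounded_iff by blast
    qed
    then obtain R0 where R0: "\<And>t y. t \<in> T \<Longrightarrow> y \<in> ?K \<Longrightarrow> norm (iter_deriv vs (chart_rep c (h t)) y) \<le> R0" by blast
    define R where "R = max R0 1"
    have R: "R > 0" "\<And>t y. t \<in> T \<Longrightarrow> y \<in> ?K \<Longrightarrow> norm (iter_deriv vs (chart_rep c (h t)) y) \<le> R"
      using R0 by (auto simp: R_def intro: max.coboundedI1)
    \<comment> \<open>The 1 keeps the total change strictly below the margin, as the strict bound in
      \<open>whitney_nbhd\<close> requires.\<close>
    define \<delta>0 where "\<delta>0 = \<mu> / ((real (card T) + 1) * R)"
    have \<delta>0: "\<delta>0 > 0" using \<mu> R by (simp add: \<delta>0_def)
    have bound: "norm (iter_deriv vs (chart_rep c (perturb X T h a)) y - iter_deriv vs (chart_rep c X0) y) < \<epsilon>"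
      if a: "\<forall>t\<in>T. \<bar>a t\<bar> < \<delta>" and \<delta>: "0 < \<delta>" "\<delta> < \<delta>0" and y: "y \<in> ?K" for a \<delta> y
    proof -
      have yS: "y \<in> ?S" using y KS by blast
      have "norm (\<Sum>t\<in>T. a t *\<^sub>R iter_deriv vs (chart_rep c (h t)) y) \<le> (\<Sum>t\<in>T. \<delta>0 * R)"
      proof (rule sum_norm_le)
        fix t assume t: "t \<in> T"
        have "\<bar>a t\<bar> \<le> \<delta>0" using a t \<delta> by fastforce
        then show "norm (a t *\<^sub>R iter_deriv vs (chart_rep c (h t)) y) \<le> \<delta>0 * R"
          using R(2)[OF t y] \<delta>0 by (auto intro!: mult_mono)
      qed
      also have "\<dots> = real (card T) * \<mu> / (real (card T) + 1)"
      proof -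
        have "\<delta>0 * R = \<mu> / (real (card T) + 1)" using R(1) by (simp add: \<delta>0_def)
        then show ?thesis by simp
      qed
      also have "\<dots> < \<mu>" using \<mu>(1) by (simp add: field_simps)
      finally have s: "norm (\<Sum>t\<in>T. a t *\<^sub>R iter_deriv vs (chart_rep c (h t)) y) < \<mu>" .
      have "iter_deriv vs (chart_rep c (perturb X T h a)) y - iter_deriv vs (chart_rep c X0) y
        = (iter_deriv vs (chart_rep c X) y - iter_deriv vs (chart_rep c X0) y) + (\<Sum>t\<in>T. a t *\<^sub>R iter_deriv vs (chart_rep c (h t)) y)"
      proof -
        have "iter_deriv vs (\<lambda>y. chart_rep c X y + (\<Sum>t\<in>T. a t *\<^sub>R chart_rep c (h t) y)) y
          = iter_deriv vs (chart_rep c X) y + (\<Sum>t\<in>T. a t *\<^sub>R iter_deriv vs (chart_rep c (h t)) y)"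
          by (rule iter_deriv_add_sum[OF oS sm(1) yS sm(3)])
        then show ?thesis by (simp add: rep)
      qed
      then show ?thesis using \<mu>(2)[OF y] s norm_triangle_ineq by (smt (verit))
    qed
    show ?thesis unfolding qe fst_conv snd_conv eventually_at_right_field
      using bound \<delta>0 by (intro exI[of _ \<delta>0]) blast
  qed
  have "\<forall>\<^sub>F \<delta> in at_right 0. \<forall>q\<in>\<F>'. \<forall>vs\<in>L. \<forall>a. (\<forall>t\<in>T. \<bar>a t\<bar> < \<delta>) \<longrightarrow> (\<forall>y\<in>snd (fst q) ` fst (snd q).
      norm (iter_deriv vs (chart_rep (fst q) (perturb X T h a)) y - iter_deriv vs (chart_rep (fst q) X0) y) < snd (snd q))"
    by (intro eventually_ball_finite fin finL ballI main)
  then show ?thesis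
  proof (rule eventually_mono, intro allI impI)
    fix \<delta> a assume all: "\<forall>q\<in>\<F>'. \<forall>vs\<in>L. \<forall>a. (\<forall>t\<in>T. \<bar>a t\<bar> < \<delta>) \<longrightarrow> (\<forall>y\<in>snd (fst q) ` fst (snd q).
      norm (iter_deriv vs (chart_rep (fst q) (perturb X T h a)) y - iter_deriv vs (chart_rep (fst q) X0) y) < snd (snd q))"
      and a: "\<forall>t\<in>T. \<bar>a t\<bar> < \<delta>"
    have "norm (iter_deriv vs (chart_rep c (perturb X T h a)) y - iter_deriv vs (chart_rep c X0) y) < \<epsilon>"
      if q: "(c, K, \<epsilon>) \<in> \<F>" and vs: "vs \<in> L" and y: "y \<in> snd c ` K" for c K \<epsilon> vs y
    proof (cases "(c, K, \<epsilon>) \<in> \<F>'")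
      case True then show ?thesis using all vs a y by fastforce
    next
      case False
      then have dis: "fst c \<inter> C = {}" using q by (auto simp: \<F>'_def)
      note cc = maximal_atlasD(1)[OF F'(1)[OF q]]
      have "iter_deriv vs (chart_rep c (perturb X T h a)) y = iter_deriv vs (chart_rep c X) y"
      proof (rule iter_deriv_cong_open[OF is_chartD(2)[OF cc]])
        fix z assume "z \<in> snd c ` fst c"
        from chart_inv_in[OF this] have "chart_inv c z \<notin> C" using dis by blast
        then have "chart_rep c (h t) z = 0" if "t \<in> T" for t using hC[OF that] by (simp add: chart_rep_def)
        then show "chart_rep c (perturb X T h a) z = chart_rep c X z" by (simp add: rep)
      qed (use F'(3)[OF q] y in blast)
      then show ?thesis using close[OF q vs y] by simp
    qed
    moreover have "perturb X T h a \<in> vector_fields A"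
      unfolding perturb_def by (intro vector_fields_add_sum A Xv h)
    ultimately show "perturb X T h a \<in> whitney_nbhd A l \<F> X0"
      unfolding whitney_nbhd_def L_def by fastforce
  qed
qed

text \<open>Among the operations that generate the topology, only intersections of two sets shrink
  \<delta>, and the filter \<open>at_right 0\<close> absorbs this.\<close>

lemma perturb_in_whitney_open:
  fixes A :: "('m::t2_space, 'e::euclidean_space) chart set"
  assumes A: "smooth_atlas A" and U: "openin (whitney_topology A l) U" and X: "X \<in> U" and T: "finite T"
    and h: "\<And>t. t \<in> T \<Longrightarrow> h t \<in> vector_fields A" and C: "compact C" "C \<subseteq> carrier_of A"
    and hC: "\<And>t p. t \<in> T \<Longrightarrow> p \<notin> C \<Longrightarrow> h t p = (\<lambda>f. 0)"
  shows "\<forall>\<^sub>F \<delta> in at_right 0. \<forall>a. (\<forall>t\<in>T. \<bar>a t\<bar> < \<delta>) \<longrightarrow> perturb X T h a \<in> U"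
proof -
  have "generate_topology_on {whitney_nbhd A l \<F> X | \<F> X. whitney_family A \<F> \<and> X \<in> vector_fields A} U"
    using U unfolding whitney_topology_def by (rule openin_topology_generated_by)
  then show ?thesis using X
  proof (induction rule: generate_topology_on.induct)
    case Empty then show ?case by simp
  next
    case (Int O1 O2)
    then have "\<forall>\<^sub>F \<delta> in at_right 0. \<forall>a. (\<forall>t\<in>T. \<bar>a t\<bar> < \<delta>) \<longrightarrow> perturb X T h a \<in> O1"
      "\<forall>\<^sub>F \<delta> in at_right 0. \<forall>a. (\<forall>t\<in>T. \<bar>a t\<bar> < \<delta>) \<longrightarrow> perturb X T h a \<in> O2" by auto
    then show ?case by eventually_elim blast
  next
    case (UN K)
    then obtain k where k: "k \<in> K" "X \<in> k" by blast
    from UN.IH[OF this] show ?case by (rule eventually_mono) (use k in blast)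
  next
    case (Basis O1)
    then obtain \<F> X0 where b: "O1 = whitney_nbhd A l \<F> X0" "whitney_family A \<F>" "X0 \<in> vector_fields A" by blast
    show ?case unfolding b(1)
      by (rule perturb_in_whitney_nbhd[OF A b(2,3) _ T _ C]) (use Basis.prems b h hC in auto)
  qed
qed

subsection \<open>Pairs of vector fields on a box of the configuration space\<close>

lemma norm_vec_lambda_le: "norm (\<chi> i. w i :: 'e::euclidean_space ^ 'k::finite) \<le> (\<Sum>i\<in>UNIV. norm (w i))"
  unfolding norm_vec_def using L2_set_le_sum[of UNIV "\<lambda>i. norm (w i)"] by simp

lemma jet_le_add_scaled:
  assumes S: "open S" "K \<subseteq> S" and sm: "smooth_on S f" "smooth_on S g" and j: "jet_le p K f r" "jet_le p K g s"
  shows "jet_le p K (\<lambda>y. f y + a *\<^sub>R g y) (r + \<bar>a\<bar> * s)"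
  unfolding jet_le_def
proof (intro allI impI ballI)
  fix vs :: "'a list" and y assume *: "set vs \<subseteq> Basis \<and> length vs \<le> p" "y \<in> K"
  have "norm (iter_deriv vs f y) \<le> r" "norm (iter_deriv vs g y) \<le> s"
    using j * unfolding jet_le_def by auto
  then have "norm (iter_deriv vs f y + a *\<^sub>R iter_deriv vs g y) \<le> r + \<bar>a\<bar> * s"
    by (intro norm_triangle_mono) (auto intro: mult_left_mono)
  moreover have "y \<in> S" using * S by blast
  ultimately show "norm (iter_deriv vs (\<lambda>y. f y + a *\<^sub>R g y) y) \<le> r + \<bar>a\<bar> * s"
    by (simp add: iter_deriv_add_scaled[OF S(1) sm])
qed

text \<open>Genericity is asked on the balls of radius r, and perturbations are supported in the
  balls of radius 2r, so that the bump functions do not vanish on the former. Since the larger balls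
  correspond to disjoint sets of the manifold, a field can be changed near each point independently
  of the others.\<close>

locale chart_box = chart_family A c
  for A :: "('m::t2_space, 'e::euclidean_space) chart set" and c :: "'k::finite \<Rightarrow> ('m, 'e) chart" +
  fixes x :: "'k \<Rightarrow> 'e" and r :: "'k \<Rightarrow> real"
  assumes r_pos: "r i > 0"
    and cball_sub: "cball (x i) (2 * r i) \<subseteq> snd (c i) ` fst (c i)"
    and disj: "i \<noteq> j \<Longrightarrow> chart_inv (c i) ` cball (x i) (2 * r i) \<inter> chart_inv (c j) ` cball (x j) (2 * r j) = {}"
begin

abbreviation "S i \<equiv> snd (c i) ` fst (c i)"
abbreviation "K i \<equiv> cball (x i) (r i)"
abbreviation "\<rho> i X \<equiv> chart_rep (c i) X"

definition box :: "('e ^ 'k) set" where "box = {y. \<forall>i. y $ i \<in> K i}"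

text \<open>In the product chart, this is the value at y of the n-th iterated bracket of the N-fold
  of Y = X0 + a X1 with the N-fold of X1.\<close>

definition ad_vector :: "nat \<Rightarrow> nat \<Rightarrow> ('m \<Rightarrow> 'm tangent) \<Rightarrow> ('m \<Rightarrow> 'm tangent) \<Rightarrow> 'e ^ 'k \<Rightarrow> 'e ^ 'k" where
  "ad_vector a n X0 X1 y = (\<chi> i. ad_iter (\<lambda>z. \<rho> i X0 z + real a *\<^sub>R \<rho> i X1 z) (\<rho> i X1) n (y $ i))"

definition good :: "('e ^ 'k) set \<Rightarrow> (nat \<times> nat) set \<Rightarrow> ('m \<Rightarrow> 'm tangent) \<Rightarrow> ('m \<Rightarrow> 'm tangent) \<Rightarrow> bool" where
  "good \<kappa> I X0 X1 \<longleftrightarrow> (\<forall>y\<in>\<kappa>. nondegenerate (\<lambda>q. ad_vector (fst q) (snd q) X0 X1 y) I)"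

text \<open>The vector b i picks a coordinate in which Y does not vanish near the i-th point. It
  becomes the variable of the perturbing polynomials there.\<close>

definition transversal :: "('e ^ 'k) set \<Rightarrow> nat \<Rightarrow> ('k \<Rightarrow> 'e) \<Rightarrow> ('m \<Rightarrow> 'm tangent) \<Rightarrow> ('m \<Rightarrow> 'm tangent) \<Rightarrow> bool" where
  "transversal \<kappa> a b X0 X1 \<longleftrightarrow> (\<forall>y\<in>\<kappa>. \<forall>i. (\<rho> i X0 (y $ i) + real a *\<^sub>R \<rho> i X1 (y $ i)) \<bullet> b i \<noteq> 0)"

definition jet_close :: "nat \<Rightarrow> real \<Rightarrow> ('m \<Rightarrow> 'm tangent) \<Rightarrow> ('m \<Rightarrow> 'm tangent) \<Rightarrow> bool" where
  "jet_close l \<delta> X Y \<longleftrightarrow> (\<forall>i. jet_le l (K i) (\<lambda>z. \<rho> i Y z - \<rho> i X z) \<delta>)"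

lemma open_S: "open (S i)" by (rule is_chartD(2)[OF ci])

lemma K_sub: "K i \<subseteq> S i"
proof -
  have "K i \<subseteq> cball (x i) (2 * r i)" using r_pos[of i] by (intro subset_cball) simp
  then show ?thesis using cball_sub by blast
qed

lemma smooth_rho: "X \<in> vector_fields A \<Longrightarrow> smooth_on (S i) (\<rho> i X)"
  by (rule smooth_on_chart_rep[OF A cm])

lemma compact_box: "compact box"
proof -
  have "closed box" unfolding box_def by (rule closed_vector_box) simp
  moreover have "bounded box"
  proof -
    have "norm y \<le> (\<Sum>i\<in>UNIV. norm (x i) + r i)" if "y \<in> box" for y
    proof -
      have "norm y \<le> (\<Sum>i\<in>UNIV. norm (y $ i))" using norm_vec_lambda_le[of "\<lambda>i. y $ i"] by simp
      also have "\<dots> \<le> (\<Sum>i\<in>UNIV. norm (x i) + r i)"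
      proof (rule sum_mono)
        fix i
        have "norm (x i - y $ i) \<le> r i" using that by (simp add: box_def dist_norm)
        then show "norm (y $ i) \<le> norm (x i) + r i" using norm_triangle_sub[of "y $ i" "x i"] by (simp add: norm_minus_commute)
      qed
      finally show ?thesis .
    qed
    then show ?thesis by (auto simp: bounded_iff)
  qed
  ultimately show ?thesis by (simp add: compact_eq_bounded_closed)
qed

lemma jet_close_whitney_nbhd:
  assumes X: "X \<in> vector_fields A"
    and Y: "Y \<in> whitney_nbhd A l (range (\<lambda>i. (c i, chart_inv (c i) ` K i, \<delta>))) X"
  shows "jet_close l \<delta> X Y"
  unfolding jet_close_def jet_le_def
proof (intro allI impI ballI)
  fix i vs y assume vs: "set vs \<subseteq> (Basis :: 'e set) \<and> length vs \<le> l" and y: "y \<in> K i"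
  have Yv: "Y \<in> vector_fields A" using Y by (simp add: whitney_nbhd_def)
  have yS: "y \<in> S i" using y K_sub by blast
  then have "y \<in> snd (c i) ` chart_inv (c i) ` K i" using y chart_inv_right by (metis image_eqI)
  then have "norm (iter_deriv vs (\<rho> i Y) y - iter_deriv vs (\<rho> i X) y) < \<delta>"
    using Y vs unfolding whitney_nbhd_def by fastforce
  then show "norm (iter_deriv vs (\<lambda>z. \<rho> i Y z - \<rho> i X z) y) \<le> \<delta>"
    using iter_deriv_add_scaled[OF open_S smooth_rho[OF Yv] smooth_rho[OF X] yS, of vs "-1"] by simp
qed

lemma whitney_family_box: "\<delta> > 0 \<Longrightarrow> whitney_family A (range (\<lambda>i. (c i, chart_inv (c i) ` K i, \<delta>)))"
  unfolding whitney_family_def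
proof (intro conjI ballI)
  fix q assume "\<delta> > 0" "q \<in> range (\<lambda>i. (c i, chart_inv (c i) ` K i, \<delta>))"
  then obtain i where i: "q = (c i, chart_inv (c i) ` K i, \<delta>)" by blast
  have "compact (chart_inv (c i) ` K i)" by (rule compact_chart_inv_image[OF ci compact_cball K_sub])
  moreover have "chart_inv (c i) ` K i \<subseteq> fst (c i)" using K_sub by (auto intro!: inv_into_into)
  ultimately show "case q of (d, B, \<epsilon>) \<Rightarrow> d \<in> maximal_atlas A \<and> compact B \<and> B \<subseteq> fst d \<and> \<epsilon> > 0"
    using cm i \<open>\<delta> > 0\<close> by simp
next
  fix p
  show "\<exists>W. open W \<and> p \<in> W \<and> finite {t \<in> range (\<lambda>i. (c i, chart_inv (c i) ` K i, \<delta>)). fst (fst t) \<inter> W \<noteq> {}}"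
  proof (intro exI[of _ UNIV] conjI open_UNIV UNIV_I)
    show "finite {t \<in> range (\<lambda>i. (c i, chart_inv (c i) ` K i, \<delta>)). fst (fst t) \<inter> UNIV \<noteq> {}}"
      by (rule finite_subset[of _ "range (\<lambda>i. (c i, chart_inv (c i) ` K i, \<delta>))"]) auto
  qed
qed

text \<open>\<open>jet_close\<close> involves only N charts and a compact ball in each, so it holds
  on a Whitney neighbourhood given by a finite family. Stability under small changes of derivatives
  thus becomes openness in the product topology.\<close>

lemma openin_jet_stable:
  fixes s :: nat
  assumes s: "s \<ge> 2"
    and P: "\<And>X0 X1. X0 \<in> vector_fields A \<Longrightarrow> X1 \<in> vector_fields A \<Longrightarrow> P X0 X1 \<Longrightarrow>
      \<exists>\<delta>>0. \<forall>Y0\<in>vector_fields A. \<forall>Y1\<in>vector_fields A. jet_close l \<delta> X0 Y0 \<longrightarrow> jet_close l \<delta> X1 Y1 \<longrightarrow> P Y0 Y1"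
  shows "openin (product_topology (\<lambda>_. whitney_topology A l) {..<s})
    {f \<in> topspace (product_topology (\<lambda>_. whitney_topology A l) {..<s}). P (f 0) (f 1)}" (is "openin ?T ?P")
proof (subst openin_subopen, intro ballI)
  fix f assume f: "f \<in> ?P"
  have fv: "f j \<in> vector_fields A" if "j < s" for j using f that by (auto simp: PiE_iff)
  have v: "f 0 \<in> vector_fields A" "f 1 \<in> vector_fields A" using fv[of 0] fv[of 1] s by auto
  obtain \<delta> where \<delta>: "\<delta> > 0" "\<And>Y0 Y1. Y0 \<in> vector_fields A \<Longrightarrow> Y1 \<in> vector_fields A \<Longrightarrow>
      jet_close l \<delta> (f 0) Y0 \<Longrightarrow> jet_close l \<delta> (f 1) Y1 \<Longrightarrow> P Y0 Y1"
    using P[OF v] f by blast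
  let ?F = "range (\<lambda>i. (c i, chart_inv (c i) ` K i, \<delta>))"
  let ?N = "\<lambda>j. whitney_nbhd A l ?F (f j)"
  have oN: "openin (whitney_topology A l) (?N j)" if "j < s" for j
    unfolding whitney_topology_def using whitney_family_box[OF \<delta>(1)] fv[OF that]
    by (intro topology_generated_by_Basis) blast
  have oT: "openin ?T {g \<in> topspace ?T. g j \<in> ?N j}" if "j < s" for j
  proof (rule openin_continuous_map_preimage[OF _ oN[OF that]])
    show "continuous_map ?T (whitney_topology A l) (\<lambda>g. g j)"
      using continuous_map_product_projection[of j "{..<s}" "\<lambda>_. whitney_topology A l"] that by simp
  qed
  let ?W = "{g \<in> topspace ?T. g 0 \<in> ?N 0} \<inter> {g \<in> topspace ?T. g 1 \<in> ?N 1}"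
  have "openin ?T ?W" using s by (intro openin_Int oT) auto
  moreover have "f j \<in> ?N j" if "j < s" for j using fv[OF that] \<delta>(1) by (auto simp: whitney_nbhd_def)
  then have "f \<in> ?W" using f s by auto
  moreover have "?W \<subseteq> ?P"
  proof
    fix g assume g: "g \<in> ?W"
    have "P (g 0) (g 1)"
    proof (rule \<delta>(2))
      show "jet_close l \<delta> (f 0) (g 0)" by (rule jet_close_whitney_nbhd[OF v(1)]) (use g in blast)
      show "jet_close l \<delta> (f 1) (g 1)" by (rule jet_close_whitney_nbhd[OF v(2)]) (use g in blast)
      show "g 0 \<in> vector_fields A" "g 1 \<in> vector_fields A"
        using g by (simp_all add: whitney_nbhd_def)
    qed
    then show "g \<in> ?P" using g by blast
  qed
  ultimately show "\<exists>T. openin ?T T \<and> f \<in> T \<and> T \<subseteq> ?P" by blast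
qed

lemma smooth_combination:
  "X0 \<in> vector_fields A \<Longrightarrow> X1 \<in> vector_fields A \<Longrightarrow> smooth_on (S i) (\<lambda>z. \<rho> i X0 z + real a *\<^sub>R \<rho> i X1 z)"
  by (intro smooth_on_add smooth_on_scaleR open_S smooth_rho smooth_on_const)

lemma jet_close_combination:
  assumes v: "X0 \<in> vector_fields A" "X1 \<in> vector_fields A" "Y0 \<in> vector_fields A" "Y1 \<in> vector_fields A"
    and j: "jet_close l \<delta> X0 Y0" "jet_close l \<delta> X1 Y1" and n: "n \<le> l"
  shows "jet_le n (K i) (\<lambda>z. (\<rho> i Y0 z + real a *\<^sub>R \<rho> i Y1 z) - (\<rho> i X0 z + real a *\<^sub>R \<rho> i X1 z)) ((1 + real a) * \<delta>)"
proof -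
  have "jet_le n (K i) (\<lambda>z. (\<rho> i Y0 z - \<rho> i X0 z) + real a *\<^sub>R (\<rho> i Y1 z - \<rho> i X1 z)) (\<delta> + \<bar>real a\<bar> * \<delta>)"
    using j n unfolding jet_close_def
    by (intro jet_le_add_scaled[OF open_S K_sub] smooth_on_diff open_S smooth_rho v) (auto intro: jet_le_mono)
  then show ?thesis by (simp add: algebra_simps)
qed

text \<open>The bracket of order k depends continuously on k derivatives of the fields, so orders up
  to l are controlled by \<open>jet_close l\<close>. On the compact \<kappa>,
  \<open>nondegenerate_robust\<close> tolerates a small change of finitely many brackets.\<close>

lemma good_stable:
  assumes \<kappa>: "compact \<kappa>" "\<kappa> \<subseteq> box" and I: "finite I" "\<And>q. q \<in> I \<Longrightarrow> snd q \<le> l"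
    and v: "X0 \<in> vector_fields A" "X1 \<in> vector_fields A" and g: "good \<kappa> I X0 X1"
  shows "\<exists>\<delta>>0. \<forall>Y0\<in>vector_fields A. \<forall>Y1\<in>vector_fields A. jet_close l \<delta> X0 Y0 \<longrightarrow> jet_close l \<delta> X1 Y1 \<longrightarrow> good \<kappa> I Y0 Y1"
proof -
  have inK: "y $ i \<in> K i" if "y \<in> \<kappa>" for y i using that \<kappa>(2) unfolding box_def by blast
  have inS: "y $ i \<in> S i" if "y \<in> \<kappa>" for y i using K_sub inK[OF that] by blast
  have cont: "continuous_on \<kappa> (ad_vector a n X0 X1)" for a n
    unfolding ad_vector_def
  proof (rule continuous_on_vec_lambda)
    fix i
    show "continuous_on \<kappa> (\<lambda>y. ad_iter (\<lambda>z. \<rho> i X0 z + real a *\<^sub>R \<rho> i X1 z) (\<rho> i X1) n (y $ i))"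
      by (rule continuous_on_compose2[OF smooth_on_continuous_on[OF smooth_on_ad_iter[OF open_S smooth_combination[OF v] smooth_rho[OF v(2)]]]])
        (use inS in \<open>auto intro!: continuous_intros\<close>)
  qed
  obtain \<epsilon> where \<epsilon>: "\<epsilon> > 0"
    "\<And>y w. y \<in> \<kappa> \<Longrightarrow> (\<forall>q\<in>I. norm (w q - ad_vector (fst q) (snd q) X0 X1 y) \<le> \<epsilon>) \<Longrightarrow> nondegenerate w I"
    using nondegenerate_robust[OF \<kappa>(1) I(1), of "\<lambda>q. ad_vector (fst q) (snd q) X0 X1"] cont g
    unfolding good_def by blast
  \<comment> \<open>The tolerance \<epsilon> is shared among the N points, the norm of a tuple being
    at most the sum of the norms of its components.\<close>
  define N where "N = real CARD('k)"
  have N: "N > 0" by (simp add: N_def)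
  let ?A = "\<lambda>q i X0 X1. ad_iter (\<lambda>z. \<rho> i X0 z + real (fst q) *\<^sub>R \<rho> i X1 z) (\<rho> i X1) (snd q)"
  have ev: "\<forall>\<^sub>F \<delta> in at_right 0. \<forall>Y0\<in>vector_fields A. \<forall>Y1\<in>vector_fields A. jet_close l \<delta> X0 Y0 \<longrightarrow> jet_close l \<delta> X1 Y1 \<longrightarrow>
      jet_le 0 (K i) (\<lambda>z. ?A q i Y0 Y1 z - ?A q i X0 X1 z) (\<epsilon> / N)" if q: "q \<in> I" for q i
  proof -
    have "\<epsilon> / N > 0" using \<epsilon> N by simp
    from ad_iter_jet_continuous[OF open_S K_sub compact_cball smooth_combination[OF v, where a="fst q"] smooth_rho[OF v(2)] this, where p=0 and k="snd q"]
    obtain \<delta>0 where \<delta>0: "\<delta>0 > 0" "\<And>\<xi>' \<eta>'. smooth_on (S i) \<xi>' \<Longrightarrow> smooth_on (S i) \<eta>' \<Longrightarrow>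
      jet_le (snd q) (K i) (\<lambda>z. \<xi>' z - (\<rho> i X0 z + real (fst q) *\<^sub>R \<rho> i X1 z)) \<delta>0 \<Longrightarrow>
      jet_le (snd q) (K i) (\<lambda>z. \<eta>' z - \<rho> i X1 z) \<delta>0 \<Longrightarrow>
      jet_le 0 (K i) (\<lambda>z. ad_iter \<xi>' \<eta>' (snd q) z - ?A q i X0 X1 z) (\<epsilon> / N)" unfolding add_0 by blast
    \<comment> \<open>A change of X0 and X1 by \<delta> moves X0 + a X1 by up to (1 + a) \<delta>,
      which explains the upper limit for \<delta>.\<close>
    have "jet_le 0 (K i) (\<lambda>z. ?A q i Y0 Y1 z - ?A q i X0 X1 z) (\<epsilon> / N)"
      if \<delta>: "0 < \<delta>" "\<delta> < \<delta>0 / (1 + real (fst q))" and Y: "Y0 \<in> vector_fields A" "Y1 \<in> vector_fields A"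
        and j: "jet_close l \<delta> X0 Y0" "jet_close l \<delta> X1 Y1" for \<delta> Y0 Y1
    proof (rule \<delta>0(2)[OF smooth_combination[OF Y] smooth_rho[OF Y(2)]])
      have le: "(1 + real (fst q)) * \<delta> \<le> \<delta>0" using \<delta> by (simp add: field_simps)
      have "1 * \<delta> \<le> (1 + real (fst q)) * \<delta>" using \<delta>(1) by (intro mult_right_mono) auto
      then have le': "\<delta> \<le> \<delta>0" using le by simp
      show "jet_le (snd q) (K i) (\<lambda>z. (\<rho> i Y0 z + real (fst q) *\<^sub>R \<rho> i Y1 z) - (\<rho> i X0 z + real (fst q) *\<^sub>R \<rho> i X1 z)) \<delta>0"
        by (rule jet_le_mono[OF jet_close_combination[OF v Y j I(2)[OF q]] order_refl le])
      show "jet_le (snd q) (K i) (\<lambda>z. \<rho> i Y1 z - \<rho> i X1 z) \<delta>0"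
        using j(2) unfolding jet_close_def by (auto intro: jet_le_mono[OF _ I(2)[OF q] le'])
    qed
    then show ?thesis unfolding eventually_at_right_field
      using \<delta>0(1) by (intro exI[of _ "\<delta>0 / (1 + real (fst q))"] conjI allI impI ballI) (simp add: add_pos_nonneg)
  qed
  have "\<forall>\<^sub>F \<delta> in at_right 0. \<forall>q\<in>I. \<forall>i\<in>UNIV. \<forall>Y0\<in>vector_fields A. \<forall>Y1\<in>vector_fields A. jet_close l \<delta> X0 Y0 \<longrightarrow> jet_close l \<delta> X1 Y1 \<longrightarrow>
      jet_le 0 (K i) (\<lambda>z. ?A q i Y0 Y1 z - ?A q i X0 X1 z) (\<epsilon> / N)"
    by (rule eventually_ball_finite[OF I(1)], rule ballI, rule eventually_ball_finite[OF finite], rule ballI, rule ev)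
  then obtain \<delta>0 where \<delta>0: "\<delta>0 > 0" "\<forall>\<delta>>0. \<delta> < \<delta>0 \<longrightarrow> (\<forall>q\<in>I. \<forall>i\<in>UNIV. \<forall>Y0\<in>vector_fields A. \<forall>Y1\<in>vector_fields A. jet_close l \<delta> X0 Y0 \<longrightarrow> jet_close l \<delta> X1 Y1 \<longrightarrow>
      jet_le 0 (K i) (\<lambda>z. ?A q i Y0 Y1 z - ?A q i X0 X1 z) (\<epsilon> / N))"
    unfolding eventually_at_right_field by blast
  show ?thesis
  proof (intro exI[of _ "\<delta>0 / 2"] conjI ballI impI)
    show "\<delta>0 / 2 > 0" using \<delta>0 by simp
    fix Y0 Y1 assume Y: "Y0 \<in> vector_fields A" "Y1 \<in> vector_fields A" "jet_close l (\<delta>0 / 2) X0 Y0" "jet_close l (\<delta>0 / 2) X1 Y1"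
    have b: "jet_le 0 (K i) (\<lambda>z. ?A q i Y0 Y1 z - ?A q i X0 X1 z) (\<epsilon> / N)" if "q \<in> I" for q i
      using \<delta>0(2)[rule_format, of "\<delta>0 / 2" q i Y0 Y1] \<delta>0(1) Y that by simp
    show "good \<kappa> I Y0 Y1" unfolding good_def
    proof (intro ballI \<epsilon>(2))
      fix y q assume y: "y \<in> \<kappa>" and q: "q \<in> I"
      have "norm (ad_vector (fst q) (snd q) Y0 Y1 y - ad_vector (fst q) (snd q) X0 X1 y)
        = norm (\<chi> i. ?A q i Y0 Y1 (y $ i) - ?A q i X0 X1 (y $ i))"
        by (rule arg_cong[of _ _ norm]) (simp add: ad_vector_def vec_eq_iff)
      also have "\<dots> \<le> (\<Sum>i\<in>UNIV. norm (?A q i Y0 Y1 (y $ i) - ?A q i X0 X1 (y $ i)))" by (rule norm_vec_lambda_le)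
      also have "\<dots> \<le> (\<Sum>i\<in>(UNIV :: 'k set). \<epsilon> / N)"
        using b[OF q] inK[OF y] unfolding jet_le_0 by (intro sum_mono) blast
      also have "\<dots> = \<epsilon>" by (simp add: N_def)
      finally show "norm (ad_vector (fst q) (snd q) Y0 Y1 y - ad_vector (fst q) (snd q) X0 X1 y) \<le> \<epsilon>" .
    qed
  qed
qed

lemma transversal_stable:
  assumes \<kappa>: "compact \<kappa>" "\<kappa> \<subseteq> box" and b: "\<And>i. b i \<in> Basis"
    and v: "X0 \<in> vector_fields A" "X1 \<in> vector_fields A" and t: "transversal \<kappa> a b X0 X1"
  shows "\<exists>\<delta>>0. \<forall>Y0\<in>vector_fields A. \<forall>Y1\<in>vector_fields A. jet_close l \<delta> X0 Y0 \<longrightarrow> jet_close l \<delta> X1 Y1 \<longrightarrow> transversal \<kappa> a b Y0 Y1"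
proof (cases "\<kappa> = {}")
  case True then show ?thesis by (auto simp: transversal_def intro!: exI[of _ 1])
next
  case False
  let ?Z = "\<lambda>X0 X1 i z. \<rho> i X0 z + real a *\<^sub>R \<rho> i X1 z"
  have inK: "y $ i \<in> K i" if "y \<in> \<kappa>" for y i using that \<kappa>(2) unfolding box_def by blast
  have inS: "y $ i \<in> S i" if "y \<in> \<kappa>" for y i using K_sub inK[OF that] by blast
  have "\<exists>\<mu>>0. \<forall>y\<in>\<kappa>. \<mu> \<le> \<bar>?Z X0 X1 i (y $ i) \<bullet> b i\<bar>" for i
  proof -
    have "continuous_on \<kappa> (\<lambda>y. ?Z X0 X1 i (y $ i))"
      by (rule continuous_on_compose2[OF smooth_on_continuous_on[OF smooth_combination[OF v]]])
        (use inS in \<open>auto intro!: continuous_intros\<close>)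
    then have "continuous_on \<kappa> (\<lambda>y. \<bar>?Z X0 X1 i (y $ i) \<bullet> b i\<bar>)"
      by (rule continuous_on_rabs[OF continuous_on_inner[OF _ continuous_on_const]])
    from continuous_attains_inf[OF \<kappa>(1) False this] obtain y0 where
      "y0 \<in> \<kappa>" "\<forall>y\<in>\<kappa>. \<bar>?Z X0 X1 i (y0 $ i) \<bullet> b i\<bar> \<le> \<bar>?Z X0 X1 i (y $ i) \<bullet> b i\<bar>" by blast
    then show ?thesis using t unfolding transversal_def
      by (intro exI[of _ "\<bar>?Z X0 X1 i (y0 $ i) \<bullet> b i\<bar>"]) auto
  qed
  then obtain \<mu> where \<mu>: "\<And>i. \<mu> i > 0" "\<And>i y. y \<in> \<kappa> \<Longrightarrow> \<mu> i \<le> \<bar>?Z X0 X1 i (y $ i) \<bullet> b i\<bar>" by metis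
  define \<mu>0 where "\<mu>0 = Min (range \<mu>)"
  have \<mu>0: "\<mu>0 > 0" "\<And>i. \<mu>0 \<le> \<mu> i" using \<mu>(1) by (auto simp: \<mu>0_def)
  let ?d = "\<mu>0 / (2 * (1 + real a))"
  show ?thesis
  proof (intro exI[of _ ?d] conjI ballI impI)
    show "?d > 0" using \<mu>0 by (simp add: add_pos_nonneg)
    fix Y0 Y1 assume Y: "Y0 \<in> vector_fields A" "Y1 \<in> vector_fields A" and j: "jet_close l ?d X0 Y0" "jet_close l ?d X1 Y1"
    show "transversal \<kappa> a b Y0 Y1" unfolding transversal_def
    proof (intro ballI allI)
      fix y i assume y: "y \<in> \<kappa>"
      have "(1 + real a) * ?d = \<mu>0 / 2"
      proof -
        have "1 + real a \<noteq> 0" by linarith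
        then show ?thesis by (simp add: divide_simps)
      qed
      moreover have "norm (?Z Y0 Y1 i (y $ i) - ?Z X0 X1 i (y $ i)) \<le> (1 + real a) * ?d"
        using jet_close_combination[OF v Y j, of 0 i a] inK[OF y, of i] unfolding jet_le_0 by blast
      ultimately have "norm (?Z Y0 Y1 i (y $ i) - ?Z X0 X1 i (y $ i)) \<le> \<mu>0 / 2" by (simp only:)
      then have "\<bar>(?Z Y0 Y1 i (y $ i) - ?Z X0 X1 i (y $ i)) \<bullet> b i\<bar> \<le> \<mu>0 / 2"
        using Basis_le_norm[OF b] order_trans by blast
      then show "?Z Y0 Y1 i (y $ i) \<bullet> b i \<noteq> 0"
        using \<mu>(2)[OF y, of i] \<mu>0(2)[of i] \<mu>0(1) unfolding inner_diff_left by linarith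
    qed
  qed
qed

end

section \<open>Density of the spanning condition on a box\<close>

context chart_box
begin

text \<open>
  The order is such that the number of brackets equals the number \<open>2nN\<close> of places required in
  \<open>negligible_degenerate_parameters\<close>.
\<close>

definition top_order :: nat where "top_order = CARD(('e ^ 'k) basis_index \<times> bool) - 1"

definition enum_index :: "('e ^ 'k) basis_index \<times> bool \<Rightarrow> nat" where
  "enum_index = (SOME f. bij_betw f UNIV {..top_order})"

lemma bij_enum_index: "bij_betw enum_index UNIV {..top_order}"
proof -
  have "CARD(('e ^ 'k) basis_index \<times> bool) > 0" by (simp add: card_gt_0_iff)
  then have "card (UNIV :: (('e ^ 'k) basis_index \<times> bool) set) = card {..top_order}" by (simp add: top_order_def)
  then have "\<exists>f :: ('e ^ 'k) basis_index \<times> bool \<Rightarrow> nat. bij_betw f UNIV {..top_order}"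
    by (intro finite_same_card_bij) auto
  then show ?thesis unfolding enum_index_def by (rule someI_ex)
qed

abbreviation "\<beta> i \<equiv> bump (x i) (2 * r i)"

definition coord_field :: "('k \<Rightarrow> 'e) \<Rightarrow> 'k \<times> (('e ^ 'k) basis_index \<times> bool) \<times> 'e \<Rightarrow> 'e \<Rightarrow> 'e" where
  "coord_field b \<tau> = monomial_field (\<beta> (fst \<tau>)) (b (fst \<tau>)) (enum_index (fst (snd \<tau>))) (snd (snd \<tau>))"

definition box_field :: "('k \<Rightarrow> 'e) \<Rightarrow> 'k \<times> (('e ^ 'k) basis_index \<times> bool) \<times> 'e \<Rightarrow> 'm \<Rightarrow> 'm tangent" where
  "box_field b \<tau> = push_field A (c (fst \<tau>)) (coord_field b \<tau>)"

definition indices :: "('k \<times> (('e ^ 'k) basis_index \<times> bool) \<times> 'e) set" where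
  "indices = UNIV \<times> UNIV \<times> Basis"

lemma finite_indices: "finite indices" by (simp add: indices_def)

lemma coord_field_zero: "z \<notin> cball (x (fst \<tau>)) (2 * r (fst \<tau>)) \<Longrightarrow> coord_field b \<tau> z = 0"
  using bump_zero[of "2 * r (fst \<tau>)" z "x (fst \<tau>)"] r_pos[of "fst \<tau>"]
  by (simp add: coord_field_def monomial_field_def)

lemma box_field_in_vector_fields: "box_field b \<tau> \<in> vector_fields A"
  unfolding box_field_def
  by (rule push_field_in_vector_fields[OF A cm _ coord_field_zero compact_cball cball_sub])
    (simp_all add: coord_field_def smooth_on_monomial_field[OF open_S smooth_on_bump])

lemma box_field_zero: "p \<notin> chart_inv (c (fst \<tau>)) ` cball (x (fst \<tau>)) (2 * r (fst \<tau>)) \<Longrightarrow> box_field b \<tau> p = (\<lambda>f. 0)"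
  unfolding box_field_def by (rule push_field_zero[OF A cm coord_field_zero cball_sub])

lemma chart_rep_box_field:
  assumes z: "z \<in> ball (x i) (2 * r i)"
  shows "\<rho> i (box_field b \<tau>) z = (if fst \<tau> = i then coord_field b \<tau> z else 0)"
proof (cases "fst \<tau> = i")
  case True
  have zS: "z \<in> S i" using z cball_sub[of i] ball_subset_cball[of "x i" "2 * r i"] by blast
  show ?thesis using True chart_rep_unique[OF A cm has_rep_push_field zS] by (auto simp: box_field_def)
next
  case False
  have "chart_inv (c i) z \<in> chart_inv (c i) ` cball (x i) (2 * r i)" using z ball_subset_cball[of "x i" "2 * r i"] by blast
  then have "chart_inv (c i) z \<notin> chart_inv (c (fst \<tau>)) ` cball (x (fst \<tau>)) (2 * r (fst \<tau>))"
    using disj[OF False] by blast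
  then have "box_field b \<tau> (chart_inv (c i) z) = (\<lambda>f. 0)" by (rule box_field_zero)
  then show ?thesis using False by (simp add: chart_rep_def)
qed

text \<open>The open ball is larger than \<open>K i\<close> because brackets at a point require the
  equality of fields in a neighbourhood of that point.\<close>

lemma chart_rep_perturb:
  assumes z: "z \<in> ball (x i) (2 * r i)"
  shows "\<rho> i (perturb X indices (box_field b) a) z = \<rho> i X z
    + (\<Sum>(j, e)\<in>UNIV \<times> Basis. a (i, j, e) *\<^sub>R monomial_field (\<beta> i) (b i) (enum_index j) e z)"
proof -
  have "(\<Sum>\<tau>\<in>indices. a \<tau> *\<^sub>R \<rho> i (box_field b \<tau>) z)
    = (\<Sum>\<tau>\<in>indices. if fst \<tau> = i then a \<tau> *\<^sub>R coord_field b \<tau> z else 0)"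
    by (rule sum.cong) (simp_all add: chart_rep_box_field[OF z])
  also have "\<dots> = (\<Sum>i'\<in>UNIV. \<Sum>\<sigma>\<in>UNIV \<times> Basis. if i' = i then a (i', \<sigma>) *\<^sub>R coord_field b (i', \<sigma>) z else 0)"
    unfolding indices_def sum.cartesian_product by (rule sum.cong) auto
  also have "\<dots> = (\<Sum>i'\<in>UNIV. if i' = i then (\<Sum>\<sigma>\<in>UNIV \<times> Basis. a (i', \<sigma>) *\<^sub>R coord_field b (i', \<sigma>) z) else 0)"
    by (rule sum.cong) simp_all
  also have "\<dots> = (\<Sum>\<sigma>\<in>UNIV \<times> Basis. a (i, \<sigma>) *\<^sub>R coord_field b (i, \<sigma>) z)" by simp
  finally show ?thesis
    by (simp add: perturb_def chart_rep_add_sum coord_field_def split_beta)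
qed

definition perturb_pair ::
  "('k \<Rightarrow> 'e) \<Rightarrow> (nat \<Rightarrow> 'm \<Rightarrow> 'm tangent) \<Rightarrow> ('k \<times> (('e ^ 'k) basis_index \<times> bool) \<times> 'e \<Rightarrow> real) \<Rightarrow>
    ('k \<times> (('e ^ 'k) basis_index \<times> bool) \<times> 'e \<Rightarrow> real) \<Rightarrow> nat \<Rightarrow> 'm \<Rightarrow> 'm tangent" where
  "perturb_pair b f a0 a1 = f(0 := perturb (f 0) indices (box_field b) a0, 1 := perturb (f 1) indices (box_field b) a1)"

lemma perturb_pair_in_open:
  fixes s :: nat
  assumes s: "s \<ge> 2" and U: "openin (product_topology (\<lambda>_. whitney_topology A l) {..<s}) U" and f: "f \<in> U"
  shows "\<exists>\<delta>>0. \<forall>a0 a1. (\<forall>\<tau>\<in>indices. \<bar>a0 \<tau>\<bar> < \<delta> \<and> \<bar>a1 \<tau>\<bar> < \<delta>) \<longrightarrow> perturb_pair b f a0 a1 \<in> U"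
proof -
  obtain W where W: "f \<in> Pi\<^sub>E {..<s} W" "\<And>j. openin (whitney_topology A l) (W j)" "Pi\<^sub>E {..<s} W \<subseteq> U"
    using product_topology_open_contains_basis[OF U f] by blast
  define C where "C = (\<Union>i. chart_inv (c i) ` cball (x i) (2 * r i))"
  have C: "compact C" unfolding C_def
    by (intro compact_UN[OF finite] compact_chart_inv_image[OF ci compact_cball cball_sub])
  have "chart_inv (c i) ` cball (x i) (2 * r i) \<subseteq> carrier_of A" for i
  proof -
    have "chart_inv (c i) ` cball (x i) (2 * r i) \<subseteq> fst (c i)"
      using chart_inv_in[OF subsetD[OF cball_sub]] by blast
    then show ?thesis using maximal_atlasD(2)[OF cm[of i]] by (rule order_trans)
  qed
  then have C': "C \<subseteq> carrier_of A" unfolding C_def by blast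
  have hC: "box_field b \<tau> p = (\<lambda>f. 0)" if "p \<notin> C" for \<tau> p
    by (rule box_field_zero) (use that in \<open>auto simp: C_def\<close>)
  have ev: "\<forall>\<^sub>F \<delta> in at_right 0. \<forall>a. (\<forall>\<tau>\<in>indices. \<bar>a \<tau>\<bar> < \<delta>) \<longrightarrow> perturb (f j) indices (box_field b) a \<in> W j" if "j < s" for j
    by (rule perturb_in_whitney_open[OF A W(2) _ finite_indices _ C C'])
      (use W(1) that box_field_in_vector_fields hC in \<open>auto simp: PiE_iff\<close>)
  have "\<forall>\<^sub>F \<delta> in at_right (0::real). (\<forall>a. (\<forall>\<tau>\<in>indices. \<bar>a \<tau>\<bar> < \<delta>) \<longrightarrow> perturb (f 0) indices (box_field b) a \<in> W 0) \<and>
     (\<forall>a. (\<forall>\<tau>\<in>indices. \<bar>a \<tau>\<bar> < \<delta>) \<longrightarrow> perturb (f 1) indices (box_field b) a \<in> W 1)"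
    using s by (intro eventually_conj ev) auto
  then obtain d where d: "d > 0" "\<And>\<delta>. 0 < \<delta> \<Longrightarrow> \<delta> < d \<Longrightarrow>
     (\<forall>a. (\<forall>\<tau>\<in>indices. \<bar>a \<tau>\<bar> < \<delta>) \<longrightarrow> perturb (f 0) indices (box_field b) a \<in> W 0) \<and>
     (\<forall>a. (\<forall>\<tau>\<in>indices. \<bar>a \<tau>\<bar> < \<delta>) \<longrightarrow> perturb (f 1) indices (box_field b) a \<in> W 1)"
    unfolding eventually_at_right_field by blast
  show ?thesis
  proof (intro exI[of _ "d / 2"] conjI allI impI)
    show "d / 2 > 0" using d by simp
    fix a0 a1 assume a: "\<forall>\<tau>\<in>indices. \<bar>a0 \<tau>\<bar> < d / 2 \<and> \<bar>a1 \<tau>\<bar> < d / 2"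
    then have "perturb (f 0) indices (box_field b) a0 \<in> W 0" "perturb (f 1) indices (box_field b) a1 \<in> W 1"
      using d(2)[of "d / 2"] d(1) by auto
    then have "perturb_pair b f a0 a1 \<in> Pi\<^sub>E {..<s} W"
      using W(1) s unfolding perturb_pair_def by (auto simp: PiE_iff extensional_def)
    then show "perturb_pair b f a0 a1 \<in> U" using W(3) by blast
  qed
qed

lemma perturb_pair_0: "perturb_pair b f a0 a1 0 = perturb (f 0) indices (box_field b) a0"
  and perturb_pair_1: "perturb_pair b f a0 a1 1 = perturb (f 1) indices (box_field b) a1"
  by (simp_all add: perturb_pair_def)

lemma K_sub_ball: "z \<in> K i \<Longrightarrow> z \<in> ball (x i) (2 * r i)"
  using r_pos[of i] by simp

lemma open_in_vector_fields:
  fixes s :: nat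
  assumes "s \<ge> 2" "openin (product_topology (\<lambda>_. whitney_topology A l) {..<s}) U" "f \<in> U"
  shows "f 0 \<in> vector_fields A" "f 1 \<in> vector_fields A"
proof -
  have "f \<in> {..<s} \<rightarrow>\<^sub>E vector_fields A" using openin_subset[OF assms(2)] assms(3) by auto
  then show "f 0 \<in> vector_fields A" "f 1 \<in> vector_fields A" using assms(1) by (auto simp: PiE_iff)
qed

lemma nonvanishing_dense:
  fixes s :: nat
  assumes s: "s \<ge> 2" and U: "openin (product_topology (\<lambda>_. whitney_topology A l) {..<s}) U" and f: "f \<in> U"
  shows "\<exists>f'\<in>U. \<forall>i. \<forall>z\<in>K i. \<rho> i (f' 0) z \<noteq> 0 \<or> \<rho> i (f' 1) z \<noteq> 0"
proof -
  note v = open_in_vector_fields[OF s U f]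
  obtain \<delta> where \<delta>: "\<delta> > 0" "\<And>a0 a1. (\<forall>\<tau>\<in>indices. \<bar>a0 \<tau>\<bar> < \<delta> \<and> \<bar>a1 \<tau>\<bar> < \<delta>) \<Longrightarrow> perturb_pair (\<lambda>_. 0) f a0 a1 \<in> U"
    using perturb_pair_in_open[OF s U f] by blast
  have "\<exists>v0 v1. norm v0 < \<delta> \<and> norm v1 < \<delta> \<and> (\<forall>z\<in>K i. \<rho> i (f 0) z + \<beta> i z *\<^sub>R v0 \<noteq> 0 \<or> \<rho> i (f 1) z + \<beta> i z *\<^sub>R v1 \<noteq> 0)" for i
  proof (rule nonvanishing_parameters[OF K_sub smooth_rho[OF v(1)] smooth_rho[OF v(2)] smooth_on_bump _ \<delta>(1)])
    fix z assume "z \<in> K i"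
    from bump_pos[OF K_sub_ball[OF this]] show "\<beta> i z \<noteq> 0" by simp
  qed
  then obtain v0 v1 where n: "\<And>i. norm (v0 i) < \<delta>" "\<And>i. norm (v1 i) < \<delta>"
    "\<And>i z. z \<in> K i \<Longrightarrow> \<rho> i (f 0) z + \<beta> i z *\<^sub>R v0 i \<noteq> 0 \<or> \<rho> i (f 1) z + \<beta> i z *\<^sub>R v1 i \<noteq> 0" by metis
  \<comment> \<open>The index of degree 0. With only the constant monomials switched on, the
    perturbation near the i-th point is the bump function times the vector w i.\<close>
  define j0 where "j0 = inv enum_index 0"
  define a where "a w \<tau> = (if fst (snd \<tau>) = j0 then w (fst \<tau>) else 0) \<bullet> snd (snd \<tau>)"
    for w :: "'k \<Rightarrow> 'e" and \<tau> :: "'k \<times> (('e ^ 'k) basis_index \<times> bool) \<times> 'e"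
  have rep: "\<rho> i (perturb X indices (box_field (\<lambda>_. 0)) (a w)) z = \<rho> i X z + \<beta> i z *\<^sub>R w i" if z: "z \<in> K i" for i z X w
  proof -
    let ?t = "\<lambda>j. if j = j0 then w i else 0"
    have inj: "inv enum_index n = j0 \<longleftrightarrow> n = 0" if "n \<le> top_order" for n
      unfolding j0_def using inj_on_eq_iff[OF bij_betw_imp_inj_on[OF bij_betw_inv_into[OF bij_enum_index]]] that by auto
    have "(\<Sum>(j, e)\<in>UNIV \<times> Basis. a w (i, j, e) *\<^sub>R monomial_field (\<beta> i) 0 (enum_index j) e z)
      = (\<Sum>(j, e)\<in>UNIV \<times> Basis. (?t j \<bullet> e) *\<^sub>R monomial_field (\<beta> i) 0 (enum_index j) e z)"
      by (simp only: a_def fst_conv snd_conv)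
    also have "\<dots> = \<beta> i z *\<^sub>R (\<Sum>n\<le>top_order. (z \<bullet> 0) ^ n *\<^sub>R ?t (inv enum_index n))"
      by (rule sum_monomial_field[OF bij_enum_index])
    also have "(\<Sum>n\<le>top_order. (z \<bullet> 0) ^ n *\<^sub>R ?t (inv enum_index n)) = (\<Sum>n\<le>top_order. if n = 0 then w i else 0)"
      by (rule sum.cong) (auto simp: inj)
    also have "\<dots> = w i" by simp
    finally show ?thesis by (simp add: chart_rep_perturb[OF K_sub_ball[OF z]])
  qed
  have ab: "\<bar>a w \<tau>\<bar> < \<delta>" if w: "\<And>i. norm (w i) < \<delta>" and \<tau>: "\<tau> \<in> indices" for w \<tau>
  proof -
    have "\<bar>a w \<tau>\<bar> \<le> norm (if fst (snd \<tau>) = j0 then w (fst \<tau>) else 0)"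
      unfolding a_def using \<tau> by (intro Basis_le_norm) (auto simp: indices_def)
    also have "\<dots> < \<delta>" using w \<delta>(1) by simp
    finally show ?thesis .
  qed
  show ?thesis
  proof (intro bexI[of _ "perturb_pair (\<lambda>_. 0) f (a v0) (a v1)"] allI ballI)
    fix i z assume z: "z \<in> K i"
    show "\<rho> i (perturb_pair (\<lambda>_. 0) f (a v0) (a v1) 0) z \<noteq> 0 \<or> \<rho> i (perturb_pair (\<lambda>_. 0) f (a v0) (a v1) 1) z \<noteq> 0"
      unfolding perturb_pair_0 perturb_pair_1 rep[OF z] by (rule n(3)[OF z])
  next
    show "perturb_pair (\<lambda>_. 0) f (a v0) (a v1) \<in> U"
      by (rule \<delta>(2)) (use ab[of v0] ab[of v1] n(1,2) in blast)
  qed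
qed

lemma good_dense_transversal:
  fixes s :: nat
  assumes s: "s \<ge> 2" and U: "openin (product_topology (\<lambda>_. whitney_topology A l) {..<s}) U" and f: "f \<in> U"
    and \<kappa>: "compact \<kappa>" "\<kappa> \<subseteq> box" and t: "transversal \<kappa> a b (f 0) (f 1)"
  shows "\<exists>f'\<in>U. good \<kappa> ({a} \<times> {..top_order}) (f' 0) (f' 1)"
proof -
  note v = open_in_vector_fields[OF s U f]
  obtain \<delta> where \<delta>: "\<delta> > 0" "\<And>a0 a1. (\<forall>\<tau>\<in>indices. \<bar>a0 \<tau>\<bar> < \<delta> \<and> \<bar>a1 \<tau>\<bar> < \<delta>) \<Longrightarrow> perturb_pair b f a0 a1 \<in> U"
    using perturb_pair_in_open[OF s U f] by blast
  \<comment> \<open>If the coefficients for f 1 are below \<epsilon>, those for f 0, which are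
    larger by the factor a, are still below \<delta>.\<close>
  define \<epsilon> where "\<epsilon> = \<delta> / (1 + real a)"
  have \<epsilon>: "\<epsilon> > 0" "\<epsilon> \<le> \<delta>" "real a * \<epsilon> \<le> \<delta>"
    using \<delta>(1) by (auto simp: \<epsilon>_def field_simps add_pos_nonneg)
  let ?B = "\<lambda>i. ball (x i) (2 * r i)"
  let ?Y = "\<lambda>i z. \<rho> i (f 0) z + real a *\<^sub>R \<rho> i (f 1) z"
  have BS: "?B i \<subseteq> S i" for i using cball_sub ball_subset_cball by blast
  have \<kappa>B: "y $ i \<in> ?B i" if "y \<in> \<kappa>" for y i
    by (rule K_sub_ball) (use that \<kappa>(2) in \<open>auto simp: box_def subset_iff\<close>)
  have "\<exists>t :: ('e ^ 'k) ^ (('e ^ 'k) basis_index \<times> bool). norm t < \<epsilon> \<and> (\<forall>y\<in>\<kappa>. nondegenerate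
    (\<lambda>n. \<chi> i. ad_iter (?Y i) (\<lambda>z. \<rho> i (f 1) z + (\<Sum>(j, e)\<in>UNIV \<times> Basis. (t $ j $ i \<bullet> e) *\<^sub>R monomial_field (\<beta> i) (b i) (enum_index j) e z)) n (y $ i)) {..top_order})"
  proof (rule generic_parameters[OF open_ball _ _ smooth_on_bump \<kappa>(1) \<kappa>B _ _ bij_enum_index \<epsilon>(1)])
    show "smooth_on (?B i) (?Y i)" for i by (rule smooth_on_subset[OF smooth_combination[OF v] BS])
    show "smooth_on (?B i) (\<rho> i (f 1))" for i by (rule smooth_on_subset[OF smooth_rho[OF v(2)] BS])
    show "?Y i (y $ i) \<bullet> b i \<noteq> 0" if "y \<in> \<kappa>" for y i using t that unfolding transversal_def by blast
    show "\<beta> i (y $ i) \<noteq> 0" if "y \<in> \<kappa>" for y i using bump_pos[OF \<kappa>B[OF that]] by (simp add: less_imp_neq[symmetric])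
  qed
  then obtain t :: "('e ^ 'k) ^ (('e ^ 'k) basis_index \<times> bool)" where t: "norm t < \<epsilon>"
    "\<And>y. y \<in> \<kappa> \<Longrightarrow> nondegenerate
    (\<lambda>n. \<chi> i. ad_iter (?Y i) (\<lambda>z. \<rho> i (f 1) z + (\<Sum>(j, e)\<in>UNIV \<times> Basis. (t $ j $ i \<bullet> e) *\<^sub>R monomial_field (\<beta> i) (b i) (enum_index j) e z)) n (y $ i)) {..top_order}"
    by blast
  \<comment> \<open>The choice of \<open>a0\<close> keeps \<open>f 0 + a f 1\<close> fixed, so that the brackets are affine in \<open>t\<close>.\<close>
  define a1 where "a1 \<tau> = t $ fst (snd \<tau>) $ fst \<tau> \<bullet> snd (snd \<tau>)" for \<tau> :: "'k \<times> (('e ^ 'k) basis_index \<times> bool) \<times> 'e"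
  define a0 where "a0 \<tau> = - (real a * a1 \<tau>)" for \<tau>
  have a1: "\<bar>a1 \<tau>\<bar> < \<epsilon>" if "\<tau> \<in> indices" for \<tau>
  proof -
    have "\<bar>a1 \<tau>\<bar> \<le> norm (t $ fst (snd \<tau>) $ fst \<tau>)"
      unfolding a1_def using that by (intro Basis_le_norm) (auto simp: indices_def)
    also have "\<dots> \<le> norm (t $ fst (snd \<tau>))" by (rule Finite_Cartesian_Product.norm_nth_le)
    also have "\<dots> \<le> norm t" by (rule Finite_Cartesian_Product.norm_nth_le)
    finally show ?thesis using t(1) by simp
  qed
  have a0: "\<bar>a0 \<tau>\<bar> < \<delta>" if "\<tau> \<in> indices" for \<tau>
  proof (cases "a = 0")
    case False
    then have "\<bar>a0 \<tau>\<bar> < real a * \<epsilon>" using a1[OF that] by (simp add: a0_def abs_mult)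
    then show ?thesis using \<epsilon>(3) by simp
  qed (use \<delta> in \<open>simp add: a0_def\<close>)
  let ?f = "perturb_pair b f a0 a1"
  have "?f \<in> U" by (rule \<delta>(2)) (use a0 a1 \<epsilon>(2) in fastforce)
  moreover have "good \<kappa> ({a} \<times> {..top_order}) (?f 0) (?f 1)"
    unfolding good_def
  proof
    fix y assume y: "y \<in> \<kappa>"
    let ?\<eta> = "\<lambda>i z. \<rho> i (f 1) z + (\<Sum>(j, e)\<in>UNIV \<times> Basis. (t $ j $ i \<bullet> e) *\<^sub>R monomial_field (\<beta> i) (b i) (enum_index j) e z)"
    have r1: "\<rho> i (?f 1) z = ?\<eta> i z" if "z \<in> ?B i" for i z
      unfolding perturb_pair_1 chart_rep_perturb[OF that] by (simp add: a1_def)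
    have r0: "\<rho> i (?f 0) z + real a *\<^sub>R \<rho> i (?f 1) z = ?Y i z" if "z \<in> ?B i" for i z
    proof -
      have "\<rho> i (?f 0) z = \<rho> i (f 0) z - real a *\<^sub>R (\<Sum>(j, e)\<in>UNIV \<times> Basis. (t $ j $ i \<bullet> e) *\<^sub>R monomial_field (\<beta> i) (b i) (enum_index j) e z)"
        unfolding perturb_pair_0 chart_rep_perturb[OF that]
        by (simp add: a0_def a1_def scaleR_sum_right split_beta sum_negf)
      then show ?thesis unfolding r1[OF that] by (simp add: scaleR_add_right)
    qed
    have "ad_vector a n (?f 0) (?f 1) y = (\<chi> i. ad_iter (?Y i) (?\<eta> i) n (y $ i))" for n
      unfolding ad_vector_def
      using ad_iter_cong[OF open_ball r0 r1 \<kappa>B[OF y], where k=n] by (simp add: vec_eq_iff)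
    then have "nondegenerate (\<lambda>n. ad_vector a n (?f 0) (?f 1) y) {..top_order}" using t(2)[OF y] by simp
    then show "nondegenerate (\<lambda>q. ad_vector (fst q) (snd q) (?f 0) (?f 1) y) ({a} \<times> {..top_order})"
      unfolding nondegenerate_def by fastforce
  qed
  ultimately show ?thesis by blast
qed

text \<open>
  Each point of the configuration excludes at most one of the \<open>N + 1\<close> candidates for \<open>a\<close>.
\<close>

lemma transversal_locally:
  assumes v: "X0 \<in> vector_fields A" "X1 \<in> vector_fields A"
    and nz: "\<And>i z. z \<in> K i \<Longrightarrow> \<rho> i X0 z \<noteq> 0 \<or> \<rho> i X1 z \<noteq> 0" and y: "y \<in> box"
  shows "\<exists>a\<le>CARD('k). \<exists>b. \<exists>\<epsilon>>0. (\<forall>i. b i \<in> Basis) \<and> transversal (box \<inter> cball y \<epsilon>) a b X0 X1"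
proof -
  have yK: "y $ i \<in> K i" for i using y by (simp add: box_def)
  let ?Z = "\<lambda>a i z. \<rho> i X0 z + real a *\<^sub>R \<rho> i X1 z"
  have "\<exists>a\<le>CARD('k). \<forall>i. ?Z a i (y $ i) \<noteq> 0"
  proof (rule ccontr)
    assume "\<not> ?thesis"
    then have "\<forall>a\<in>{..CARD('k)}. \<exists>i. ?Z a i (y $ i) = 0" by auto
    then obtain g where g: "\<And>a. a \<le> CARD('k) \<Longrightarrow> ?Z a (g a) (y $ g a) = 0" by (metis atMost_iff)
    \<comment> \<open>If two values of a gave a zero at the same point, X1 and then X0 would vanish
      there, against \<open>nz\<close>. So the N + 1 values of a would inject into the N
      points.\<close>
    have "inj_on g {..CARD('k)}"
    proof (rule inj_onI)
      fix a a' assume a: "a \<in> {..CARD('k)}" "a' \<in> {..CARD('k)}" "g a = g a'"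
      have "?Z a (g a) (y $ g a) = 0" "?Z a' (g a) (y $ g a) = 0" using g[of a] g[of a'] a by auto
      moreover from this have "(real a - real a') *\<^sub>R \<rho> (g a) X1 (y $ g a) = 0"
        by (metis add_left_cancel diff_self scaleR_left_diff_distrib)
      ultimately show "a = a'" using nz[OF yK[of "g a"]] by auto
    qed
    then have "card {..CARD('k)} \<le> CARD('k)" using card_inj_on_le[of g "{..CARD('k)}" UNIV] by simp
    then show False by simp
  qed
  then obtain a where a: "a \<le> CARD('k)" "\<And>i. ?Z a i (y $ i) \<noteq> 0" by blast
  then have "\<forall>i. \<exists>e\<in>Basis. ?Z a i (y $ i) \<bullet> e \<noteq> 0" using euclidean_all_zero_iff by blast
  then obtain b where b: "\<And>i. b i \<in> Basis" "\<And>i. ?Z a i (y $ i) \<bullet> b i \<noteq> 0" by metis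
  have "\<forall>\<^sub>F z in at y within box. \<forall>i\<in>UNIV. ?Z a i (z $ i) \<bullet> b i \<noteq> 0"
  proof (rule eventually_ball_finite[OF finite], rule ballI)
    fix i
    have "continuous_on box (\<lambda>y. ?Z a i (y $ i))"
      by (rule continuous_on_compose2[OF smooth_on_continuous_on[OF smooth_combination[OF v]]])
        (use K_sub in \<open>auto simp: box_def subset_iff intro!: continuous_intros\<close>)
    then have "continuous_on box (\<lambda>y. ?Z a i (y $ i) \<bullet> b i)"
      by (rule continuous_on_inner[OF _ continuous_on_const])
    then have "((\<lambda>y. ?Z a i (y $ i) \<bullet> b i) \<longlongrightarrow> ?Z a i (y $ i) \<bullet> b i) (at y within box)"
      using y by (simp add: continuous_on_def)
    then show "\<forall>\<^sub>F z in at y within box. ?Z a i (z $ i) \<bullet> b i \<noteq> 0"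
      by (rule tendsto_imp_eventually_ne) (rule b(2))
  qed
  then obtain d where d: "d > 0" "\<And>z. z \<in> box \<Longrightarrow> z \<noteq> y \<Longrightarrow> dist z y < d \<Longrightarrow> \<forall>i. ?Z a i (z $ i) \<bullet> b i \<noteq> 0"
    unfolding eventually_at by auto
  have "transversal (box \<inter> cball y (d / 2)) a b X0 X1"
    unfolding transversal_def
  proof
    fix z assume z: "z \<in> box \<inter> cball y (d / 2)"
    show "\<forall>i. ?Z a i (z $ i) \<bullet> b i \<noteq> 0"
    proof (cases "z = y")
      case False
      have "dist z y < d" using z d(1) by (simp add: dist_commute)
      then show ?thesis using d(2) z False by blast
    qed (use b in blast)
  qed
  then show ?thesis using a(1) b(1) d(1) by (metis half_gt_zero)
qed

lemma good_mono: "good \<kappa> I X0 X1 \<Longrightarrow> \<kappa>' \<subseteq> \<kappa> \<Longrightarrow> I \<subseteq> J \<Longrightarrow> good \<kappa>' J X0 X1"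
  unfolding good_def nondegenerate_def by blast

definition all_brackets :: "(nat \<times> nat) set" where "all_brackets = {..CARD('k)} \<times> {..top_order}"

text \<open>\<open>good_dense_transversal\<close> needs one a and one b for a whole compact set, so
  it is applied to each piece \<open>\<kappa> y\<close> in turn. Transversality on all pieces and
  goodness on the earlier ones are open conditions; they are kept by restricting the open set in
  which the next perturbation is sought.\<close>

lemma good_dense:
  fixes s :: nat
  assumes s: "s \<ge> 2" and l: "top_order \<le> l"
    and U: "openin (product_topology (\<lambda>_. whitney_topology A l) {..<s}) U" and f: "f \<in> U"
  shows "\<exists>f'\<in>U. good box all_brackets (f' 0) (f' 1)"
proof -
  let ?T = "product_topology (\<lambda>_. whitney_topology A l) {..<s}"
  obtain f1 where f1: "f1 \<in> U" "\<And>i z. z \<in> K i \<Longrightarrow> \<rho> i (f1 0) z \<noteq> 0 \<or> \<rho> i (f1 1) z \<noteq> 0"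
    using nonvanishing_dense[OF s U f] by blast
  note v = open_in_vector_fields[OF s U f1(1)]
  have "\<forall>y\<in>box. \<exists>q. fst q \<le> CARD('k) \<and> snd (snd q) > 0 \<and> (\<forall>i. fst (snd q) i \<in> Basis)
      \<and> transversal (box \<inter> cball y (snd (snd q))) (fst q) (fst (snd q)) (f1 0) (f1 1)"
  proof
    fix y assume "y \<in> box"
    from transversal_locally[OF v f1(2) this] obtain a b \<epsilon> where
      "a \<le> CARD('k)" "\<epsilon> > 0" "\<forall>i. b i \<in> Basis" "transversal (box \<inter> cball y \<epsilon>) a b (f1 0) (f1 1)" by blast
    then show "\<exists>q. fst q \<le> CARD('k) \<and> snd (snd q) > 0 \<and> (\<forall>i. fst (snd q) i \<in> Basis)
      \<and> transversal (box \<inter> cball y (snd (snd q))) (fst q) (fst (snd q)) (f1 0) (f1 1)"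
      by (intro exI[of _ "(a, b, \<epsilon>)"]) simp
  qed
  from bchoice[OF this] obtain q where q: "\<forall>y\<in>box. fst (q y) \<le> CARD('k) \<and> snd (snd (q y)) > 0 \<and> (\<forall>i. fst (snd (q y)) i \<in> Basis)
      \<and> transversal (box \<inter> cball y (snd (snd (q y)))) (fst (q y)) (fst (snd (q y))) (f1 0) (f1 1)" by blast
  define a where "a y = fst (q y)" for y
  define b where "b y = fst (snd (q y))" for y
  define \<kappa> where "\<kappa> y = box \<inter> cball y (snd (snd (q y)))" for y
  have a: "a y \<le> CARD('k)" "\<And>i. b y i \<in> Basis" "transversal (\<kappa> y) (a y) (b y) (f1 0) (f1 1)" if "y \<in> box" for y
    using q that by (auto simp: a_def b_def \<kappa>_def)
  have \<kappa>: "compact (\<kappa> y)" "\<kappa> y \<subseteq> box" for y by (auto simp: \<kappa>_def intro!: compact_Int_closed compact_box)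
  obtain D where D: "D \<subseteq> box" "finite D" "box \<subseteq> (\<Union>y\<in>D. ball y (snd (snd (q y))))"
    by (rule compactE_image[OF compact_box, of box "\<lambda>y. ball y (snd (snd (q y)))"]) (use q in auto)
  define O1 where "O1 y = {g \<in> topspace ?T. transversal (\<kappa> y) (a y) (b y) (g 0) (g 1)}" for y
  define O2 where "O2 y = {g \<in> topspace ?T. good (\<kappa> y) ({a y} \<times> {..top_order}) (g 0) (g 1)}" for y
  have O1: "openin ?T (O1 y)" if "y \<in> box" for y
    unfolding O1_def by (intro openin_jet_stable[OF s] transversal_stable \<kappa> a(2)[OF that])
  have O2: "openin ?T (O2 y)" for y
    unfolding O2_def by (intro openin_jet_stable[OF s] good_stable \<kappa>) (use l in auto)
  have top: "U \<subseteq> topspace ?T" by (rule openin_subset[OF U])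
  have ind: "\<exists>g. g \<in> U \<and> (\<forall>y\<in>D. g \<in> O1 y) \<and> (\<forall>y\<in>E. g \<in> O2 y)" if "finite E" "E \<subseteq> D" for E
    using that
  proof (induction E rule: finite_induct)
    case empty
    show ?case using f1(1) a(3) D(1) top unfolding O1_def by (intro exI[of _ f1]) blast
  next
    case (insert y E)
    then obtain g where g: "g \<in> U" "\<forall>y\<in>D. g \<in> O1 y" "\<forall>y\<in>E. g \<in> O2 y" by auto
    \<comment> \<open>The intersections with \<open>topspace ?T\<close> matter for an empty index
      set, such as E at the start, whose intersection would be the whole type.\<close>
    let ?W = "U \<inter> ((\<Inter>y\<in>D. O1 y) \<inter> topspace ?T) \<inter> ((\<Inter>y\<in>E. O2 y) \<inter> topspace ?T)"
    have oW: "openin ?T ?W"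
      using D insert.hyps(1) by (intro openin_Int U openin_INT O1 O2) auto
    have gW: "g \<in> ?W" using g top by auto
    have yD: "y \<in> D" using insert.prems by blast
    have "transversal (\<kappa> y) (a y) (b y) (g 0) (g 1)" using g(2) yD by (simp add: O1_def)
    from good_dense_transversal[OF s oW gW \<kappa> this] obtain g' where
      g': "g' \<in> ?W" "good (\<kappa> y) ({a y} \<times> {..top_order}) (g' 0) (g' 1)" by blast
    then have "g' \<in> O2 y" unfolding O2_def by blast
    then show ?case using g'(1) by (intro exI[of _ g']) blast
  qed
  from ind[OF D(2) order_refl] obtain g where g: "g \<in> U" "\<forall>y\<in>D. g \<in> O2 y" by blast
  have "good box all_brackets (g 0) (g 1)"
    unfolding good_def
  proof
    fix z assume z: "z \<in> box"
    then obtain y where y: "y \<in> D" "z \<in> ball y (snd (snd (q y)))" using D(3) by blast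
    then have "z \<in> \<kappa> y" using z ball_subset_cball by (auto simp: \<kappa>_def)
    moreover have "good (\<kappa> y) ({a y} \<times> {..top_order}) (g 0) (g 1)" using g(2) y(1) by (simp add: O2_def)
    moreover have "{a y} \<times> {..top_order} \<subseteq> all_brackets" using a(1) y(1) D(1) by (auto simp: all_brackets_def)
    ultimately have "good {z} all_brackets (g 0) (g 1)" by (rule_tac good_mono) auto
    then show "nondegenerate (\<lambda>q. ad_vector (fst q) (snd q) (g 0) (g 1) z) all_brackets" by (simp add: good_def)
  qed
  then show ?thesis using g(1) by blast
qed

lemma openin_good:
  fixes s :: nat
  assumes "s \<ge> 2" "top_order \<le> l"
  shows "openin (product_topology (\<lambda>_. whitney_topology A l) {..<s})
    {f \<in> topspace (product_topology (\<lambda>_. whitney_topology A l) {..<s}). good box all_brackets (f 0) (f 1)}"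
  by (intro openin_jet_stable[OF assms(1)] good_stable compact_box order_refl)
    (use assms(2) in \<open>auto simp: all_brackets_def\<close>)

end

section \<open>From generic pairs to bracket generation\<close>

context chart_box
begin

text \<open>Outside the locale this constant depends on \<open>c\<close>, \<open>x\<close> and
  \<open>r\<close> alone, so that the condition can be written as a function of the box before the
  locale is interpreted.\<close>

definition generic_pair :: "('m \<Rightarrow> 'm tangent) \<Rightarrow> ('m \<Rightarrow> 'm tangent) \<Rightarrow> bool" where
  "generic_pair X0 X1 \<longleftrightarrow> good box all_brackets X0 X1"

text \<open>In the product chart the brackets of N-folds are computed point by point, which
  identifies the relevant combinations with the vectors \<open>ad_vector\<close>. These span because
  the coordinates of \<gamma> lie in \<open>box\<close>.\<close>

lemma generic_pair_bracket_generating: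
  fixes s :: nat
  assumes s: "s \<ge> 2" and f: "f \<in> {..<s} \<rightarrow>\<^sub>E vector_fields A" and g: "generic_pair (f 0) (f 1)"
    and \<gamma>: "\<And>i. \<gamma> $ i \<in> chart_inv (c i) ` K i"
  shows "bracket_generating_at (config_atlas A) ((\<lambda>j. nfold A (f j)) ` {..<s}) \<gamma>"
proof -
  let ?F = "(\<lambda>j. nfold A (f j)) ` {..<s} :: ('m ^ 'k \<Rightarrow> ('m ^ 'k) tangent) set"
  let ?y = "snd C \<gamma>"
  have B: "smooth_atlas (config_atlas A :: ('m ^ 'k, 'e ^ 'k) chart set)" by (rule smooth_atlas_config_atlas[OF A])
  have Cm: "C \<in> maximal_atlas (config_atlas A)" by (rule maximal_atlasI[OF B C_in_config_atlas])
  have yK: "?y $ i \<in> K i" "\<gamma> $ i \<in> fst (c i)" for i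
  proof -
    obtain z where z: "z \<in> K i" "\<gamma> $ i = chart_inv (c i) z" using \<gamma>[of i] by blast
    have "z \<in> S i" using z(1) K_sub by blast
    then show "?y $ i \<in> K i" "\<gamma> $ i \<in> fst (c i)"
      using z chart_inv_in[of z "c i"] by (simp_all add: chart_inv_right)
  qed
  have "\<gamma> $ i \<noteq> \<gamma> $ j" if "i \<noteq> j" for i j
  proof -
    have "K i \<subseteq> cball (x i) (2 * r i)" for i using r_pos[of i] by (intro subset_cball) simp
    then have "\<gamma> $ i \<in> chart_inv (c i) ` cball (x i) (2 * r i)" for i using \<gamma>[of i] by blast
    then show ?thesis using disj[OF that] by (metis disjoint_iff)
  qed
  then have \<gamma>C: "\<gamma> \<in> fst C" using yK(2) by (simp add: product_chart_domain[of c A, OF cA])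
  have ybox: "?y \<in> box" unfolding box_def using yK(1) by blast
  let ?\<xi> = "\<lambda>X y. \<chi> i. \<rho> i X (y $ i)"
  have rep: "has_rep (config_atlas A) C (nfold A X) (?\<xi> X)" if "X \<in> vector_fields A" for X
    by (rule has_rep_nfold[OF has_rep_chart_rep[OF A cm that]])
  have sm: "smooth_on (snd C ` fst C) (?\<xi> X)" if "X \<in> vector_fields A" for X
  proof (rule smooth_on_vec_lambda[OF open_image])
    fix i
    show "smooth_on (snd C ` fst C) (\<lambda>y. \<rho> i X (y $ i))"
      by (rule smooth_on_compose[OF open_image open_S _ smooth_rho[OF that] smooth_on_nth])
        (use inv_eq(2) in blast)
  qed
  have v: "f 0 \<in> vector_fields A" "f 1 \<in> vector_fields A" using f s by (auto simp: PiE_iff)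
  have F: "nfold A (f 0) \<in> ?F" "nfold A (f 1) \<in> ?F" using s by auto
  let ?R = "(\<lambda>X. chart_rep C X ?y) ` represented_brackets (config_atlas A) C ?F"
  have "ad_vector (fst q) (snd q) (f 0) (f 1) ?y \<in> span ?R" for q
  proof -
    have "bracket_span (config_atlas A) C ?F (ad_iter (\<lambda>y. ?\<xi> (f 0) y + real (fst q) *\<^sub>R ?\<xi> (f 1) y) (?\<xi> (f 1)) (snd q))"
      by (rule bracket_span_ad_iter[OF B Cm F rep[OF v(1)] sm[OF v(1)] rep[OF v(2)] sm[OF v(2)]])
    then have "ad_iter (\<lambda>y. ?\<xi> (f 0) y + real (fst q) *\<^sub>R ?\<xi> (f 1) y) (?\<xi> (f 1)) (snd q) ?y \<in> span ?R"
      by (rule bracket_span_value[OF B Cm imageI[OF \<gamma>C]])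
    also have "(\<lambda>y. ?\<xi> (f 0) y + real (fst q) *\<^sub>R ?\<xi> (f 1) y) = (\<lambda>y. \<chi> i. (\<lambda>z. \<rho> i (f 0) z + real (fst q) *\<^sub>R \<rho> i (f 1) z) (y $ i))"
      by (rule ext) (simp add: vec_eq_iff)
    also have "ad_iter (\<lambda>y. \<chi> i. (\<lambda>z. \<rho> i (f 0) z + real (fst q) *\<^sub>R \<rho> i (f 1) z) (y $ i)) (?\<xi> (f 1)) (snd q) ?y
       = ad_vector (fst q) (snd q) (f 0) (f 1) ?y"
      unfolding ad_vector_def
      by (rule ad_iter_product_field[OF open_S smooth_combination[OF v] smooth_rho[OF v(2)] subsetD[OF K_sub yK(1)]])
    finally show ?thesis .
  qed
  then have "span ((\<lambda>q. ad_vector (fst q) (snd q) (f 0) (f 1) ?y) ` all_brackets) \<subseteq> span ?R"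
    by (intro span_minimal subspace_span) blast
  moreover have "nondegenerate (\<lambda>q. ad_vector (fst q) (snd q) (f 0) (f 1) ?y) all_brackets"
    using g ybox by (simp add: generic_pair_def good_def)
  ultimately have "span ?R = UNIV" using nondegenerate_span by blast
  then show ?thesis by (rule bracket_generating_atI[OF B Cm \<gamma>C])
qed

end

section \<open>Countably many boxes, and the theorem\<close>

lemma disjoint_open_neighbourhoods:
  fixes \<gamma> :: "'m::t2_space ^ 'k::finite"
  assumes "\<And>i j. i \<noteq> j \<Longrightarrow> \<gamma> $ i \<noteq> \<gamma> $ j"
  obtains W where "\<And>i. open (W i)" "\<And>i. \<gamma> $ i \<in> W i" "\<And>i j. i \<noteq> j \<Longrightarrow> W i \<inter> W j = {}"
proof -
  have "\<forall>q. \<exists>UV. fst q \<noteq> snd q \<longrightarrow> open (fst UV) \<and> open (snd UV) \<and> \<gamma> $ fst q \<in> fst UV \<and> \<gamma> $ snd q \<in> snd UV \<and> fst UV \<inter> snd UV = {}"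
    using hausdorff[OF assms] by (metis fst_conv snd_conv)
  then obtain UV where UV: "\<And>i j. i \<noteq> j \<Longrightarrow> open (fst (UV (i, j))) \<and> open (snd (UV (i, j))) \<and>
      \<gamma> $ i \<in> fst (UV (i, j)) \<and> \<gamma> $ j \<in> snd (UV (i, j)) \<and> fst (UV (i, j)) \<inter> snd (UV (i, j)) = {}"
    by (metis fst_conv snd_conv)
  \<comment> \<open>The neighbourhoods chosen for (i, j) need not be those for (j, i) in reverse
    order, so both choices enter.\<close>
  let ?W = "\<lambda>i. \<Inter>j\<in>-{i}. fst (UV (i, j)) \<inter> snd (UV (j, i))"
  show ?thesis
  proof (rule that[of ?W])
    show "open (?W i)" for i using UV by (intro open_INT open_Int) auto
    show "\<gamma> $ i \<in> ?W i" for i using UV by auto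
    show "?W i \<inter> ?W j = {}" if "i \<noteq> j" for i j
      using UV[OF that] that by blast
  qed
qed

text \<open>Boxes around all configurations are uncountably many, but N-tuples of basic open sets
  are countable by second countability. One box is chosen for every tuple that fits into some box,
  and a configuration lies in the box chosen for a small tuple around it.\<close>

lemma countable_chart_boxes:
  fixes A :: "('m::{t2_space, second_countable_topology}, 'e::euclidean_space) chart set"
  assumes A: "smooth_atlas A"
  obtains \<B> :: "(('k::finite \<Rightarrow> ('m, 'e) chart) \<times> ('k \<Rightarrow> 'e) \<times> ('k \<Rightarrow> real)) set" where "countable \<B>"
    "\<forall>(c, x, r)\<in>\<B>. chart_box A c x r"
    "\<forall>\<gamma>\<in>(config_space A :: ('m ^ 'k) set). \<exists>(c, x, r)\<in>\<B>. \<forall>i. \<gamma> $ i \<in> chart_inv (c i) ` cball (x i) (r i)"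
proof -
  obtain \<T> :: "'m set set" where \<T>: "countable \<T>" "topological_basis \<T>" using ex_countable_basis by blast
  define fits where "fits b q \<longleftrightarrow> chart_box A (fst q) (fst (snd q)) (snd (snd q)) \<and>
      (\<forall>i. b i \<subseteq> chart_inv (fst q i) ` cball (fst (snd q) i) (snd (snd q) i))"
    for b :: "'k \<Rightarrow> 'm set" and q :: "('k \<Rightarrow> ('m, 'e) chart) \<times> ('k \<Rightarrow> 'e) \<times> ('k \<Rightarrow> real)"
  define D where "D = {b \<in> (UNIV \<rightarrow>\<^sub>E \<T>). \<exists>q. fits b q}"
  define \<B> where "\<B> = (\<lambda>b. SOME q. fits b q) ` D"
  have fits: "fits b (SOME q. fits b q)" if "b \<in> D" for b using that unfolding D_def by (auto intro: someI_ex)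
  show ?thesis
  proof (rule that[of \<B>])
    have "countable ((UNIV :: 'k set) \<rightarrow>\<^sub>E \<T>)" by (intro countable_PiE \<T>(1)) simp
    then have "countable D" by (rule countable_subset[rotated]) (auto simp: D_def)
    then show "countable \<B>" by (simp add: \<B>_def)
    show "\<forall>(c, x, r)\<in>\<B>. chart_box A c x r"
    proof (clarify)
      fix c x r assume "(c, x, r) \<in> \<B>"
      then obtain b where b: "b \<in> D" "(SOME q. fits b q) = (c, x, r)" unfolding \<B>_def by force
      show "chart_box A c x r" using fits[OF b(1), unfolded b(2)] by (simp add: fits_def)
    qed
    show "\<forall>\<gamma>\<in>(config_space A :: ('m ^ 'k) set). \<exists>(c, x, r)\<in>\<B>. \<forall>i. \<gamma> $ i \<in> chart_inv (c i) ` cball (x i) (r i)"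
    proof
    fix \<gamma> :: "'m ^ 'k" assume \<gamma>: "\<gamma> \<in> config_space A"
    then have ne: "\<gamma> $ i \<noteq> \<gamma> $ j" if "i \<noteq> j" for i j using that by (auto simp: config_space_def fat_diagonal_def)
    obtain W where W: "\<And>i. open (W i)" "\<And>i. \<gamma> $ i \<in> W i" "\<And>i j. i \<noteq> j \<Longrightarrow> W i \<inter> W j = {}"
      using disjoint_open_neighbourhoods[of \<gamma>] ne by blast
    have "\<forall>i. \<exists>d. d \<in> A \<and> \<gamma> $ i \<in> fst d" using \<gamma> by (simp add: config_space_def carrier_of_def Bex_def)
    then obtain c where c: "\<And>i. c i \<in> A" "\<And>i. \<gamma> $ i \<in> fst (c i)" by metis
    have cc: "is_chart (c i)" for i using A c(1) by (simp add: smooth_atlas_def)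
    define x where "x i = snd (c i) (\<gamma> $ i)" for i
    have "\<exists>e>0. cball (x i) e \<subseteq> snd (c i) ` (fst (c i) \<inter> W i)" for i
    proof -
      have "x i \<in> snd (c i) ` (fst (c i) \<inter> W i)" using c W(2) by (auto simp: x_def)
      then show ?thesis using open_contains_cball chart_image_open[OF cc W(1)] by blast
    qed
    then obtain e where e: "\<And>i. e i > 0" "\<And>i. cball (x i) (e i) \<subseteq> snd (c i) ` (fst (c i) \<inter> W i)" by metis
    define r where "r i = e i / 2" for i
    have PW: "chart_inv (c i) ` cball (x i) (2 * r i) \<subseteq> W i" for i
    proof
      fix p assume "p \<in> chart_inv (c i) ` cball (x i) (2 * r i)"
      then obtain z where z: "z \<in> cball (x i) (e i)" "p = chart_inv (c i) z" by (auto simp: r_def)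
      then obtain q where "q \<in> fst (c i)" "q \<in> W i" "z = snd (c i) q" using e(2)[of i] by blast
      then show "p \<in> W i" using z(2) by (simp add: chart_inv_left[OF cc])
    qed
    have box: "chart_box A c x r"
    proof unfold_locales
      show "smooth_atlas A" by fact
      show "c i \<in> A" for i by (rule c(1))
      show "r i > 0" for i using e(1) by (simp add: r_def)
      show "cball (x i) (2 * r i) \<subseteq> snd (c i) ` fst (c i)" for i using e(2)[of i] by (auto simp: r_def)
      show "chart_inv (c i) ` cball (x i) (2 * r i) \<inter> chart_inv (c j) ` cball (x j) (2 * r j) = {}" if "i \<noteq> j" for i j
        using PW[of i] PW[of j] W(3)[OF that] by blast
    qed
    have "\<exists>B\<in>\<T>. \<gamma> $ i \<in> B \<and> B \<subseteq> chart_inv (c i) ` cball (x i) (r i)" for i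
    proof -
      have "open {p \<in> fst (c i). snd (c i) p \<in> ball (x i) (r i)}" by (rule chart_vimage_open[OF cc open_ball])
      moreover have "\<gamma> $ i \<in> {p \<in> fst (c i). snd (c i) p \<in> ball (x i) (r i)}" using c(2) e(1) by (simp add: x_def r_def)
      ultimately obtain B where B: "B \<in> \<T>" "\<gamma> $ i \<in> B" "B \<subseteq> {p \<in> fst (c i). snd (c i) p \<in> ball (x i) (r i)}"
        by (rule topological_basisE[OF \<T>(2)])
      have "B \<subseteq> chart_inv (c i) ` cball (x i) (r i)"
      proof
        fix p assume "p \<in> B"
        then have p: "p \<in> fst (c i)" "snd (c i) p \<in> cball (x i) (r i)" using B(3) by auto
        then show "p \<in> chart_inv (c i) ` cball (x i) (r i)"
          using chart_inv_left[OF cc p(1)] by (metis image_eqI)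
      qed
      then show ?thesis using B by blast
    qed
    then obtain b where b: "\<And>i. b i \<in> \<T>" "\<And>i. \<gamma> $ i \<in> b i" "\<And>i. b i \<subseteq> chart_inv (c i) ` cball (x i) (r i)" by metis
    have "fits b (c, x, r)" using box b(3) by (simp add: fits_def)
    then have bD: "b \<in> D" using b(1) unfolding D_def by (auto simp: PiE_iff)
    \<comment> \<open>The box selected for the tuple b need not be the one built around \<gamma>,
      but it contains the sets of b and hence \<gamma>.\<close>
    obtain c' x' r' where q: "(SOME q. fits b q) = (c', x', r')" by (metis prod_cases3)
    have "\<forall>i. \<gamma> $ i \<in> chart_inv (c' i) ` cball (x' i) (r' i)"
    proof
      fix i
      have "b i \<subseteq> chart_inv (c' i) ` cball (x' i) (r' i)" using fits[OF bD, unfolded q] by (simp add: fits_def)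
      then show "\<gamma> $ i \<in> chart_inv (c' i) ` cball (x' i) (r' i)" using b(2) by blast
    qed
    moreover have "(c', x', r') \<in> \<B>" using bD q unfolding \<B>_def by (metis image_eqI)
    ultimately show "\<exists>(c, x, r)\<in>\<B>. \<forall>i. \<gamma> $ i \<in> chart_inv (c i) ` cball (x i) (r i)" by blast
    qed
  qed
qed

theorem theorem1:
  fixes A :: "('m::{t2_space, second_countable_topology}, 'e::euclidean_space) chart set"
    and g :: "'m \<Rightarrow> 'm tangent \<Rightarrow> 'm tangent \<Rightarrow> real"
    and s :: nat
  assumes "smooth_atlas A"
    and "connected (carrier_of A)"
    and "riemannian_metric A g"
    and "DIM('e) \<ge> 2"
    and "s \<ge> 2"
  shows "\<exists>L::nat. \<forall>l\<ge>L. \<exists>R.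
    residual_in (product_topology (\<lambda>_. whitney_topology A l) {..<s}) R \<and>
    (\<forall>f\<in>R. \<forall>\<gamma>\<in>(config_space A :: ('m ^ 'k) set).
      bracket_generating_at (config_atlas A) ((\<lambda>j. nfold A (f j)) ` {..<s}) \<gamma>)"
proof -
  note A = assms(1) and s = assms(5)
  obtain \<B> :: "(('k \<Rightarrow> ('m, 'e) chart) \<times> ('k \<Rightarrow> 'e) \<times> ('k \<Rightarrow> real)) set" where \<B>: "countable \<B>"
    "\<forall>(c, x, r)\<in>\<B>. chart_box A c x r"
    "\<forall>\<gamma>\<in>(config_space A :: ('m ^ 'k) set). \<exists>(c, x, r)\<in>\<B>. \<forall>i. \<gamma> $ i \<in> chart_inv (c i) ` cball (x i) (r i)"
    by (rule countable_chart_boxes[OF A])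
  show ?thesis
  \<comment> \<open>The threshold is 2nN - 1: the longest bracket used applies ad that many times,
    and so takes as many derivatives of the fields.\<close>
  proof (intro exI[of _ "CARD(('e ^ 'k) basis_index \<times> bool) - 1"] allI impI)
    fix l assume l: "CARD(('e ^ 'k) basis_index \<times> bool) - 1 \<le> l"
    let ?T = "product_topology (\<lambda>_. whitney_topology A l) {..<s}"
    define G where "G = (\<lambda>(c :: 'k \<Rightarrow> ('m, 'e) chart, x, r). {f \<in> topspace ?T. chart_box.generic_pair c x r (f 0) (f 1)})"
    have G: "openin ?T (G q) \<and> ?T closure_of (G q) = topspace ?T" if "q \<in> \<B>" for q
    proof -
      obtain c x r where q: "q = (c, x, r)" by (metis prod_cases3)
      interpret chart_box A c x r using \<B>(2) that q by auto
      have l': "top_order \<le> l" using l by (simp only: top_order_def)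
      have Gq: "G q = {f \<in> topspace ?T. good box all_brackets (f 0) (f 1)}"
        by (simp only: G_def q case_prod_conv generic_pair_def)
      show ?thesis unfolding dense_intersects_open
      proof (intro conjI allI impI)
        show "openin ?T (G q)" unfolding Gq by (rule openin_good[OF s l'])
        fix U assume U: "openin ?T U \<and> U \<noteq> {}"
        then obtain f where "f \<in> U" by blast
        then obtain f' where "f' \<in> U" "good box all_brackets (f' 0) (f' 1)"
          using good_dense[OF s l' conjunct1[OF U]] by blast
        then show "G q \<inter> U \<noteq> {}" using openin_subset[OF conjunct1[OF U]] unfolding Gq by blast
      qed
    qed
    let ?R = "topspace ?T \<inter> \<Inter> (G ` \<B>)"
    have "residual_in ?T ?R"
      unfolding residual_in_def using \<B>(1) G by (intro conjI exI[of _ "G ` \<B>"]) auto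
    moreover have "bracket_generating_at (config_atlas A) ((\<lambda>j. nfold A (f j)) ` {..<s}) \<gamma>"
      if f: "f \<in> ?R" and \<gamma>: "\<gamma> \<in> (config_space A :: ('m ^ 'k) set)" for f \<gamma>
    proof -
      obtain c x r where q: "(c, x, r) \<in> \<B>" "\<And>i. \<gamma> $ i \<in> chart_inv (c i) ` cball (x i) (r i)"
        using \<B>(3) \<gamma> by blast
      interpret chart_box A c x r using \<B>(2) q(1) by blast
      have "f \<in> G (c, x, r)" using f q(1) by blast
      then have "f \<in> {..<s} \<rightarrow>\<^sub>E vector_fields A" "generic_pair (f 0) (f 1)" by (simp_all add: G_def)
      then show ?thesis by (rule generic_pair_bracket_generating[OF s _ _ q(2)])
    qed
    ultimately show "\<exists>R. residual_in ?T R \<and> (\<forall>f\<in>R. \<forall>\<gamma>\<in>(config_space A :: ('m ^ 'k) set).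
      bracket_generating_at (config_atlas A) ((\<lambda>j. nfold A (f j)) ` {..<s}) \<gamma>)" by blast
  qed
qed

end
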